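(* Let $P=\{\mathbf{x}\in\mathbb{R}^n: A\mathbf{x}\le\mathbf{b}\}$ be a full-dimensional polytope, and suppose $\mathbf{b}$ is sufficiently generic that $P$ is simple. Let $\delta$ be the minimal distance, over all vertices of $P$ and all rays of the normal cone at that vertex, of the unit-length generator of the ray to the linear hyperplane spanned by all other rays of that normal cone. Then the expected number of vertices of a uniformly random shadow of $P$ is bounded by $O\!\left(\frac{n^2}{\delta}\right)$, i.e. by $c\,n^2/\delta$ for an absolute constant $c$.
   Context: The normal cone of $P$ at a vertex $v$ is $\{c\in\mathbb{R}^n: c^{\intercal}v=\max_{x\in P}c^{\intercal}x\}$; for a simple full-dimensional polytope it is a simplicial cone with $n$ extreme rays. A uniformly random shadow of $P$ is $\pi(P)$ with $\pi(x)=(U^{\intercal}x,V^{\intercal}x)$, where $(U,V)$ is a uniformly random pair of unit vectors in $\mathbb{R}^n$ with $U^{\intercal}V=0$. *)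

theory Defs
  imports "HOL-Probability.Probability"
begin

text \<open>
  The constant in the bound must not depend on the dimension, so the dimension has to be
  quantified inside the formula and cannot be a type.  All spaces \<open>\<real>\<^sup>n\<close> are therefore
  realised inside one inner product space, that of finitely supported real sequences, as the
  subspaces \<open>Rn n\<close> of the sequences vanishing from index \<open>n\<close> on.
\<close>

typedef rvec = "{f :: nat \<Rightarrow> real. finite {i. f i \<noteq> 0}}"
  morphisms coord Abs_rvec
  by (rule exI[of _ "\<lambda>_. 0"]) simp

setup_lifting type_definition_rvec

lemma rvec_eq_iff: "x = y \<longleftrightarrow> (\<forall>i. coord x i = coord y i)"
  by (metis coord_inject ext)

lemma finite_coord [simp]: "finite {i. coord x i \<noteq> 0}"
  using coord[of x] by simp

instantiation rvec :: real_vector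
begin

lift_definition zero_rvec :: rvec is "\<lambda>_. 0"
  by simp

lift_definition plus_rvec :: "rvec \<Rightarrow> rvec \<Rightarrow> rvec" is "\<lambda>f g i. f i + g i"
  subgoal for f g by (rule finite_subset[of _ "{i. f i \<noteq> 0} \<union> {i. g i \<noteq> 0}"]) auto
  done

lift_definition uminus_rvec :: "rvec \<Rightarrow> rvec" is "\<lambda>f i. - f i"
  by simp

lift_definition minus_rvec :: "rvec \<Rightarrow> rvec \<Rightarrow> rvec" is "\<lambda>f g i. f i - g i"
  subgoal for f g by (rule finite_subset[of _ "{i. f i \<noteq> 0} \<union> {i. g i \<noteq> 0}"]) auto
  done

lift_definition scaleR_rvec :: "real \<Rightarrow> rvec \<Rightarrow> rvec" is "\<lambda>r f i. r * f i"
  by simp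

instance
  by standard (transfer; simp add: algebra_simps)+

end

lemma coord_simps [simp]:
  "coord 0 i = 0" "coord (x + y) i = coord x i + coord y i" "coord (- x) i = - coord x i"
  "coord (x - y) i = coord x i - coord y i" "coord (r *\<^sub>R x) i = r * coord x i"
  by (transfer; simp)+

instantiation rvec :: real_inner
begin

definition inner_rvec :: "rvec \<Rightarrow> rvec \<Rightarrow> real" where
  "inner_rvec x y = (\<Sum>i | coord x i \<noteq> 0. coord x i * coord y i)"

definition norm_rvec :: "rvec \<Rightarrow> real" where
  "norm_rvec x = sqrt (inner x x)"

definition sgn_rvec :: "rvec \<Rightarrow> rvec" where
  "sgn_rvec x = x /\<^sub>R norm x"

definition dist_rvec :: "rvec \<Rightarrow> rvec \<Rightarrow> real" where
  "dist_rvec x y = norm (x - y)"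

definition uniformity_rvec :: "(rvec \<times> rvec) filter" where
  "uniformity_rvec = (INF e\<in>{0<..}. principal {(x, y). dist x y < e})"

definition open_rvec :: "rvec set \<Rightarrow> bool" where
  "open_rvec U \<longleftrightarrow> (\<forall>x\<in>U. eventually (\<lambda>(x', y). x' = x \<longrightarrow> y \<in> U) uniformity)"

lemma inner_rvec_superset:
  assumes "finite I" "{i. coord x i \<noteq> 0} \<subseteq> I"
  shows "inner x y = (\<Sum>i\<in>I. coord x i * coord y i)"
  unfolding inner_rvec_def using assms by (intro sum.mono_neutral_left) auto

instance
proof
  fix x y z :: rvec and r :: real
  define I where "I = {i. coord x i \<noteq> 0} \<union> {i. coord y i \<noteq> 0}"
  have I: "finite I" "{i. coord x i \<noteq> 0} \<subseteq> I" "{i. coord y i \<noteq> 0} \<subseteq> I"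
    "{i. coord (x + y) i \<noteq> 0} \<subseteq> I" "{i. coord (r *\<^sub>R x) i \<noteq> 0} \<subseteq> I"
    by (auto simp: I_def)
  show "inner x y = inner y x"
    unfolding inner_rvec_superset[OF I(1,2)] inner_rvec_superset[OF I(1,3)]
    by (simp add: mult.commute)
  show "inner (x + y) z = inner x z + inner y z"
    unfolding inner_rvec_superset[OF I(1,2)] inner_rvec_superset[OF I(1,3)]
      inner_rvec_superset[OF I(1,4)]
    by (simp add: algebra_simps sum.distrib)
  show "inner (r *\<^sub>R x) y = r * inner x y"
    unfolding inner_rvec_superset[OF I(1,2)] inner_rvec_superset[OF I(1,5)]
    by (simp add: sum_distrib_left mult.assoc)
  show "0 \<le> inner x x"
    unfolding inner_rvec_def by (intro sum_nonneg) auto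
  show "inner x x = 0 \<longleftrightarrow> x = 0"
    unfolding inner_rvec_def by (subst sum_nonneg_eq_0_iff) (auto simp: rvec_eq_iff)
qed (auto simp: norm_rvec_def sgn_rvec_def dist_rvec_def uniformity_rvec_def open_rvec_def)

end

definition Rn :: "nat \<Rightarrow> rvec set" where
  "Rn n = {x. \<forall>i\<ge>n. coord x i = 0}"

lemma inner_Rn:
  assumes "x \<in> Rn n"
  shows "x \<bullet> y = (\<Sum>i<n. coord x i * coord y i)"
  using assms by (intro inner_rvec_superset) (auto simp: Rn_def not_le[symmetric])

definition polyhedron_of :: "nat \<Rightarrow> nat \<Rightarrow> (nat \<Rightarrow> nat \<Rightarrow> real) \<Rightarrow> (nat \<Rightarrow> real) \<Rightarrow> rvec set" where
  "polyhedron_of m n A b = {x \<in> Rn n. \<forall>i<m. (\<Sum>j<n. A i j * coord x j) \<le> b i}"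

text \<open>
  The library's \<open>aff_dim\<close> and \<open>facet_of\<close> are restricted to \<open>euclidean_space\<close>; the following
  two definitions restate them for arbitrary real vector spaces.
\<close>

definition has_aff_dim :: "'a::real_vector set \<Rightarrow> nat \<Rightarrow> bool" where
  "has_aff_dim S d \<longleftrightarrow>
     (\<exists>B. finite B \<and> \<not> affine_dependent B \<and> affine hull B = affine hull S \<and> card B = d + 1)"

definition is_facet :: "'a::real_vector set \<Rightarrow> 'a set \<Rightarrow> bool" where
  "is_facet F P \<longleftrightarrow> F face_of P \<and> (\<exists>d. has_aff_dim P (d + 1) \<and> has_aff_dim F d)"

definition vertices :: "'a::real_vector set \<Rightarrow> 'a set" where
  "vertices P = {v. v extreme_point_of P}"

definition is_simple :: "'a::real_vector set \<Rightarrow> bool" where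
  "is_simple P \<longleftrightarrow>
     (\<exists>d. has_aff_dim P d \<and> (\<forall>v\<in>vertices P. card {F. is_facet F P \<and> v \<in> F} = d))"

definition normal_cone :: "nat \<Rightarrow> rvec set \<Rightarrow> rvec \<Rightarrow> rvec set" where
  "normal_cone n P v = {c \<in> Rn n. \<forall>x\<in>P. c \<bullet> x \<le> c \<bullet> v}"

text \<open>The extreme rays of a cone are its faces that are half-lines from the origin.\<close>

definition ray_generators :: "'a::real_normed_vector set \<Rightarrow> 'a set" where
  "ray_generators C = {g. norm g = 1 \<and> {t *\<^sub>R g | t. 0 \<le> t} face_of C}"

text \<open>For a simple full-dimensional polytope the set below is finite and nonempty, so that the
  infimum is a minimum.\<close>

definition delta :: "nat \<Rightarrow> rvec set \<Rightarrow> real" where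
  "delta n P = Inf {infdist g (span (ray_generators (normal_cone n P v) - {g})) | v g.
     v \<in> vertices P \<and> g \<in> ray_generators (normal_cone n P v)}"

definition orthonormal_pairs :: "nat \<Rightarrow> (rvec \<times> rvec) set" where
  "orthonormal_pairs n = {(u, v). u \<in> Rn n \<and> v \<in> Rn n \<and> norm u = 1 \<and> norm v = 1 \<and> u \<bullet> v = 0}"

text \<open>
  The uniform distribution on orthonormal pairs is the unique Borel probability measure on them
  that is invariant under the orthogonal group of \<open>\<real>\<^sup>n\<close> acting diagonally.  Every orthogonal map of
  \<open>Rn n\<close> extends, by the identity on the remaining coordinates, to an orthogonal transformation of
  the whole space.
\<close>

definition uniform_orthonormal_pair :: "nat \<Rightarrow> (rvec \<times> rvec) measure \<Rightarrow> bool" where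
  "uniform_orthonormal_pair n M \<longleftrightarrow>
     prob_space M \<and> sets M = sets (restrict_space borel (orthonormal_pairs n)) \<and>
     (\<forall>T. orthogonal_transformation T \<and> T ` Rn n = Rn n \<longrightarrow> distr M M (map_prod T T) = M)"

definition shadow :: "rvec \<Rightarrow> rvec \<Rightarrow> rvec set \<Rightarrow> (real \<times> real) set" where
  "shadow u v P = (\<lambda>x. (u \<bullet> x, v \<bullet> x)) ` P"

end

theory Submission
  imports Defs
begin

text \<open>
  The vertices of the shadow correspond to distinct vertices of \<open>P\<close> whose normal cones are met by
  the random plane \<open>E\<close> spanned by \<open>U\<close> and \<open>V\<close>.  As normal cones are pointed, a plane that meets
  such a cone \<open>N\<close> outside the origin also meets one of its \<open>n\<close> facets.  Let \<open>F\<close> be a facet with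
  unit normal \<open>\<nu>\<close> and opposite generator \<open>g\<close>.  Almost surely \<open>E\<close> meets the hyperplane of \<open>F\<close> in the
  line through \<open>(V \<bullet> \<nu>) U - (U \<bullet> \<nu>) V\<close>, whose direction is invariant under the rotations fixing \<open>\<nu>\<close>
  and hence uniform, so \<open>E\<close> meets \<open>F\<close> with probability at most twice the fraction of the unit ball
  of the hyperplane covered by \<open>F\<close>.  Sweeping the unit-ball part of \<open>F\<close> in direction \<open>g\<close> up to
  height \<open>\<delta> / n\<close> above the hyperplane stays inside \<open>N\<close> and inside the ball of radius \<open>1 + 1 / n\<close>, so
  this fraction is at most \<open>2 e n / \<delta>\<close> times the fraction of the \<open>n\<close>-dimensional ball covered by
  \<open>N\<close>.  The normal cones of distinct vertices overlap in null sets, so summing over the \<open>n\<close> facets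
  of every normal cone gives \<open>4 e n\<^sup>2 / \<delta>\<close>.
\<close>

section \<open>The space of finitely supported sequences, and reflections\<close>

text \<open>Nothing is known of the random pair beyond its invariance, so probabilities come from
  the uniqueness of uniform measures and not from integration in coordinates. One reflection
  exchanges two given vectors of equal norm, so reflections can stand in for the whole orthogonal
  group. Since the dimension is a variable and not a type, Lebesgue measure on \<open>Rn n\<close>
  and on its hyperplanes is built as an image of a product measure. The distance \<delta> enters
  because \<open>g \<bullet> \<nu>\<close> is the distance of \<open>g\<close> from the span of the
  other generators. In the constant \<open>4 * exp 1\<close>, one 2 counts the two orientations of
  the crossing line, which may lie in \<open>F\<close> or in \<open>- F\<close>; the other 2 bounds
  the volume of the n-dimensional ball by that of its equatorial ball; the height
  \<open>\<delta> / n\<close> is chosen so that the enlargement \<open>(1 + 1 / n) ^ n\<close> stays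
  below \<open>exp 1\<close>. That choice costs one factor n; the n facets of each cone cost the
  other.\<close>

definition unit_vec :: "nat \<Rightarrow> rvec" where
  "unit_vec i = Abs_rvec (\<lambda>j. if j = i then 1 else 0)"

lemma coord_unit_vec [simp]: "coord (unit_vec i) j = (if j = i then 1 else 0)"
proof -
  have "finite {j. (if j = i then 1 else (0::real)) \<noteq> 0}" by simp
  then show ?thesis unfolding unit_vec_def by (subst Abs_rvec_inverse) auto
qed

lemma inner_unit_vec: "unit_vec i \<bullet> x = coord x i"
  by (subst inner_rvec_superset[of "{i}"]) auto

lemma inner_unit_vec_unit_vec: "unit_vec i \<bullet> unit_vec j = (if i = j then 1 else 0)"
  by (simp add: inner_unit_vec)

lemma norm_unit_vec [simp]: "norm (unit_vec i) = 1"
  by (simp add: norm_eq_sqrt_inner inner_unit_vec_unit_vec)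

lemma coord_sum [simp]: "coord (\<Sum>i\<in>I. f i) j = (\<Sum>i\<in>I. coord (f i) j)"
  by (induction I rule: infinite_finite_induct) auto

lemma Rn_expand:
  assumes "x \<in> Rn n"
  shows "x = (\<Sum>i<n. coord x i *\<^sub>R unit_vec i)"
  using assms by (auto simp: rvec_eq_iff Rn_def if_distrib cong: if_cong)

lemma rvec_expand: "\<exists>n. x \<in> Rn n"
proof -
  obtain n where "\<And>i. i \<in> {i. coord x i \<noteq> 0} \<Longrightarrow> i < n"
    using finite_nat_set_iff_bounded[of "{i. coord x i \<noteq> 0}"] by auto
  then have "x \<in> Rn n" unfolding Rn_def by (auto simp: not_less[symmetric])
  then show ?thesis ..
qed

lemma subspace_Rn: "subspace (Rn n)"
  by (auto simp: subspace_def Rn_def)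

lemma unit_vec_Rn: "i < n \<Longrightarrow> unit_vec i \<in> Rn n"
  by (auto simp: Rn_def)

lemma span_unit_vec: "span (unit_vec ` {..<n}) = Rn n"
proof
  show "span (unit_vec ` {..<n}) \<subseteq> Rn n"
    by (rule span_minimal) (auto simp: subspace_Rn unit_vec_Rn)
  show "Rn n \<subseteq> span (unit_vec ` {..<n})"
  proof
    fix x assume "x \<in> Rn n"
    then show "x \<in> span (unit_vec ` {..<n})"
      by (subst Rn_expand, assumption, intro span_sum span_scale) (auto intro: span_base)
  qed
qed

definition rat_vec :: "rat list \<Rightarrow> rvec" where
  "rat_vec l = (\<Sum>i<length l. of_rat (l ! i) *\<^sub>R unit_vec i)"

lemma rat_vec_dense:
  assumes "e > 0"
  shows "\<exists>l. dist (rat_vec l) x < e"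
proof -
  obtain n where n: "x \<in> Rn n" using rvec_expand by blast
  \<comment> \<open>The n coordinate errors add up to at most \<open>n * e / (n + 1)\<close>, which
    is below \<open>e\<close> even for \<open>n = 0\<close>.\<close>
  define d where "d = e / (real n + 1)"
  have "d > 0" using assms by (simp add: d_def)
  have "\<exists>q. \<bar>of_rat q - coord x i\<bar> < d" for i
  proof -
    obtain q where "coord x i < real_of_rat q" "real_of_rat q < coord x i + d"
      using of_rat_dense[of "coord x i" "coord x i + d"] \<open>d > 0\<close> by auto
    then show ?thesis by (intro exI[of _ q]) auto
  qed
  then obtain q where q: "\<And>i. \<bar>of_rat (q i) - coord x i\<bar> < d" by metis
  define l where "l = map q [0..<n]"
  have "rat_vec l - x = (\<Sum>i<n. (of_rat (q i) - coord x i) *\<^sub>R unit_vec i)"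
    by (subst Rn_expand[OF n]) (simp add: rat_vec_def l_def sum_subtractf algebra_simps)
  then have "norm (rat_vec l - x) \<le> (\<Sum>i<n. \<bar>of_rat (q i) - coord x i\<bar>)"
    by (simp add: sum_norm_le)
  also have "\<dots> \<le> (\<Sum>i<n. d)" using q by (intro sum_mono less_imp_le)
  also have "\<dots> < e" using assms by (simp add: d_def field_simps)
  finally show ?thesis by (auto simp: dist_norm)
qed

text \<open>Second countability makes the Borel sets of pairs the product of the Borel sets and the
  vector operations measurable; the countable base consists of balls with rational radii around
  rational sequences.\<close>

instance rvec :: second_countable_topology
proof
  define B where "B = (\<lambda>(l, q). ball (rat_vec l) (of_rat q)) ` (UNIV :: (rat list \<times> rat) set)"
  have "topological_basis B"
  proof (rule topological_basisI)
    show "open S" if "S \<in> B" for S using that by (auto simp: B_def)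
    fix S :: "rvec set" and x assume "open S" "x \<in> S"
    then obtain e where e: "e > 0" "ball x e \<subseteq> S" by (meson openE)
    obtain q where q: "0 < real_of_rat q" "real_of_rat q < e / 2"
      using of_rat_dense[of 0 "e / 2"] e by auto
    obtain l where l: "dist (rat_vec l) x < of_rat q" using rat_vec_dense[OF q(1)] by blast
    have "ball (rat_vec l) (of_rat q) \<subseteq> ball x e"
    proof
      fix y assume "y \<in> ball (rat_vec l) (of_rat q)"
      then have "dist x y < of_rat q + of_rat q"
        using l dist_triangle[of x y "rat_vec l"] by (simp add: dist_commute)
      then show "y \<in> ball x e" using q by simp
    qed
    with e l show "\<exists>T\<in>B. x \<in> T \<and> T \<subseteq> S"
      by (intro bexI[of _ "ball (rat_vec l) (of_rat q)"]) (auto simp: B_def)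
  qed
  moreover have "countable B" by (simp add: B_def)
  ultimately show "\<exists>B :: rvec set set. countable B \<and> open = generate_topology B"
    using topological_basis_imp_subbasis by blast
qed

text \<open>For \<open>w = 0\<close> the quotient is 0 by the convention for division, so the map is
  the identity and the facts below hold for every \<open>w\<close>.\<close>

definition reflect :: "'a::real_inner \<Rightarrow> 'a \<Rightarrow> 'a" where
  "reflect w x = x - (2 * (x \<bullet> w) / (w \<bullet> w)) *\<^sub>R w"

lemma reflect_linear: "linear (reflect w)"
  by (rule linearI) (auto simp: reflect_def inner_add_left algebra_simps add_divide_distrib)

lemma reflect_reflect [simp]: "reflect w (reflect w x) = x"
  by (cases "w = 0") (auto simp: reflect_def inner_diff_left algebra_simps)

lemma inner_reflect_left: "reflect w x \<bullet> y = x \<bullet> reflect w y"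
  by (simp add: reflect_def inner_diff_left inner_diff_right inner_commute)

lemma orthogonal_transformation_reflect: "orthogonal_transformation (reflect w)"
  by (simp add: orthogonal_transformation_def reflect_linear inner_reflect_left)

lemma norm_reflect [simp]: "norm (reflect w x) = norm x"
  using orthogonal_transformation_reflect orthogonal_transformation by blast

lemma dist_reflect [simp]: "dist (reflect w x) (reflect w y) = dist x y"
  by (simp add: dist_norm flip: linear_diff[OF reflect_linear])

lemma reflect_fixes: "x \<bullet> w = 0 \<Longrightarrow> reflect w x = x"
  by (simp add: reflect_def)

text \<open>The hyperplane orthogonal to \<open>x - y\<close> is the perpendicular bisector of
  \<open>x\<close> and \<open>y\<close>. This gives transitivity on spheres inside any subspace
  containing both points.\<close>

lemma reflect_diff_eq:
  assumes "norm x = norm y"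
  shows "reflect (x - y) x = y"
proof (cases "x = y")
  case False
  have "x \<bullet> x = y \<bullet> y" using assms by (simp add: norm_eq)
  then have *: "2 * (x \<bullet> (x - y)) = (x - y) \<bullet> (x - y)"
    by (simp add: inner_diff_left inner_diff_right inner_commute)
  show ?thesis using False unfolding reflect_def * by simp
qed (simp add: reflect_def)

lemma reflect_in_subspace: "subspace V \<Longrightarrow> w \<in> V \<Longrightarrow> x \<in> V \<Longrightarrow> reflect w x \<in> V"
  unfolding reflect_def by (intro subspace_diff subspace_scale)

lemma reflect_image_subspace: "subspace V \<Longrightarrow> w \<in> V \<Longrightarrow> reflect w ` V = V"
  by (metis reflect_in_subspace reflect_reflect image_eqI subsetI equalityI image_subset_iff)

lemma reflect_measurable [measurable]:
  "reflect (w :: 'a::{real_inner, second_countable_topology}) \<in> borel_measurable borel"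
  unfolding reflect_def by measurable

section \<open>Uniformly distributed measures\<close>

text \<open>
  Christensen's argument.  By Fubini both measures give balls of radius \<open>r\<close> centred in \<open>S\<close> the same
  mass \<open>h r\<close>.  Again by Fubini, the average over \<open>x \<in> U\<close> of \<open>\<sigma> (U \<inter> ball x r) / h r\<close> is at most
  \<open>\<sigma> U\<close>, while its integrand tends to \<open>1\<close> as \<open>r\<close> tends to \<open>0\<close>; Fatou's lemma concludes.
\<close>

lemma uniformly_distributed_open_le:
  fixes \<mu> \<sigma> :: "'a::{metric_space, second_countable_topology} measure"
  assumes "prob_space \<mu>" "prob_space \<sigma>"
    and sets [measurable_cong]: "sets \<mu> = sets borel" "sets \<sigma> = sets borel"
    and AE: "AE x in \<mu>. x \<in> S" "AE x in \<sigma>. x \<in> S"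
    and hom: "\<And>x y r. x \<in> S \<Longrightarrow> y \<in> S \<Longrightarrow> emeasure \<mu> (ball x r) = emeasure \<mu> (ball y r)"
      "\<And>x y r. x \<in> S \<Longrightarrow> y \<in> S \<Longrightarrow> emeasure \<sigma> (ball x r) = emeasure \<sigma> (ball y r)"
    and "open U"
  shows "emeasure \<mu> U \<le> emeasure \<sigma> U"
proof -
  interpret \<mu>: prob_space \<mu> by fact
  interpret \<sigma>: prob_space \<sigma> by fact
  interpret pair_sigma_finite \<mu> \<sigma> ..
  have spaces: "space \<mu> = UNIV" "space \<sigma> = UNIV"
    using sets_eq_imp_space_eq[OF sets(1)] sets_eq_imp_space_eq[OF sets(2)] by auto
  have "S \<noteq> {}"
    using AE(1) \<mu>.ae_filter_bot by (auto simp: trivial_limit_def)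
  then obtain s where s: "s \<in> S" by blast
  define h where "h r = emeasure \<sigma> (ball s r)" for r
  have h\<sigma>: "emeasure \<sigma> (ball x r) = h r" if "x \<in> S" for x r
    using hom(2)[OF that s] by (simp add: h_def)
  \<comment> \<open>Both sides measure the pairs in \<open>V\<close> at distance below
    \<open>r\<close>. With \<open>V = UNIV\<close> this compares the masses of balls, with
    \<open>V = U\<close> it bounds the averages of \<open>f k\<close>.\<close>
  have swap: "(\<integral>\<^sup>+x. indicator V x * emeasure \<sigma> (V \<inter> ball x r) \<partial>\<mu>)
            = (\<integral>\<^sup>+y. indicator V y * emeasure \<mu> (V \<inter> ball y r) \<partial>\<sigma>)" if "open V" for V r
  proof -
    have [measurable]: "V \<in> sets borel" using that by simp
    have "(\<integral>\<^sup>+x. indicator V x * emeasure \<sigma> (V \<inter> ball x r) \<partial>\<mu>)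
        = (\<integral>\<^sup>+x. \<integral>\<^sup>+y. (if x \<in> V \<and> y \<in> V \<and> dist x y < r then 1 else 0) \<partial>\<sigma> \<partial>\<mu>)"
    proof (intro nn_integral_cong)
      fix x
      have "(\<integral>\<^sup>+y. (if x \<in> V \<and> y \<in> V \<and> dist x y < r then 1 else 0) \<partial>\<sigma>)
          = (\<integral>\<^sup>+y. indicator V x * indicator (V \<inter> ball x r) y \<partial>\<sigma>)"
        by (intro nn_integral_cong) (auto simp: indicator_def)
      also have "\<dots> = indicator V x * emeasure \<sigma> (V \<inter> ball x r)"
        using that by (subst nn_integral_cmult) (auto simp: sets intro!: borel_measurable_indicator)
      finally show "indicator V x * emeasure \<sigma> (V \<inter> ball x r)
          = (\<integral>\<^sup>+y. (if x \<in> V \<and> y \<in> V \<and> dist x y < r then 1 else 0) \<partial>\<sigma>)" by simp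
    qed
    also have "\<dots> = (\<integral>\<^sup>+y. \<integral>\<^sup>+x. (if x \<in> V \<and> y \<in> V \<and> dist x y < r then 1 else 0) \<partial>\<mu> \<partial>\<sigma>)"
      by (rule Fubini'[symmetric]) measurable
    also have "\<dots> = (\<integral>\<^sup>+y. indicator V y * emeasure \<mu> (V \<inter> ball y r) \<partial>\<sigma>)"
    proof (intro nn_integral_cong)
      fix y
      have "(\<integral>\<^sup>+x. (if x \<in> V \<and> y \<in> V \<and> dist x y < r then 1 else 0) \<partial>\<mu>)
          = (\<integral>\<^sup>+x. indicator V y * indicator (V \<inter> ball y r) x \<partial>\<mu>)"
        by (intro nn_integral_cong) (auto simp: indicator_def dist_commute)
      also have "\<dots> = indicator V y * emeasure \<mu> (V \<inter> ball y r)"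
        using that by (subst nn_integral_cmult) (auto simp: sets intro!: borel_measurable_indicator)
      finally show "(\<integral>\<^sup>+x. (if x \<in> V \<and> y \<in> V \<and> dist x y < r then 1 else 0) \<partial>\<mu>)
          = indicator V y * emeasure \<mu> (V \<inter> ball y r)" .
    qed
    finally show ?thesis .
  qed
  have h\<mu>: "emeasure \<mu> (ball x r) = h r" if "x \<in> S" for x r
  proof -
    have "h r = (\<integral>\<^sup>+x. h r \<partial>\<mu>)" by (simp add: \<mu>.emeasure_space_1)
    also have "\<dots> = (\<integral>\<^sup>+x. emeasure \<sigma> (ball x r) \<partial>\<mu>)"
      using AE(1) by (intro nn_integral_cong_AE) (auto simp: h\<sigma>)
    also have "\<dots> = (\<integral>\<^sup>+y. emeasure \<mu> (ball y r) \<partial>\<sigma>)"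
      using swap[of UNIV r] by simp
    also have "\<dots> = (\<integral>\<^sup>+y. emeasure \<mu> (ball x r) \<partial>\<sigma>)"
      using AE(2) by (intro nn_integral_cong_AE) (auto elim!: eventually_mono simp: hom(1)[OF _ that])
    also have "\<dots> = emeasure \<mu> (ball x r)" by (simp add: \<sigma>.emeasure_space_1)
    finally show ?thesis by simp
  qed
  \<comment> \<open>If balls centred in \<open>S\<close> were null, then by Lindelof countably many
    of them would cover \<open>S\<close>, making a set of full measure null.\<close>
  have h_pos: "h r \<noteq> 0" if "r > 0" for r
  proof
    assume 0: "h r = 0"
    obtain F where F: "F \<subseteq> (\<lambda>x. ball x r) ` S" "countable F" "\<Union>F = \<Union>((\<lambda>x. ball x r) ` S)"
      using Lindelof[of "(\<lambda>x. ball x r) ` S"] by auto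
    have "\<Union>F \<in> null_sets \<sigma>"
    proof -
      have "(\<Union>T\<in>F. T) \<in> null_sets \<sigma>"
      proof (rule null_sets_UN')
        show "T \<in> null_sets \<sigma>" if T: "T \<in> F" for T
        proof -
          obtain x where "x \<in> S" "T = ball x r" using T F(1) by auto
          then show ?thesis using h\<sigma>[of x r] 0 by (auto simp: null_sets_def sets)
        qed
      qed fact
      then show ?thesis by simp
    qed
    then have "AE x in \<sigma>. x \<notin> \<Union>F" by (rule AE_not_in)
    with AE(2) have "AE x in \<sigma>. False"
    proof eventually_elim
      case (elim x)
      then have "x \<in> \<Union>((\<lambda>x. ball x r) ` S)" using that by force
      with elim F show False by simp
    qed
    then show False using \<sigma>.ae_filter_bot by (simp add: trivial_limit_def)
  qed
  have h_fin: "h r \<noteq> \<infinity>" for r by (simp add: h_def \<sigma>.emeasure_eq_measure)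
  have [measurable]: "U \<in> sets borel" using \<open>open U\<close> by simp
  define f where "f k x = indicator U x * emeasure \<sigma> (U \<inter> ball x (1 / Suc k)) / h (1 / Suc k)"
    for k :: nat and x
  have f_meas: "f k \<in> borel_measurable \<mu>" for k
  proof -
    \<comment> \<open>\<open>U \<inter> ball x r\<close> is the section at \<open>x\<close> of a
      measurable subset of the product, so its mass depends measurably on \<open>x\<close>.\<close>
    have "(\<lambda>x. emeasure \<sigma> (Pair x -` {p \<in> space (\<mu> \<Otimes>\<^sub>M \<sigma>). snd p \<in> U \<and> dist (fst p) (snd p) < 1 / Suc k}))
      \<in> borel_measurable \<mu>"
      by (rule \<sigma>.measurable_emeasure_Pair) measurable
    also have "(\<lambda>x. emeasure \<sigma> (Pair x -` {p \<in> space (\<mu> \<Otimes>\<^sub>M \<sigma>). snd p \<in> U \<and> dist (fst p) (snd p) < 1 / Suc k}))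
      = (\<lambda>x. emeasure \<sigma> (U \<inter> ball x (1 / Suc k)))"
      by (intro ext arg_cong[where f = "emeasure \<sigma>"]) (auto simp: space_pair_measure spaces)
    finally show ?thesis unfolding f_def by measurable
  qed
  have int_f: "(\<integral>\<^sup>+x. f k x \<partial>\<mu>) \<le> emeasure \<sigma> U" for k
  proof -
    let ?r = "1 / Suc k"
    have cancel: "a / h ?r * h ?r = a" for a
      using h_pos[of ?r] h_fin[of ?r] by (simp add: ennreal_divide_times ennreal_divide_self less_top)
    have "(\<integral>\<^sup>+x. f k x \<partial>\<mu>) * h ?r = (\<integral>\<^sup>+x. f k x * h ?r \<partial>\<mu>)"
      by (rule nn_integral_multc[symmetric, OF f_meas])
    also have "\<dots> = (\<integral>\<^sup>+x. indicator U x * emeasure \<sigma> (U \<inter> ball x ?r) \<partial>\<mu>)"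
      unfolding f_def cancel ..
    also have "\<dots> = (\<integral>\<^sup>+y. indicator U y * emeasure \<mu> (U \<inter> ball y ?r) \<partial>\<sigma>)"
      by (rule swap) fact
    also have "\<dots> \<le> (\<integral>\<^sup>+y. indicator U y * h ?r \<partial>\<sigma>)"
    proof (rule nn_integral_mono_AE)
      show "AE y in \<sigma>. indicator U y * emeasure \<mu> (U \<inter> ball y ?r) \<le> indicator U y * h ?r"
        using AE(2)
      proof eventually_elim
        case (elim y)
        have "emeasure \<mu> (U \<inter> ball y ?r) \<le> emeasure \<mu> (ball y ?r)"
          by (rule emeasure_mono) (auto simp: sets)
        then show ?case using h\<mu>[OF elim] by (simp add: mult_left_mono)
      qed
    qed
    also have "\<dots> = emeasure \<sigma> U * h ?r"
      by (subst nn_integral_multc) auto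
    finally have "h ?r * (\<integral>\<^sup>+x. f k x \<partial>\<mu>) \<le> h ?r * emeasure \<sigma> U"
      by (simp add: mult.commute)
    then show ?thesis
      using h_pos[of ?r] h_fin[of ?r] by (subst (asm) ennreal_mult_le_mult_iff) (auto simp: top_unique)
  qed
  have "emeasure \<mu> U = (\<integral>\<^sup>+x. indicator U x \<partial>\<mu>)" by simp
  also have "\<dots> \<le> (\<integral>\<^sup>+x. liminf (\<lambda>k. f k x) \<partial>\<mu>)"
  proof (rule nn_integral_mono_AE)
    show "AE x in \<mu>. indicator U x \<le> liminf (\<lambda>k. f k x)"
      using AE(1)
    proof eventually_elim
      case (elim x)
      show ?case
      proof (cases "x \<in> U")
        case True
        then obtain e where e: "e > 0" "ball x e \<subseteq> U" using \<open>open U\<close> openE by blast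
        have "eventually (\<lambda>k. 1 / real (Suc k) < e) sequentially"
          using e(1) by real_asymp
        then have "eventually (\<lambda>k. 1 \<le> f k x) sequentially"
        proof eventually_elim
          case (elim k)
          have "U \<inter> ball x (1 / Suc k) = ball x (1 / Suc k)"
            using e(2) elim by (auto simp: subset_iff)
          then have "f k x = 1"
            using h\<sigma>[OF \<open>x \<in> S\<close>, of "1 / Suc k"] h_pos[of "1 / Suc k"] h_fin[of "1 / Suc k"] True
            by (simp add: f_def ennreal_divide_self less_top)
          then show ?case by simp
        qed
        then show ?thesis using True by (simp add: Liminf_bounded)
      qed simp
    qed
  qed
  also have "\<dots> \<le> liminf (\<lambda>k. \<integral>\<^sup>+x. f k x \<partial>\<mu>)"
    by (rule nn_integral_liminf[OF f_meas])
  also have "\<dots> \<le> liminf (\<lambda>k. emeasure \<sigma> U)"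
    by (intro Liminf_mono always_eventually allI int_f)
  also have "\<dots> = emeasure \<sigma> U" by (simp add: Liminf_const)
  finally show ?thesis .
qed

lemma uniformly_distributed_closed_eq:
  fixes \<mu> \<sigma> :: "'a::{metric_space, second_countable_topology} measure"
  assumes "prob_space \<mu>" "prob_space \<sigma>"
    and sets: "sets \<mu> = sets borel" "sets \<sigma> = sets borel"
    and AE: "AE x in \<mu>. x \<in> S" "AE x in \<sigma>. x \<in> S"
    and hom: "\<And>x y r. x \<in> S \<Longrightarrow> y \<in> S \<Longrightarrow> emeasure \<mu> (ball x r) = emeasure \<mu> (ball y r)"
      "\<And>x y r. x \<in> S \<Longrightarrow> y \<in> S \<Longrightarrow> emeasure \<sigma> (ball x r) = emeasure \<sigma> (ball y r)"
    and "closed C"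
  shows "measure \<mu> C = measure \<sigma> C"
proof -
  interpret \<mu>: prob_space \<mu> by fact
  interpret \<sigma>: prob_space \<sigma> by fact
  have spaces: "space \<mu> = UNIV" "space \<sigma> = UNIV"
    using sets_eq_imp_space_eq[OF sets(1)] sets_eq_imp_space_eq[OF sets(2)] by auto
  have op: "open (- C)" using \<open>closed C\<close> by auto
  have "emeasure \<mu> (- C) = emeasure \<sigma> (- C)"
    by (intro antisym uniformly_distributed_open_le[of \<mu> \<sigma> S] uniformly_distributed_open_le[of \<sigma> \<mu> S] assms op)
  then have "measure \<mu> (- C) = measure \<sigma> (- C)" by (simp add: measure_def)
  moreover have "C \<in> sets borel" using \<open>closed C\<close> by simp
  ultimately show ?thesis
    using \<mu>.prob_compl[of C] \<sigma>.prob_compl[of C] by (simp add: sets spaces Compl_eq_Diff_UNIV)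
qed

section \<open>Lebesgue measure on subspaces\<close>

text \<open>
  Both sides equal the double integral of \<open>indicator A x * indicator B (y - x)\<close>: substitute
  \<open>y - x\<close> for \<open>x\<close> in the \<open>\<mu>\<close>-integral.
\<close>

lemma translation_invariant_measures_proportional:
  fixes \<mu> \<nu> :: "'a::{real_normed_vector, second_countable_topology} measure"
  assumes "sigma_finite_measure \<mu>" "sigma_finite_measure \<nu>"
    and sets [measurable_cong]: "sets \<mu> = sets borel" "sets \<nu> = sets borel"
    and "subspace V"
    and AE: "AE x in \<mu>. x \<in> V" "AE x in \<nu>. x \<in> V"
    and inv: "\<And>v A. v \<in> V \<Longrightarrow> A \<in> sets borel \<Longrightarrow> emeasure \<nu> {x. x + v \<in> A} = emeasure \<nu> A"
    and refl: "\<And>v A. v \<in> V \<Longrightarrow> A \<in> sets borel \<Longrightarrow> emeasure \<mu> {x. v - x \<in> A} = emeasure \<mu> A"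
    and [measurable]: "A \<in> sets borel" "B \<in> sets borel"
  shows "emeasure \<mu> A * emeasure \<nu> B = emeasure \<mu> B * emeasure \<nu> A"
proof -
  interpret \<mu>: sigma_finite_measure \<mu> by fact
  interpret \<nu>: sigma_finite_measure \<nu> by fact
  interpret pair_sigma_finite \<mu> \<nu> ..
  have spaces: "space \<mu> = UNIV" "space \<nu> = UNIV"
    using sets_eq_imp_space_eq[OF sets(1)] sets_eq_imp_space_eq[OF sets(2)] by auto
  have conv: "(\<integral>\<^sup>+x. \<integral>\<^sup>+y. indicator C x * indicator D (y - x) \<partial>\<nu> \<partial>\<mu>) = emeasure \<mu> C * emeasure \<nu> D"
    if [measurable]: "C \<in> sets borel" "D \<in> sets borel" for C D :: "'a set"
  proof -
    have "(\<integral>\<^sup>+x. \<integral>\<^sup>+y. indicator C x * indicator D (y - x) \<partial>\<nu> \<partial>\<mu>)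
        = (\<integral>\<^sup>+x. indicator C x * emeasure \<nu> D \<partial>\<mu>)"
    \<comment> \<open>Invariance is available only for shifts in \<open>V\<close>; it suffices to
      evaluate the inner integral there because \<open>\<mu>\<close> is concentrated on
      \<open>V\<close>.\<close>
    proof (rule nn_integral_cong_AE)
      show "AE x in \<mu>. (\<integral>\<^sup>+y. indicator C x * indicator D (y - x) \<partial>\<nu>) = indicator C x * emeasure \<nu> D"
        using AE(1)
      proof eventually_elim
        case (elim x)
        have eq: "indicator D (y - x) = (indicator {y. y + (- x) \<in> D} y :: ennreal)" for y
          by (simp add: indicator_def)
        have "(\<integral>\<^sup>+y. indicator C x * indicator D (y - x) \<partial>\<nu>)
            = indicator C x * (\<integral>\<^sup>+y. indicator D (y - x) \<partial>\<nu>)"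
          by (rule nn_integral_cmult) measurable
        also have "(\<integral>\<^sup>+y. indicator D (y - x) \<partial>\<nu>) = emeasure \<nu> {y. y + (- x) \<in> D}"
          unfolding eq by (rule nn_integral_indicator) (auto simp: sets)
        also have "\<dots> = emeasure \<nu> D"
          using elim \<open>subspace V\<close> by (intro inv) (auto simp: subspace_neg)
        finally show ?case .
      qed
    qed
    also have "\<dots> = emeasure \<mu> C * emeasure \<nu> D"
      by (subst nn_integral_multc) (auto simp: sets)
    finally show ?thesis .
  qed
  have "emeasure \<mu> A * emeasure \<nu> B = (\<integral>\<^sup>+x. \<integral>\<^sup>+y. indicator A x * indicator B (y - x) \<partial>\<nu> \<partial>\<mu>)"
    by (rule conv[symmetric]) measurable
  also have "\<dots> = (\<integral>\<^sup>+y. \<integral>\<^sup>+x. indicator A x * indicator B (y - x) \<partial>\<mu> \<partial>\<nu>)"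
    by (rule Fubini'[symmetric]) measurable
  also have "\<dots> = (\<integral>\<^sup>+y. \<integral>\<^sup>+x. indicator B x * indicator A (y - x) \<partial>\<mu> \<partial>\<nu>)"
  proof (rule nn_integral_cong_AE)
    show "AE y in \<nu>. (\<integral>\<^sup>+x. indicator A x * indicator B (y - x) \<partial>\<mu>)
                   = (\<integral>\<^sup>+x. indicator B x * indicator A (y - x) \<partial>\<mu>)"
      using AE(2)
    proof eventually_elim
      case (elim y)
      have C: "{x. x \<in> B \<and> y - x \<in> A} \<in> sets borel" "{x. x \<in> A \<and> y - x \<in> B} \<in> sets borel"
        by measurable
      have "(\<integral>\<^sup>+x. indicator A x * indicator B (y - x) \<partial>\<mu>) = (\<integral>\<^sup>+x. indicator {x. x \<in> A \<and> y - x \<in> B} x \<partial>\<mu>)"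
        by (intro nn_integral_cong) (auto simp: indicator_def)
      also have "\<dots> = emeasure \<mu> {x. x \<in> A \<and> y - x \<in> B}"
        using C by (intro nn_integral_indicator) (simp add: sets)
      also have "\<dots> = emeasure \<mu> {x. y - x \<in> {x. x \<in> B \<and> y - x \<in> A}}"
        by (intro arg_cong[where f = "emeasure \<mu>"]) auto
      also have "\<dots> = emeasure \<mu> {x. x \<in> B \<and> y - x \<in> A}"
        by (rule refl[OF elim C(1)])
      also have "\<dots> = (\<integral>\<^sup>+x. indicator {x. x \<in> B \<and> y - x \<in> A} x \<partial>\<mu>)"
        using C by (intro nn_integral_indicator[symmetric]) (simp add: sets)
      also have "\<dots> = (\<integral>\<^sup>+x. indicator B x * indicator A (y - x) \<partial>\<mu>)"
        by (intro nn_integral_cong) (auto simp: indicator_def)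
      finally show ?case .
    qed
  qed
  also have "\<dots> = (\<integral>\<^sup>+x. \<integral>\<^sup>+y. indicator B x * indicator A (y - x) \<partial>\<nu> \<partial>\<mu>)"
    by (rule Fubini') measurable
  also have "\<dots> = emeasure \<mu> B * emeasure \<nu> A"
    by (rule conv) measurable
  finally show ?thesis .
qed

lemma emeasure_lborel_affine:
  fixes r a :: real
  assumes "r \<noteq> 0" "A \<in> sets borel"
  shows "emeasure lborel ((\<lambda>t. r * t + a) -` A) = ennreal \<bar>1 / r\<bar> * emeasure lborel A"
proof -
  have "emeasure lborel A = emeasure (density (distr lborel borel (\<lambda>x. a + r * x)) (\<lambda>_. ennreal \<bar>r\<bar>)) A"
    using lborel_real_affine[OF assms(1), of a] by simp
  also have "\<dots> = ennreal \<bar>r\<bar> * emeasure lborel ((\<lambda>t. a + r * t) -` A)"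
    using assms by (simp add: emeasure_density_const emeasure_distr)
  finally have "ennreal \<bar>1 / r\<bar> * emeasure lborel A
      = ennreal \<bar>1 / r\<bar> * ennreal \<bar>r\<bar> * emeasure lborel ((\<lambda>t. a + r * t) -` A)"
    by (simp add: mult.assoc)
  also have "ennreal \<bar>1 / r\<bar> * ennreal \<bar>r\<bar> = 1"
    using assms by (simp flip: ennreal_mult)
  finally show ?thesis by (simp add: add.commute)
qed

interpretation lborel_product: product_sigma_finite "\<lambda>_::nat. lborel :: real measure"
  by standard

lemma emeasure_PiM_lborel_affine:
  fixes r :: real and a :: "nat \<Rightarrow> real"
  assumes "finite I" "r \<noteq> 0" and X: "X \<in> sets (PiM I (\<lambda>_. lborel))"
  shows "emeasure (PiM I (\<lambda>_. lborel)) ((\<lambda>f. \<lambda>i\<in>I. r * f i + a i) -` X \<inter> space (PiM I (\<lambda>_. lborel)))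
       = ennreal (\<bar>1 / r\<bar> ^ card I) * emeasure (PiM I (\<lambda>_. lborel)) X"
proof -
  let ?M = "PiM I (\<lambda>_::nat. lborel :: real measure)" and ?\<phi> = "\<lambda>f. \<lambda>i\<in>I. r * f i + a i"
  have meas [measurable]: "?\<phi> \<in> measurable ?M ?M"
    by (rule measurable_restrict) measurable
  \<comment> \<open>With the factor moved to this side both sides are measures, and agreement on
    boxes, where the one-dimensional case applies in each coordinate, is enough.\<close>
  have "scale_measure (ennreal (\<bar>r\<bar> ^ card I)) (distr ?M ?M ?\<phi>) = ?M"
  proof (rule lborel_product.PiM_eqI)
    fix A :: "nat \<Rightarrow> real set" assume A: "\<And>i. i \<in> I \<Longrightarrow> A i \<in> sets lborel"
    have "?\<phi> -` Pi\<^sub>E I A \<inter> space ?M = Pi\<^sub>E I (\<lambda>i. (\<lambda>t. r * t + a i) -` A i)"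
      by (auto simp: space_PiM PiE_iff)
    moreover have "(\<lambda>t. r * t + a i) -` A i \<in> sets lborel" if "i \<in> I" for i
      using measurable_sets[of "\<lambda>t. r * t + a i" borel borel "A i"] A[OF that] by simp
    ultimately have "emeasure (distr ?M ?M ?\<phi>) (Pi\<^sub>E I A)
        = (\<Prod>i\<in>I. emeasure lborel ((\<lambda>t. r * t + a i) -` A i))"
      using A assms(1) by (subst emeasure_distr) (auto simp: lborel_product.emeasure_PiM)
    also have "\<dots> = ennreal (\<bar>1 / r\<bar> ^ card I) * (\<Prod>i\<in>I. emeasure lborel (A i))"
      using A assms by (simp add: emeasure_lborel_affine prod.distrib ennreal_power)
    finally have "emeasure (scale_measure (ennreal (\<bar>r\<bar> ^ card I)) (distr ?M ?M ?\<phi>)) (Pi\<^sub>E I A)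
        = ennreal (\<bar>r\<bar> ^ card I) * ennreal (\<bar>1 / r\<bar> ^ card I) * (\<Prod>i\<in>I. emeasure lborel (A i))"
      by (simp add: mult.assoc)
    also have "ennreal (\<bar>r\<bar> ^ card I) * ennreal (\<bar>1 / r\<bar> ^ card I) = 1"
      using assms by (simp flip: ennreal_mult power_mult_distrib)
    finally show "emeasure (scale_measure (ennreal (\<bar>r\<bar> ^ card I)) (distr ?M ?M ?\<phi>)) (Pi\<^sub>E I A)
        = (\<Prod>i\<in>I. emeasure lborel (A i))" by (simp only: mult_1)
  qed (use assms in auto)
  then have "emeasure ?M X = emeasure (scale_measure (ennreal (\<bar>r\<bar> ^ card I)) (distr ?M ?M ?\<phi>)) X"
    by simp
  also have "\<dots> = ennreal (\<bar>r\<bar> ^ card I) * emeasure ?M (?\<phi> -` X \<inter> space ?M)"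
    using X by (simp add: emeasure_distr)
  finally have "ennreal (\<bar>1 / r\<bar> ^ card I) * emeasure ?M X
      = ennreal (\<bar>1 / r\<bar> ^ card I) * ennreal (\<bar>r\<bar> ^ card I) * emeasure ?M (?\<phi> -` X \<inter> space ?M)"
    by (simp add: mult.assoc)
  also have "ennreal (\<bar>1 / r\<bar> ^ card I) * ennreal (\<bar>r\<bar> ^ card I) = 1"
    using assms by (simp flip: ennreal_mult power_mult_distrib)
  finally show ?thesis by (simp only: mult_1)
qed

section \<open>Orthonormal coordinates and volume on a finite-dimensional subspace\<close>

definition orthonormal_upto :: "nat \<Rightarrow> (nat \<Rightarrow> 'a::real_inner) \<Rightarrow> bool" where
  "orthonormal_upto k b \<longleftrightarrow> (\<forall>i<k. \<forall>j<k. b i \<bullet> b j = (if i = j then 1 else 0))"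

definition lincomb :: "nat \<Rightarrow> (nat \<Rightarrow> 'a::real_vector) \<Rightarrow> (nat \<Rightarrow> real) \<Rightarrow> 'a" where
  "lincomb k b f = (\<Sum>i<k. f i *\<^sub>R b i)"

definition subspace_leb ::
    "nat \<Rightarrow> (nat \<Rightarrow> 'a::{real_inner, second_countable_topology}) \<Rightarrow> 'a measure" where
  "subspace_leb k b = distr (PiM {..<k} (\<lambda>_. lborel)) borel (lincomb k b)"

lemma lincomb_measurable [measurable]:
  fixes b :: "nat \<Rightarrow> 'a::{real_inner, second_countable_topology}"
  shows "lincomb k b \<in> borel_measurable (PiM {..<k} (\<lambda>_. lborel))"
  unfolding lincomb_def by measurable

lemma sets_subspace_leb [simp, measurable_cong]: "sets (subspace_leb k b) = sets borel"
  by (simp add: subspace_leb_def)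

lemma space_subspace_leb [simp]: "space (subspace_leb k b) = UNIV"
  by (simp add: subspace_leb_def)

lemma lincomb_in_span: "lincomb k b f \<in> span (b ` {..<k})"
  unfolding lincomb_def by (intro span_sum span_scale) (auto intro: span_base)

lemma lincomb_inner:
  assumes "orthonormal_upto k b" "i < k"
  shows "lincomb k b f \<bullet> b i = f i"
proof -
  have "lincomb k b f \<bullet> b i = (\<Sum>j<k. if j = i then f j else 0)"
    unfolding lincomb_def inner_sum_left
    using assms by (intro sum.cong) (auto simp: orthonormal_upto_def)
  then show ?thesis using assms by simp
qed

text \<open>Membership in the span becomes an equation between Borel functions of \<open>x\<close>,
  which is how the span is shown to be measurable.\<close>

lemma span_orthonormal_upto:
  assumes "orthonormal_upto k b"
  shows "x \<in> span (b ` {..<k}) \<longleftrightarrow> x = lincomb k b (\<lambda>i. x \<bullet> b i)"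
proof
  assume "x \<in> span (b ` {..<k})"
  then show "x = lincomb k b (\<lambda>i. x \<bullet> b i)"
  proof (induction rule: span_induct_alt)
    case base
    show ?case by (simp add: lincomb_def)
  next
    case (step c z y)
    then obtain j where j: "j < k" "z = b j" by auto
    have "lincomb k b (\<lambda>i. z \<bullet> b i) = (\<Sum>i<k. if i = j then b i else 0)"
      unfolding lincomb_def using assms j by (intro sum.cong) (auto simp: orthonormal_upto_def)
    also have "\<dots> = z" using j by simp
    finally have z: "lincomb k b (\<lambda>i. z \<bullet> b i) = z" .
    have "lincomb k b (\<lambda>i. (c *\<^sub>R z + y) \<bullet> b i)
        = c *\<^sub>R lincomb k b (\<lambda>i. z \<bullet> b i) + lincomb k b (\<lambda>i. y \<bullet> b i)"
      by (simp add: lincomb_def inner_add_left scaleR_left_distrib sum.distrib scaleR_right.sum)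
    then show ?case using z step.IH by simp
  qed
qed (metis lincomb_in_span)

lemma norm_lincomb:
  assumes "orthonormal_upto k b"
  shows "(norm (lincomb k b f))\<^sup>2 = (\<Sum>i<k. (f i)\<^sup>2)"
proof -
  have "(norm (lincomb k b f))\<^sup>2 = lincomb k b f \<bullet> (\<Sum>i<k. f i *\<^sub>R b i)"
    by (simp add: power2_norm_eq_inner lincomb_def)
  also have "\<dots> = (\<Sum>i<k. f i * (lincomb k b f \<bullet> b i))"
    by (simp add: inner_sum_right)
  also have "\<dots> = (\<Sum>i<k. (f i)\<^sup>2)"
    using assms by (intro sum.cong) (auto simp: lincomb_inner power2_eq_square)
  finally show ?thesis .
qed

lemma AE_subspace_leb_in_span:
  assumes "orthonormal_upto k b"
  shows "AE x in subspace_leb k b. x \<in> span (b ` {..<k})"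
  unfolding span_orthonormal_upto[OF assms] subspace_leb_def
proof (subst AE_distr_iff)
  show "{x \<in> space borel. x = lincomb k b (\<lambda>i. x \<bullet> b i)} \<in> sets borel"
    unfolding lincomb_def by measurable
  show "AE f in PiM {..<k} (\<lambda>_. lborel). lincomb k b f = lincomb k b (\<lambda>i. lincomb k b f \<bullet> b i)"
    using span_orthonormal_upto[OF assms] lincomb_in_span by (intro AE_I2) blast
qed measurable

text \<open>Used with \<open>r = 1\<close> for translations, with \<open>r = -1\<close> for point
  reflections and with \<open>r = 1 / R\<close> for dilation by \<open>R\<close>.\<close>

lemma emeasure_subspace_leb_affine:
  fixes b :: "nat \<Rightarrow> 'a::{real_inner, second_countable_topology}"
  assumes "orthonormal_upto k b" "r \<noteq> 0" "v \<in> span (b ` {..<k})" and A: "A \<in> sets borel"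
  shows "emeasure (subspace_leb k b) {x. r *\<^sub>R x + v \<in> A} = ennreal (\<bar>1 / r\<bar> ^ k) * emeasure (subspace_leb k b) A"
proof -
  let ?M = "PiM {..<k} (\<lambda>_::nat. lborel :: real measure)"
  let ?\<phi> = "\<lambda>f. \<lambda>i\<in>{..<k}. r * f i + v \<bullet> b i"
  have v: "v = lincomb k b (\<lambda>i. v \<bullet> b i)" using assms span_orthonormal_upto by blast
  have \<phi>: "lincomb k b (?\<phi> f) = r *\<^sub>R lincomb k b f + v" for f
    by (subst v) (simp add: lincomb_def scaleR_left_distrib sum.distrib scaleR_right.sum)
  have A': "lincomb k b -` A \<inter> space ?M \<in> sets ?M"
    by (rule measurable_sets[OF lincomb_measurable A])
  have \<phi>_space: "?\<phi> f \<in> space ?M" for f by (simp add: space_PiM)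
  have [measurable]: "A \<in> sets borel" by fact
  have "{x. r *\<^sub>R x + v \<in> A} \<in> sets borel" by measurable
  then have "emeasure (subspace_leb k b) {x. r *\<^sub>R x + v \<in> A}
      = emeasure ?M (lincomb k b -` {x. r *\<^sub>R x + v \<in> A} \<inter> space ?M)"
    unfolding subspace_leb_def by (rule emeasure_distr[OF lincomb_measurable])
  also have "lincomb k b -` {x. r *\<^sub>R x + v \<in> A} \<inter> space ?M = ?\<phi> -` (lincomb k b -` A \<inter> space ?M) \<inter> space ?M"
    using \<phi> \<phi>_space by auto
  also have "emeasure ?M \<dots> = ennreal (\<bar>1 / r\<bar> ^ card {..<k}) * emeasure ?M (lincomb k b -` A \<inter> space ?M)"
    by (rule emeasure_PiM_lborel_affine) (use assms A' in auto)
  also have "emeasure ?M (lincomb k b -` A \<inter> space ?M) = emeasure (subspace_leb k b) A"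
    unfolding subspace_leb_def by (rule emeasure_distr[OF lincomb_measurable A, symmetric])
  finally show ?thesis by simp
qed

lemma emeasure_subspace_leb_cball_finite:
  fixes b :: "nat \<Rightarrow> 'a::{real_inner, second_countable_topology}"
  assumes "orthonormal_upto k b"
  shows "emeasure (subspace_leb k b) (cball 0 R) < \<infinity>"
proof -
  let ?M = "PiM {..<k} (\<lambda>_::nat. lborel :: real measure)"
  have "emeasure (subspace_leb k b) (cball 0 R) = emeasure ?M (lincomb k b -` cball 0 R \<inter> space ?M)"
    unfolding subspace_leb_def by (rule emeasure_distr) measurable
  also have "\<dots> \<le> emeasure ?M (Pi\<^sub>E {..<k} (\<lambda>_. {-\<bar>R\<bar>..\<bar>R\<bar>}))"
  proof (rule emeasure_mono)
    show "Pi\<^sub>E {..<k} (\<lambda>_. {-\<bar>R\<bar>..\<bar>R\<bar>}) \<in> sets ?M" by (auto intro!: sets_PiM_I_finite)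
    show "lincomb k b -` cball 0 R \<inter> space ?M \<subseteq> Pi\<^sub>E {..<k} (\<lambda>_. {-\<bar>R\<bar>..\<bar>R\<bar>})"
    proof
      fix f assume f: "f \<in> lincomb k b -` cball 0 R \<inter> space ?M"
      have "\<bar>f i\<bar> \<le> \<bar>R\<bar>" if "i < k" for i
      proof -
        have "norm (b i) = 1" using assms that by (simp add: orthonormal_upto_def norm_eq_sqrt_inner)
        then have "\<bar>f i\<bar> \<le> norm (lincomb k b f)"
          using Cauchy_Schwarz_ineq2[of "lincomb k b f" "b i"] lincomb_inner[OF assms that] by simp
        then show ?thesis using f by auto
      qed
      then show "f \<in> Pi\<^sub>E {..<k} (\<lambda>_. {-\<bar>R\<bar>..\<bar>R\<bar>})"
        using f by (auto simp: space_PiM PiE_iff abs_le_iff minus_le_iff)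
    qed
  qed
  also have "\<dots> = ennreal ((2 * \<bar>R\<bar>) ^ k)"
    by (subst lborel_product.emeasure_PiM) (auto simp: ennreal_power)
  finally show ?thesis using order_le_less_trans by fastforce
qed

lemma emeasure_subspace_leb_cball_pos:
  fixes b :: "nat \<Rightarrow> 'a::{real_inner, second_countable_topology}"
  assumes "orthonormal_upto k b"
  shows "0 < emeasure (subspace_leb k b) (cball 0 1)"
proof -
  \<comment> \<open>A cube of half-side \<open>1 / (k + 1)\<close> fits into the ball: each squared
    coordinate is at most \<open>1 / (k + 1)\<close>, so the k of them sum to at most 1.\<close>
  let ?M = "PiM {..<k} (\<lambda>_::nat. lborel :: real measure)" and ?r = "1 / (real k + 1)"
  have "0 < ennreal ((2 * ?r) ^ k)" by (simp add: field_simps)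
  also have "ennreal ((2 * ?r) ^ k) = emeasure ?M (Pi\<^sub>E {..<k} (\<lambda>_. {-?r..?r}))"
    by (subst lborel_product.emeasure_PiM) (auto simp: ennreal_power)
  also have "\<dots> \<le> emeasure ?M (lincomb k b -` cball 0 1 \<inter> space ?M)"
  proof (rule emeasure_mono)
    show "lincomb k b -` cball 0 1 \<inter> space ?M \<in> sets ?M"
      by (rule measurable_sets[OF lincomb_measurable]) simp
    show "Pi\<^sub>E {..<k} (\<lambda>_. {-?r..?r}) \<subseteq> lincomb k b -` cball 0 1 \<inter> space ?M"
    proof
      fix f assume f: "f \<in> Pi\<^sub>E {..<k} (\<lambda>_. {-?r..?r})"
      have "(norm (lincomb k b f))\<^sup>2 \<le> (\<Sum>i<k. ?r)"
        unfolding norm_lincomb[OF assms]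
      proof (rule sum_mono)
        fix i assume "i \<in> {..<k}"
        then have "\<bar>f i\<bar> \<le> ?r" using PiE_mem[OF f, of i] by auto
        moreover have "\<bar>f i\<bar> \<le> 1" using calculation by (rule order_trans) simp
        ultimately have "\<bar>f i\<bar> * \<bar>f i\<bar> \<le> ?r * 1" by (intro mult_mono) auto
        then show "(f i)\<^sup>2 \<le> ?r" by (simp add: power2_eq_square)
      qed
      also have "\<dots> \<le> 1" by simp
      finally have "norm (lincomb k b f) \<le> 1" by (simp add: abs_square_le_1)
      then show "f \<in> lincomb k b -` cball 0 1 \<inter> space ?M"
        using f by (auto simp: space_PiM)
    qed
  qed
  also have "\<dots> = emeasure (subspace_leb k b) (cball 0 1)"
    unfolding subspace_leb_def by (rule emeasure_distr[symmetric]) measurable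
  finally show ?thesis .
qed

lemma sigma_finite_subspace_leb:
  fixes b :: "nat \<Rightarrow> 'a::{real_inner, second_countable_topology}"
  assumes "orthonormal_upto k b"
  shows "sigma_finite_measure (subspace_leb k b)"
proof
  show "\<exists>A. countable A \<and> A \<subseteq> sets (subspace_leb k b) \<and> \<Union>A = space (subspace_leb k b) \<and>
      (\<forall>a\<in>A. emeasure (subspace_leb k b) a \<noteq> \<infinity>)"
    using emeasure_subspace_leb_cball_finite[OF assms]
    by (intro exI[of _ "range (\<lambda>n::nat. cball 0 (real n))"])
      (auto simp: less_top real_arch_simple)
qed

text \<open>
  Rotation invariance of Lebesgue measure: both measures are translation invariant on the same
  subspace, hence proportional, and they agree on the unit ball.
\<close>

lemma subspace_leb_eq:
  fixes b c :: "nat \<Rightarrow> 'a::{real_inner, second_countable_topology}"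
  assumes b: "orthonormal_upto k b" and c: "orthonormal_upto k c"
    and span: "span (b ` {..<k}) = span (c ` {..<k})"
  shows "subspace_leb k b = subspace_leb k c"
proof (rule measure_eqI)
  fix A assume "A \<in> sets (subspace_leb k b)"
  then have A: "A \<in> sets borel" by simp
  \<comment> \<open>By \<open>norm_lincomb\<close> the unit ball has the same coordinate preimage
    for both bases, and its measure is positive and finite, so it fixes the constant of
    proportionality and can be cancelled.\<close>
  let ?B = "cball (0::'a) 1"
  have "emeasure (subspace_leb k b) A * emeasure (subspace_leb k c) ?B
      = emeasure (subspace_leb k b) ?B * emeasure (subspace_leb k c) A"
  proof (rule translation_invariant_measures_proportional[where V = "span (b ` {..<k})"])
    show "emeasure (subspace_leb k c) {x. x + v \<in> X} = emeasure (subspace_leb k c) X"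
      if "v \<in> span (b ` {..<k})" "X \<in> sets borel" for v X
      using emeasure_subspace_leb_affine[OF c, of 1 v X] that span by simp
    show "emeasure (subspace_leb k b) {x. v - x \<in> X} = emeasure (subspace_leb k b) X"
      if "v \<in> span (b ` {..<k})" "X \<in> sets borel" for v X
      using emeasure_subspace_leb_affine[OF b, of "-1" v X] that by simp
  qed (use A b c span AE_subspace_leb_in_span[OF b] AE_subspace_leb_in_span[OF c] in
      \<open>auto intro: sigma_finite_subspace_leb\<close>)
  moreover have "emeasure (subspace_leb k b) ?B = emeasure (subspace_leb k c) ?B"
  proof -
    have "norm (lincomb k b f) = norm (lincomb k c f)" for f
      using norm_lincomb[OF b, of f] norm_lincomb[OF c, of f] by (metis norm_ge_zero power2_eq_imp_eq)
    then have "lincomb k b -` ?B = lincomb k c -` ?B" by auto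
    then show ?thesis unfolding subspace_leb_def by (simp add: emeasure_distr)
  qed
  ultimately have "emeasure (subspace_leb k c) ?B * emeasure (subspace_leb k b) A
      = emeasure (subspace_leb k c) ?B * emeasure (subspace_leb k c) A"
    by (simp only: mult.commute)
  then show "emeasure (subspace_leb k b) A = emeasure (subspace_leb k c) A"
    using emeasure_subspace_leb_cball_pos[OF c] emeasure_subspace_leb_cball_finite[OF c, of 1]
    unfolding ennreal_mult_cancel_left by auto
qed simp

lemma emeasure_subspace_leb:
  fixes b :: "nat \<Rightarrow> 'a::{real_inner, second_countable_topology}"
  assumes "A \<in> sets borel"
  shows "emeasure (subspace_leb k b) A = (\<integral>\<^sup>+f. indicator A (lincomb k b f) \<partial>PiM {..<k} (\<lambda>_. lborel))"
proof -
  have "emeasure (subspace_leb k b) A = (\<integral>\<^sup>+x. indicator A x \<partial>subspace_leb k b)"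
    using assms by simp
  also have "\<dots> = (\<integral>\<^sup>+f. indicator A (lincomb k b f) \<partial>PiM {..<k} (\<lambda>_. lborel))"
    unfolding subspace_leb_def using assms by (intro nn_integral_distr) auto
  finally show ?thesis .
qed

text \<open>Fubini along the last basis vector: the set is sliced by hyperplanes at height
  \<open>s\<close>. With an adapted basis the slices are parallel to a prescribed
  hyperplane.\<close>

lemma emeasure_subspace_leb_Suc:
  fixes b :: "nat \<Rightarrow> 'a::{real_inner, second_countable_topology}"
  assumes [measurable]: "A \<in> sets borel"
  shows "emeasure (subspace_leb (Suc k) b) A
       = (\<integral>\<^sup>+s. emeasure (subspace_leb k b) {y. y + s *\<^sub>R b k \<in> A} \<partial>lborel)"
proof -
  let ?M = "\<lambda>k. PiM {..<k} (\<lambda>_::nat. lborel :: real measure)"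
  have "emeasure (subspace_leb (Suc k) b) A = (\<integral>\<^sup>+f. indicator A (lincomb (Suc k) b f) \<partial>?M (Suc k))"
    by (rule emeasure_subspace_leb) measurable
  also have "\<dots> = (\<integral>\<^sup>+s. \<integral>\<^sup>+f. indicator A (lincomb (Suc k) b (f(k := s))) \<partial>?M k \<partial>lborel)"
  proof -
    have [measurable]: "lincomb (Suc k) b \<in> borel_measurable (PiM (insert k {..<k}) (\<lambda>_. lborel))"
      using lincomb_measurable[of "Suc k" b] by (simp add: lessThan_Suc)
    show ?thesis
      unfolding lessThan_Suc
      by (rule lborel_product.product_nn_integral_insert_rev) auto
  qed
  also have "\<dots> = (\<integral>\<^sup>+s. emeasure (subspace_leb k b) {y. y + s *\<^sub>R b k \<in> A} \<partial>lborel)"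
  proof (rule nn_integral_cong)
    fix s
    have [measurable]: "{y. y + s *\<^sub>R b k \<in> A} \<in> sets borel" by measurable
    have "emeasure (subspace_leb k b) {y. y + s *\<^sub>R b k \<in> A}
        = (\<integral>\<^sup>+f. indicator {y. y + s *\<^sub>R b k \<in> A} (lincomb k b f) \<partial>?M k)"
      by (rule emeasure_subspace_leb) measurable
    also have "\<dots> = (\<integral>\<^sup>+f. indicator A (lincomb (Suc k) b (f(k := s))) \<partial>?M k)"
      by (intro nn_integral_cong) (auto simp: indicator_def lincomb_def)
    finally show "(\<integral>\<^sup>+f. indicator A (lincomb (Suc k) b (f(k := s))) \<partial>?M k)
        = emeasure (subspace_leb k b) {y. y + s *\<^sub>R b k \<in> A}" by simp
  qed
  finally show ?thesis .
qed

section \<open>The fraction of a ball covered by a cone\<close>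

lemma orthonormal_upto_mono: "orthonormal_upto n b \<Longrightarrow> k \<le> n \<Longrightarrow> orthonormal_upto k b"
  by (auto simp: orthonormal_upto_def)

lemma orthonormal_upto_linear_image:
  "orthogonal_transformation T \<Longrightarrow> orthonormal_upto k b \<Longrightarrow> orthonormal_upto k (\<lambda>i. T (b i))"
  by (simp add: orthonormal_upto_def orthogonal_transformation_def)

lemma span_inner_orthonormal_last:
  assumes "orthonormal_upto (Suc k) b" "y \<in> span (b ` {..<k})"
  shows "y \<bullet> b k = 0"
  using assms(2)
proof (induction rule: span_induct_alt)
  case (step c x y)
  then show ?case using assms(1) by (auto simp: orthonormal_upto_def inner_add_left)
qed simp

text \<open>Almost every point of the slice at height \<open>s\<close> has inner product
  \<open>s\<close> with \<open>b k\<close>, so only the single height 0 could contribute.\<close>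

lemma emeasure_subspace_leb_hyperplane:
  fixes b :: "nat \<Rightarrow> 'a::{real_inner, second_countable_topology}"
  assumes b: "orthonormal_upto (Suc k) b"
  shows "emeasure (subspace_leb (Suc k) b) {x. x \<bullet> b k = 0} = 0"
proof -
  have b': "orthonormal_upto k b" using b by (rule orthonormal_upto_mono) simp
  have meas: "{x. x \<bullet> b k = 0} \<in> sets borel" by measurable
  have "emeasure (subspace_leb k b) {y. y + s *\<^sub>R b k \<in> {x. x \<bullet> b k = 0}} = 0" if "s \<noteq> 0" for s
  proof -
    have "{y. y + s *\<^sub>R b k \<in> {x. x \<bullet> b k = 0}} \<in> sets borel" by measurable
    moreover have "AE y in subspace_leb k b. y \<notin> {y. y + s *\<^sub>R b k \<in> {x. x \<bullet> b k = 0}}"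
      using AE_subspace_leb_in_span[OF b']
    proof eventually_elim
      case (elim y)
      then show ?case
        using span_inner_orthonormal_last[OF b elim] that b by (auto simp: inner_add_left orthonormal_upto_def)
    qed
    ultimately show ?thesis by (subst (asm) AE_iff_measurable) auto
  qed
  then have "AE s in lborel. emeasure (subspace_leb k b) {y. y + s *\<^sub>R b k \<in> {x. x \<bullet> b k = 0}} = 0"
    using AE_lborel_singleton[of 0] by (rule_tac eventually_mono) auto
  then show ?thesis
    unfolding emeasure_subspace_leb_Suc[OF meas] by (subst nn_integral_cong_AE[where v = "\<lambda>_. 0"]) auto
qed

text \<open>Reflecting the basis yields another orthonormal basis of the same span, and the measure
  does not depend on that choice.\<close>

lemma emeasure_subspace_leb_reflect:
  fixes b :: "nat \<Rightarrow> 'a::{real_inner, second_countable_topology}"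
  assumes b: "orthonormal_upto k b" and w: "w \<in> span (b ` {..<k})" and A: "A \<in> sets borel"
  shows "emeasure (subspace_leb k b) (reflect w -` A) = emeasure (subspace_leb k b) A"
proof -
  let ?c = "\<lambda>i. reflect w (b i)"
  have "reflect w (lincomb k b f) = lincomb k ?c f" for f
    by (simp add: lincomb_def linear_sum[OF reflect_linear] linear_cmul[OF reflect_linear])
  then have "distr (subspace_leb k b) borel (reflect w) = subspace_leb k ?c"
    unfolding subspace_leb_def by (subst distr_distr) (auto simp: comp_def)
  also have "subspace_leb k ?c = subspace_leb k b"
  proof (rule subspace_leb_eq)
    show "orthonormal_upto k ?c"
      by (rule orthonormal_upto_linear_image[OF orthogonal_transformation_reflect b])
    have "?c ` {..<k} = reflect w ` (b ` {..<k})" by (simp add: image_image)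
    then show "span (?c ` {..<k}) = span (b ` {..<k})"
      using linear_span_image[OF reflect_linear[of w], of "b ` {..<k}"] reflect_image_subspace[OF subspace_span w] by simp
  qed fact
  finally have "emeasure (subspace_leb k b) A = emeasure (distr (subspace_leb k b) borel (reflect w)) A" by simp
  then show ?thesis using A by (simp add: emeasure_distr)
qed

text \<open>The normalised solid angle of a cone within the span of \<open>b\<close>, expressed by
  volume in the ball so that angles of a facet and of the full cone can be compared by
  slicing.\<close>

definition cone_frac :: "nat \<Rightarrow> (nat \<Rightarrow> 'a::{real_inner, second_countable_topology}) \<Rightarrow> 'a set \<Rightarrow> real" where
  "cone_frac k b C = measure (subspace_leb k b) (C \<inter> cball 0 1) / measure (subspace_leb k b) (cball 0 1)"

lemma measure_subspace_leb_cball_pos: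
  assumes "orthonormal_upto k b"
  shows "0 < measure (subspace_leb k b) (cball 0 1)"
  using emeasure_subspace_leb_cball_pos[OF assms] emeasure_subspace_leb_cball_finite[OF assms, of 1]
  by (simp add: measure_def enn2real_positive_iff)

lemma fmeasurable_subspace_leb_cball:
  assumes "orthonormal_upto k b" "A \<in> sets borel"
  shows "A \<inter> cball 0 R \<in> fmeasurable (subspace_leb k b)"
  by (rule fmeasurableI2[of "cball 0 R"])
    (use assms emeasure_subspace_leb_cball_finite[OF assms(1)] in \<open>auto intro!: fmeasurableI\<close>)

lemma cone_frac_uminus:
  fixes b :: "nat \<Rightarrow> 'a::{real_inner, second_countable_topology}"
  assumes b: "orthonormal_upto k b" and C [measurable]: "C \<in> sets borel"
  shows "cone_frac k b {x. - x \<in> C} = cone_frac k b C"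
proof -
  have "{x. - x \<in> C} \<inter> cball 0 1 = {x. (-1) *\<^sub>R x + 0 \<in> C \<inter> cball 0 1}" by auto
  then have "emeasure (subspace_leb k b) ({x. - x \<in> C} \<inter> cball 0 1) = emeasure (subspace_leb k b) (C \<inter> cball 0 1)"
    using emeasure_subspace_leb_affine[OF b, of "-1" 0 "C \<inter> cball 0 1"] by (simp add: span_zero)
  then show ?thesis by (simp add: cone_frac_def measure_def)
qed

lemma sgn_reflect: "sgn (reflect w x) = reflect w (sgn x)"
  by (simp add: sgn_div_norm linear_cmul[OF reflect_linear])

text \<open>The radial projection of the uniform measure on the ball is another reflection-invariant
  probability measure on the unit sphere. Reflections carry balls around one point of the sphere to
  balls around any other, so both measures are uniformly distributed and agree on closed
  sets.\<close>

lemma rotation_invariant_eq_cone_frac: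
  fixes b :: "nat \<Rightarrow> 'a::{real_inner, second_countable_topology}"
  assumes b: "orthonormal_upto k b" and "k > 0"
    and "prob_space \<rho>" and sets: "sets \<rho> = sets borel"
    and AE: "AE x in \<rho>. x \<in> span (b ` {..<k}) \<and> norm x = 1"
    and inv: "\<And>w A. w \<in> span (b ` {..<k}) \<Longrightarrow> A \<in> sets borel \<Longrightarrow> emeasure \<rho> (reflect w -` A) = emeasure \<rho> A"
    and "closed C" and cone: "\<And>x t. x \<in> C \<Longrightarrow> 0 \<le> t \<Longrightarrow> t *\<^sub>R x \<in> C"
  shows "measure \<rho> C = cone_frac k b C"
proof -
  let ?V = "span (b ` {..<k})" and ?L = "subspace_leb k b" and ?B = "cball (0::'a) 1"
  define S where "S = {x \<in> ?V. norm x = 1}"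
  define \<sigma> where "\<sigma> = distr (uniform_measure ?L ?B) borel sgn"
  have fin: "emeasure ?L ?B \<noteq> 0" "emeasure ?L ?B \<noteq> \<infinity>"
    using emeasure_subspace_leb_cball_pos[OF b] emeasure_subspace_leb_cball_finite[OF b, of 1] by auto
  have [measurable]: "C \<in> sets borel" using \<open>closed C\<close> by simp
  have sgn [measurable]: "sgn \<in> borel_measurable (borel :: 'a measure)"
    unfolding sgn_div_norm by measurable
  have sgn' [measurable]: "sgn \<in> measurable (uniform_measure ?L ?B) borel"
    using measurable_cong_sets[of "uniform_measure ?L ?B" borel "borel :: 'a measure" borel] sgn by simp
  have \<sigma>: "emeasure \<sigma> A = emeasure ?L (?B \<inter> sgn -` A) / emeasure ?L ?B" if "A \<in> sets borel" for A
  proof -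
    have "sgn -` A \<in> sets borel" using measurable_sets[OF sgn that] by simp
    then show ?thesis using that fin unfolding \<sigma>_def
      by (subst emeasure_distr[OF sgn']) auto
  qed
  have hom_of_inv: "emeasure \<mu> (ball x r) = emeasure \<mu> (ball y r)"
    if \<mu>: "\<And>w A. w \<in> ?V \<Longrightarrow> A \<in> sets borel \<Longrightarrow> emeasure \<mu> (reflect w -` A) = emeasure \<mu> A"
      and xy: "x \<in> S" "y \<in> S" for \<mu> :: "'a measure" and x y r
  proof -
    have "reflect (x - y) x = y" using xy by (intro reflect_diff_eq) (auto simp: S_def)
    then have "dist y (reflect (x - y) z) = dist x z" for z by (metis dist_reflect)
    then have "reflect (x - y) -` ball y r = ball x r" by auto
    moreover have "x - y \<in> ?V" using xy by (auto simp: S_def span_diff)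
    ultimately show ?thesis using \<mu>[of "x - y" "ball y r"] by simp
  qed
  have "measure \<rho> C = measure \<sigma> C"
  proof (rule uniformly_distributed_closed_eq[where S = S])
    show "prob_space \<sigma>" unfolding \<sigma>_def
      by (rule prob_space.prob_space_distr[OF prob_space_uniform_measure]) (use fin sgn' in auto)
    show "AE x in \<rho>. x \<in> S" using AE by (simp add: S_def)
    show "AE x in \<sigma>. x \<in> S"
    proof -
      \<comment> \<open>\<open>sgn\<close> sends 0 to 0, off the sphere. As \<open>k > 0\<close>,
        the origin lies in a null hyperplane and may be ignored.\<close>
      obtain j where k: "k = Suc j" using \<open>k > 0\<close> gr0_implies_Suc by blast
      have "{x. x \<bullet> b j = 0} \<in> null_sets ?L"
        using emeasure_subspace_leb_hyperplane[of j b] b unfolding k by (auto simp: null_sets_def)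
      then have "AE x in ?L. x \<notin> {x. x \<bullet> b j = 0}" by (rule AE_not_in)
      with AE_subspace_leb_in_span[OF b] have ae: "AE x in ?L. x \<in> ?V \<and> x \<noteq> 0"
        by eventually_elim auto
      have "{x \<in> space borel. x \<in> S} \<in> sets borel"
        unfolding S_def span_orthonormal_upto[OF b] lincomb_def by measurable
      moreover have "AE x in uniform_measure ?L ?B. sgn x \<in> S"
      proof (rule AE_uniform_measureI)
        show "AE x in ?L. x \<in> ?B \<longrightarrow> sgn x \<in> S"
          using ae by eventually_elim (auto simp: S_def sgn_div_norm span_scale)
      qed simp
      ultimately show ?thesis unfolding \<sigma>_def
        by (subst AE_distr_iff[OF sgn']) auto
    qed
    show "emeasure \<rho> (ball x r) = emeasure \<rho> (ball y r)" if "x \<in> S" "y \<in> S" for x y r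
      by (rule hom_of_inv) (use inv that in auto)
    show "emeasure \<sigma> (ball x r) = emeasure \<sigma> (ball y r)" if "x \<in> S" "y \<in> S" for x y r
    proof (rule hom_of_inv)
      fix w A assume w: "w \<in> ?V" and A: "A \<in> sets (borel :: 'a measure)"
      have A': "sgn -` A \<in> sets borel" using measurable_sets[OF sgn A] by simp
      have rA: "reflect w -` A \<in> sets borel" using measurable_sets[OF reflect_measurable A] by simp
      have "?B \<inter> sgn -` (reflect w -` A) = reflect w -` (?B \<inter> sgn -` A)"
        by (auto simp: sgn_reflect)
      then have "emeasure ?L (?B \<inter> sgn -` (reflect w -` A)) = emeasure ?L (?B \<inter> sgn -` A)"
        using emeasure_subspace_leb_reflect[OF b w, of "?B \<inter> sgn -` A"] A' by simp
      then show "emeasure \<sigma> (reflect w -` A) = emeasure \<sigma> A"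
        by (simp add: \<sigma>[OF A] \<sigma>[OF rA])
    qed fact+
  qed (use assms in \<open>auto simp: \<sigma>_def\<close>)
  \<comment> \<open>Because \<open>C\<close> is a cone, passing to directions does not change
    membership, so the mass of \<open>C\<close> on the sphere is its volume fraction.\<close>
  also have "sgn -` C = C"
  proof (intro set_eqI iffI)
    fix x assume "x \<in> sgn -` C"
    then have "norm x *\<^sub>R sgn x \<in> C" by (intro cone) auto
    then show "x \<in> C" by (cases "x = 0") (auto simp: sgn_div_norm)
  next
    fix x assume "x \<in> C"
    then show "x \<in> sgn -` C" by (simp add: sgn_div_norm cone)
  qed
  then have "measure \<sigma> C = cone_frac k b C"
    unfolding cone_frac_def \<sigma>_def using fin
    by (subst measure_distr[OF sgn']) (auto simp: Int_commute)
  finally show ?thesis .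
qed

text \<open>By Pythagoras the slice at height \<open>s\<close> is empty for
  \<open>\<bar>s\<bar> > 1\<close> and otherwise lies in the lower-dimensional unit ball, up to a
  null set; the heights form an interval of length 2.\<close>

lemma emeasure_subspace_leb_ball_Suc_le:
  fixes b :: "nat \<Rightarrow> 'a::{real_inner, second_countable_topology}"
  assumes b: "orthonormal_upto (Suc k) b"
  shows "emeasure (subspace_leb (Suc k) b) (cball 0 1) \<le> 2 * emeasure (subspace_leb k b) (cball 0 1)"
proof -
  have b': "orthonormal_upto k b" using b by (rule orthonormal_upto_mono) simp
  have bk: "norm (b k) = 1" using b by (simp add: orthonormal_upto_def norm_eq_sqrt_inner)
  have "emeasure (subspace_leb (Suc k) b) (cball 0 1)
      = (\<integral>\<^sup>+s. emeasure (subspace_leb k b) {y. y + s *\<^sub>R b k \<in> cball 0 1} \<partial>lborel)"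
    by (rule emeasure_subspace_leb_Suc) simp
  also have "\<dots> \<le> (\<integral>\<^sup>+s. emeasure (subspace_leb k b) (cball 0 1) * indicator {-1..1::real} s \<partial>lborel)"
  proof (rule nn_integral_mono)
    fix s
    have "emeasure (subspace_leb k b) {y. y + s *\<^sub>R b k \<in> cball 0 1}
        \<le> emeasure (subspace_leb k b) (if \<bar>s\<bar> \<le> 1 then cball 0 1 else {})"
    proof (rule emeasure_mono_AE)
      show "AE y in subspace_leb k b. y \<in> {y. y + s *\<^sub>R b k \<in> cball 0 1}
          \<longrightarrow> y \<in> (if \<bar>s\<bar> \<le> 1 then cball 0 1 else {})"
        using AE_subspace_leb_in_span[OF b']
      proof eventually_elim
        case (elim y)
        have "(norm (y + s *\<^sub>R b k))\<^sup>2 = (norm y)\<^sup>2 + s\<^sup>2"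
          using span_inner_orthonormal_last[OF b elim] bk
          by (simp add: norm_add_Pythagorean orthogonal_def)
        moreover have "(norm (y + s *\<^sub>R b k))\<^sup>2 \<le> 1" if "norm (y + s *\<^sub>R b k) \<le> 1"
          using that by (simp add: power_le_one)
        ultimately have "(norm y)\<^sup>2 \<le> 1 \<and> s\<^sup>2 \<le> 1" if "norm (y + s *\<^sub>R b k) \<le> 1"
          using that zero_le_power2[of s] zero_le_power2[of "norm y"] by linarith
        then have "norm y \<le> 1 \<and> \<bar>s\<bar> \<le> 1" if "norm (y + s *\<^sub>R b k) \<le> 1"
          using that by (simp add: abs_square_le_1)
        then show ?case by auto
      qed
    qed simp
    then show "emeasure (subspace_leb k b) {y. y + s *\<^sub>R b k \<in> cball 0 1}
        \<le> emeasure (subspace_leb k b) (cball 0 1) * indicator {-1..1} s"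
      by (auto split: if_splits simp: indicator_def abs_le_iff)
  qed
  also have "\<dots> = 2 * emeasure (subspace_leb k b) (cball 0 1)"
    by (subst nn_integral_cmult_indicator) (auto simp: mult.commute)
  finally show ?thesis .
qed

text \<open>The generator \<open>g\<close> is in general oblique to the hyperplane. The sweep is a
  shear: each slice contains a translate of \<open>F\<close> within the hyperplane, so the
  obliqueness costs no volume and only the height \<open>h = g \<bullet> b k\<close>
  matters.\<close>

lemma cone_frac_facet_le:
  fixes b :: "nat \<Rightarrow> 'a::{real_inner, second_countable_topology}"
  assumes b: "orthonormal_upto (Suc k) b"
    and [measurable]: "F \<in> sets borel" "N \<in> sets borel"
    and cone: "\<And>x t. x \<in> N \<Longrightarrow> 0 \<le> t \<Longrightarrow> t *\<^sub>R x \<in> N"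
    and g: "g \<in> span (b ` {..<Suc k})" "norm g = 1" "g \<bullet> b k \<ge> \<delta>" and "\<delta> > 0"
    and FN: "\<And>x t. x \<in> F \<Longrightarrow> 0 \<le> t \<Longrightarrow> x + t *\<^sub>R g \<in> N"
  shows "cone_frac k b F \<le> 2 * exp 1 * real (Suc k) / \<delta> * cone_frac (Suc k) b N"
proof -
  have b': "orthonormal_upto k b" using b by (rule orthonormal_upto_mono) simp
  define h where "h = g \<bullet> b k"
  define n where "n = real (Suc k)"
  define R where "R = 1 + 1 / n"
  have n: "n > 0" and h: "h \<ge> \<delta>" "h > 0" and R: "R > 0"
    using g \<open>\<delta> > 0\<close> by (auto simp: n_def h_def R_def add_pos_pos)
  \<comment> \<open>The component of \<open>g\<close> inside the hyperplane, along which the slices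
    drift.\<close>
  define p where "p = g - h *\<^sub>R b k"
  have p: "p \<in> span (b ` {..<k})"
  proof -
    have "g = lincomb (Suc k) b (\<lambda>i. g \<bullet> b i)" using g(1) span_orthonormal_upto[OF b] by blast
    then have "g = lincomb k b (\<lambda>i. g \<bullet> b i) + h *\<^sub>R b k" by (simp add: lincomb_def h_def)
    then have "p = lincomb k b (\<lambda>i. g \<bullet> b i)" unfolding p_def by (rule diff_eq_eq[THEN iffD2])
    then show ?thesis by (simp add: lincomb_in_span)
  qed
  have "ennreal (\<delta> / n) * emeasure (subspace_leb k b) (F \<inter> cball 0 1)
      = (\<integral>\<^sup>+s. emeasure (subspace_leb k b) (F \<inter> cball 0 1) * indicator {0..\<delta> / n} s \<partial>lborel)"
    using \<open>\<delta> > 0\<close> n by (subst nn_integral_cmult_indicator) (auto simp: mult.commute)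
  also have "\<dots> \<le> (\<integral>\<^sup>+s. emeasure (subspace_leb k b) {y. y + s *\<^sub>R b k \<in> N \<inter> cball 0 R} \<partial>lborel)"
  proof (rule nn_integral_mono)
    fix s
    show "emeasure (subspace_leb k b) (F \<inter> cball 0 1) * indicator {0..\<delta> / n} s
        \<le> emeasure (subspace_leb k b) {y. y + s *\<^sub>R b k \<in> N \<inter> cball 0 R}"
    proof (cases "s \<in> {0..\<delta> / n}")
      case True
      \<comment> \<open>Reaching height \<open>s\<close> takes the multiple \<open>s / h\<close> of
        \<open>g\<close>. Heights up to \<open>\<delta> / n\<close> need at most
        \<open>1 / n\<close> since \<open>h \<ge> \<delta>\<close>, and this gives the radius
        \<open>R\<close>.\<close>
      have "s / h \<le> (\<delta> / n) / \<delta>" using True h \<open>\<delta> > 0\<close> by (intro frac_le) auto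
      then have sh: "0 \<le> s / h" "s / h \<le> 1 / n" using True h \<open>\<delta> > 0\<close> by auto
      have "emeasure (subspace_leb k b) (F \<inter> cball 0 1)
          = emeasure (subspace_leb k b) {y. 1 *\<^sub>R y + (- (s / h)) *\<^sub>R p \<in> F \<inter> cball 0 1}"
        using emeasure_subspace_leb_affine[OF b', of 1 "(- (s / h)) *\<^sub>R p" "F \<inter> cball 0 1"] p
        by (simp add: span_neg span_scale)
      also have "\<dots> \<le> emeasure (subspace_leb k b) {y. y + s *\<^sub>R b k \<in> N \<inter> cball 0 R}"
      proof (rule emeasure_mono)
        show "{y. 1 *\<^sub>R y + (- (s / h)) *\<^sub>R p \<in> F \<inter> cball 0 1} \<subseteq> {y. y + s *\<^sub>R b k \<in> N \<inter> cball 0 R}"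
        proof
          fix y assume y: "y \<in> {y. 1 *\<^sub>R y + (- (s / h)) *\<^sub>R p \<in> F \<inter> cball 0 1}"
          define x where "x = y - (s / h) *\<^sub>R p"
          have x: "x \<in> F" "norm x \<le> 1" using y by (auto simp: x_def)
          have eq: "y + s *\<^sub>R b k = x + (s / h) *\<^sub>R g"
            using h by (simp add: x_def p_def algebra_simps)
          have "norm (x + (s / h) *\<^sub>R g) \<le> norm x + (s / h) * norm g"
            using sh(1) True h norm_triangle_ineq[of x "(s / h) *\<^sub>R g"] by simp
          also have "\<dots> \<le> R" using x sh g by (simp add: R_def)
          finally show "y \<in> {y. y + s *\<^sub>R b k \<in> N \<inter> cball 0 R}"
            using FN[OF x(1) sh(1)] by (simp add: eq)
        qed
      qed simp
      finally show ?thesis using True by simp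
    qed simp
  qed
  also have "\<dots> = emeasure (subspace_leb (Suc k) b) (N \<inter> cball 0 R)"
    by (rule emeasure_subspace_leb_Suc[symmetric]) simp
  \<comment> \<open>The cone is invariant under dilation, so shrinking by \<open>R\<close> brings
    the part in the larger ball back to the unit ball at the cost of
    \<open>R ^ Suc k\<close>.\<close>
  also have "N \<inter> cball 0 R = {x. (1 / R) *\<^sub>R x + 0 \<in> N \<inter> cball 0 1}"
  proof (intro set_eqI iffI)
    fix x assume "x \<in> N \<inter> cball 0 R"
    then show "x \<in> {x. (1 / R) *\<^sub>R x + 0 \<in> N \<inter> cball 0 1}"
      using cone[of x "1 / R"] R by (simp add: divide_simps)
  next
    fix x assume "x \<in> {x. (1 / R) *\<^sub>R x + 0 \<in> N \<inter> cball 0 1}"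
    then show "x \<in> N \<inter> cball 0 R"
      using cone[of "(1 / R) *\<^sub>R x" R] R by (simp add: divide_simps)
  qed
  also have "emeasure (subspace_leb (Suc k) b) \<dots> = ennreal (R ^ Suc k) * emeasure (subspace_leb (Suc k) b) (N \<inter> cball 0 1)"
    using R by (subst emeasure_subspace_leb_affine[OF b]) (auto simp: span_zero)
  finally have main: "ennreal (\<delta> / n) * emeasure (subspace_leb k b) (F \<inter> cball 0 1)
      \<le> ennreal (R ^ Suc k) * emeasure (subspace_leb (Suc k) b) (N \<inter> cball 0 1)" .
  define f where "f = measure (subspace_leb k b) (F \<inter> cball 0 1)"
  define m where "m = measure (subspace_leb (Suc k) b) (N \<inter> cball 0 1)"
  define \<beta> where "\<beta> = measure (subspace_leb k b) (cball 0 1)"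
  define \<gamma> where "\<gamma> = measure (subspace_leb (Suc k) b) (cball 0 1)"
  have ef: "emeasure (subspace_leb k b) (F \<inter> cball 0 1) = ennreal f"
    and em: "emeasure (subspace_leb (Suc k) b) (N \<inter> cball 0 1) = ennreal m"
    and e\<beta>: "emeasure (subspace_leb k b) (cball 0 1) = ennreal \<beta>"
    and e\<gamma>: "emeasure (subspace_leb (Suc k) b) (cball 0 1) = ennreal \<gamma>"
    using fmeasurable_subspace_leb_cball[OF b', of F 1] fmeasurable_subspace_leb_cball[OF b, of N 1]
      fmeasurable_subspace_leb_cball[OF b', of UNIV 1] fmeasurable_subspace_leb_cball[OF b, of UNIV 1]
    by (auto simp: f_def m_def \<beta>_def \<gamma>_def emeasure_eq_measure2 fmeasurableD2 emeasure_eq_ennreal_measure)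
  have nn: "f \<ge> 0" "m \<ge> 0" "\<beta> > 0" "\<gamma> > 0"
    using measure_subspace_leb_cball_pos[OF b] measure_subspace_leb_cball_pos[OF b']
    by (auto simp: f_def m_def \<beta>_def \<gamma>_def)
  have "ennreal (\<delta> / n * f) \<le> ennreal (R ^ Suc k * m)"
    using main R nn \<open>\<delta> > 0\<close> n unfolding ef em
    by (subst (1 2) ennreal_mult) auto
  then have 1: "\<delta> / n * f \<le> R ^ Suc k * m"
    using R nn by (subst (asm) ennreal_le_iff) auto
  have "R \<le> exp (1 / n)" unfolding R_def by (rule exp_ge_add_one_self)
  then have "R ^ Suc k \<le> exp (1 / n) ^ Suc k" using R by (intro power_mono) auto
  also have "\<dots> = exp (real (Suc k) * (1 / n))" by (rule exp_of_nat_mult[symmetric])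
  also have "\<dots> = exp 1" using n by (simp add: n_def)
  finally have "R ^ Suc k * m \<le> exp 1 * m" using nn by (intro mult_right_mono) auto
  with 1 have "\<delta> / n * f \<le> exp 1 * m" by (rule order_trans)
  then have 2: "f \<le> exp 1 * m * n / \<delta>" using \<open>\<delta> > 0\<close> n by (simp add: field_simps)
  have "ennreal \<gamma> \<le> ennreal (2 * \<beta>)"
    using emeasure_subspace_leb_ball_Suc_le[OF b] nn unfolding e\<beta> e\<gamma> by (simp add: ennreal_mult)
  then have 3: "\<gamma> \<le> 2 * \<beta>" using nn by (subst (asm) ennreal_le_iff) auto
  have "f / \<beta> \<le> f * (2 / \<gamma>)" using 3 nn mult_left_mono[OF 3, of f] by (simp add: field_simps)
  also have "\<dots> \<le> (exp 1 * m * n / \<delta>) * (2 / \<gamma>)" using 2 nn by (intro mult_right_mono) auto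
  finally show ?thesis
    by (simp add: cone_frac_def f_def[symmetric] m_def[symmetric] \<beta>_def[symmetric] \<gamma>_def[symmetric] n_def mult_ac)
qed

lemma sum_cone_frac_le_1:
  fixes b :: "nat \<Rightarrow> 'a::{real_inner, second_countable_topology}"
  assumes b: "orthonormal_upto k b" and "finite I"
    and meas: "\<And>i. i \<in> I \<Longrightarrow> C i \<in> sets borel"
    and null: "\<And>i j. i \<in> I \<Longrightarrow> j \<in> I \<Longrightarrow> i \<noteq> j \<Longrightarrow> AE x in subspace_leb k b. \<not> (x \<in> C i \<and> x \<in> C j)"
  shows "(\<Sum>i\<in>I. cone_frac k b (C i)) \<le> 1"
proof -
  let ?L = "subspace_leb k b" and ?B = "cball (0::'a) 1"
  have "ennreal (\<Sum>i\<in>I. measure ?L (C i \<inter> ?B)) = (\<Sum>i\<in>I. ennreal (measure ?L (C i \<inter> ?B)))" by simp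
  also have "\<dots> = (\<Sum>i\<in>I. emeasure ?L (C i \<inter> ?B))"
    using fmeasurable_subspace_leb_cball[OF b meas] by (intro sum.cong) (auto simp: emeasure_eq_measure2)
  also have "\<dots> = (\<Sum>i\<in>I. \<integral>\<^sup>+x. indicator (C i \<inter> ?B) x \<partial>?L)"
    using meas by (intro sum.cong) auto
  also have "\<dots> = (\<integral>\<^sup>+x. (\<Sum>i\<in>I. indicator (C i \<inter> ?B) x) \<partial>?L)"
    using meas by (intro nn_integral_sum[symmetric] borel_measurable_indicator) auto
  also have "\<dots> \<le> (\<integral>\<^sup>+x. indicator ?B x \<partial>?L)"
  proof (rule nn_integral_mono_AE)
    \<comment> \<open>Off a null set a point lies in at most one cone, so the indicators add up to
      at most that of the ball.\<close>
    have "AE x in ?L. \<forall>i\<in>I. \<forall>j\<in>I. i \<noteq> j \<longrightarrow> \<not> (x \<in> C i \<and> x \<in> C j)"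
      using null \<open>finite I\<close> by (auto intro!: AE_finite_allI)
    then show "AE x in ?L. (\<Sum>i\<in>I. indicator (C i \<inter> ?B) x) \<le> (indicator ?B x :: ennreal)"
    proof eventually_elim
      case (elim x)
      show ?case
      proof (cases "\<exists>i\<in>I. x \<in> C i")
        case True
        then obtain i where i: "i \<in> I" "x \<in> C i" by blast
        have "(\<Sum>j\<in>I. indicator (C j \<inter> ?B) x) = (\<Sum>j\<in>I. if j = i then indicator ?B x else (0::ennreal))"
          using elim i by (intro sum.cong) (auto simp: indicator_def)
        then show ?thesis using i \<open>finite I\<close> by simp
      next
        case False
        then show ?thesis by (simp add: indicator_def)
      qed
    qed
  qed
  also have "\<dots> = ennreal (measure ?L ?B)"
    using fmeasurable_subspace_leb_cball[OF b, of UNIV 1] by (simp add: emeasure_eq_measure2)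
  finally have "(\<Sum>i\<in>I. measure ?L (C i \<inter> ?B)) \<le> measure ?L ?B" by (subst (asm) ennreal_le_iff) auto
  then show ?thesis
    using measure_subspace_leb_cball_pos[OF b] by (simp add: cone_frac_def flip: sum_divide_distrib)
qed

section \<open>Finitely generated cones\<close>

text \<open>
  Bartl's induction: if the last functional \<open>a j\<close> is needed, some \<open>y\<close> with \<open>a j \<bullet> y = 1\<close> violates the
  claim for the others; composing all functionals with the projection along \<open>y\<close> onto the kernel of
  \<open>a j\<close> eliminates \<open>a j\<close>.
\<close>

lemma Farkas:
  fixes a :: "'i \<Rightarrow> 'a::real_inner"
  assumes "finite I" and "\<And>d. (\<forall>i\<in>I. a i \<bullet> d \<le> 0) \<Longrightarrow> c \<bullet> d \<le> 0"
  shows "\<exists>z. (\<forall>i\<in>I. 0 \<le> z i) \<and> c = (\<Sum>i\<in>I. z i *\<^sub>R a i)"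
  using assms
proof (induction I arbitrary: a c rule: finite_induct)
  case empty
  from empty.prems[of c] have "c \<bullet> c \<le> 0" by simp
  then have "c = 0" using inner_ge_zero[of c] by (metis antisym inner_eq_zero_iff)
  then show ?case by simp
next
  case (insert j I)
  show ?case
  proof (cases "\<forall>d. (\<forall>i\<in>I. a i \<bullet> d \<le> 0) \<longrightarrow> c \<bullet> d \<le> 0")
    case True
    then obtain z where z: "\<forall>i\<in>I. 0 \<le> z i" "c = (\<Sum>i\<in>I. z i *\<^sub>R a i)"
      using insert.IH[of a c] by blast
    have "(\<Sum>i\<in>I. (z(j := 0)) i *\<^sub>R a i) = (\<Sum>i\<in>I. z i *\<^sub>R a i)"
      using insert.hyps by (intro sum.cong) auto
    with z insert.hyps show ?thesis by (intro exI[of _ "z(j := 0)"]) simp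
  next
    case False
    then obtain x where x: "\<And>i. i \<in> I \<Longrightarrow> a i \<bullet> x \<le> 0" "c \<bullet> x > 0" by (meson not_le)
    have jx: "a j \<bullet> x > 0"
    proof (rule ccontr)
      assume "\<not> a j \<bullet> x > 0"
      with x have "c \<bullet> x \<le> 0" by (intro insert.prems) auto
      with x show False by simp
    qed
    define y where "y = (1 / (a j \<bullet> x)) *\<^sub>R x"
    have y: "a j \<bullet> y = 1" "\<And>i. i \<in> I \<Longrightarrow> a i \<bullet> y \<le> 0" "c \<bullet> y > 0"
      using jx x by (auto simp: y_def divide_simps mult_nonpos_nonneg)
    \<comment> \<open>Projection may make functionals coincide or vanish, which is harmless because
      the induction runs over an index set.\<close>
    define a' where "a' i = a i - (a i \<bullet> y) *\<^sub>R a j" for i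
    define c' where "c' = c - (c \<bullet> y) *\<^sub>R a j"
    have "\<exists>z. (\<forall>i\<in>I. 0 \<le> z i) \<and> c' = (\<Sum>i\<in>I. z i *\<^sub>R a' i)"
    proof (rule insert.IH)
      fix d assume d: "\<forall>i\<in>I. a' i \<bullet> d \<le> 0"
      have "c \<bullet> (d - (a j \<bullet> d) *\<^sub>R y) \<le> 0"
        using d y(1) by (intro insert.prems) (auto simp: a'_def inner_diff_left inner_diff_right mult.commute)
      then show "c' \<bullet> d \<le> 0" by (simp add: c'_def inner_diff_left inner_diff_right mult.commute)
    qed
    then obtain z where z: "\<forall>i\<in>I. 0 \<le> z i" "c' = (\<Sum>i\<in>I. z i *\<^sub>R a' i)" by blast
    \<comment> \<open>The coefficient left for \<open>a j\<close> when the projected combination is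
      expanded; it is nonnegative because \<open>c \<bullet> y > 0\<close> and every
      \<open>a i \<bullet> y\<close> is at most 0.\<close>
    define t where "t = c \<bullet> y - (\<Sum>i\<in>I. z i * (a i \<bullet> y))"
    have "(\<Sum>i\<in>I. z i * (a i \<bullet> y)) \<le> 0" using z(1) y(2) by (intro sum_nonpos mult_nonneg_nonpos) auto
    then have t: "t \<ge> 0" using y(3) by (simp add: t_def)
    have "c = c' + (c \<bullet> y) *\<^sub>R a j" by (simp add: c'_def)
    also have "c' = (\<Sum>i\<in>I. z i *\<^sub>R a i) - (\<Sum>i\<in>I. z i * (a i \<bullet> y)) *\<^sub>R a j"
      unfolding z(2) a'_def by (simp add: scaleR_diff_right sum_subtractf scaleR_left.sum)
    finally have "c = (\<Sum>i\<in>I. z i *\<^sub>R a i) + t *\<^sub>R a j" by (simp add: t_def algebra_simps)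
    moreover have "(\<Sum>i\<in>I. (z(j := t)) i *\<^sub>R a i) = (\<Sum>i\<in>I. z i *\<^sub>R a i)"
      using insert.hyps by (intro sum.cong) auto
    ultimately show ?thesis using z(1) t insert.hyps
      by (intro exI[of _ "z(j := t)"]) (simp add: add.commute)
  qed
qed

text \<open>A span is the cone generated by the vectors and their negatives, and a functional that
  is nonpositive on both vanishes on the span.\<close>

lemma separating_functional_span:
  fixes G :: "'a::real_inner set"
  assumes "finite G" "x \<notin> span G"
  shows "\<exists>d. (\<forall>g\<in>G. g \<bullet> d = 0) \<and> x \<bullet> d > 0"
proof (rule ccontr)
  assume *: "\<nexists>d. (\<forall>g\<in>G. g \<bullet> d = 0) \<and> x \<bullet> d > 0"
  have "\<exists>z. (\<forall>h\<in>G \<union> uminus ` G. 0 \<le> z h) \<and> x = (\<Sum>h\<in>G \<union> uminus ` G. z h *\<^sub>R h)"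
  proof (rule Farkas)
    fix d assume d: "\<forall>h\<in>G \<union> uminus ` G. h \<bullet> d \<le> 0"
    have "g \<bullet> d = 0" if "g \<in> G" for g
      using that d[THEN bspec, of g] d[THEN bspec, of "- g"] by auto
    with * show "x \<bullet> d \<le> 0" by (meson not_le)
  qed (use assms in auto)
  then obtain z where x: "x = (\<Sum>h\<in>G \<union> uminus ` G. z h *\<^sub>R h)" by blast
  have "x \<in> span G" unfolding x
    by (intro span_sum span_scale) (auto intro: span_base span_neg)
  with assms show False by simp
qed

text \<open>For infinite \<open>G\<close> the sum defaults to 0 and the cone collapses to the
  origin, hence the finiteness assumption wherever generators must belong to it.\<close>

definition gen_cone :: "'a::real_vector set \<Rightarrow> 'a set" where
  "gen_cone G = {x. \<exists>z. (\<forall>g\<in>G. 0 \<le> z g) \<and> x = (\<Sum>g\<in>G. z g *\<^sub>R g)}"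

lemma gen_cone_0: "0 \<in> gen_cone G"
  unfolding gen_cone_def by (auto intro!: exI[of _ "\<lambda>_. 0"])

lemma gen_cone_add: "x \<in> gen_cone G \<Longrightarrow> y \<in> gen_cone G \<Longrightarrow> x + y \<in> gen_cone G"
  unfolding gen_cone_def
proof safe
  fix z w :: "'a \<Rightarrow> real" assume "\<forall>g\<in>G. 0 \<le> z g" "\<forall>g\<in>G. 0 \<le> w g"
  then show "\<exists>u. (\<forall>g\<in>G. 0 \<le> u g) \<and> (\<Sum>g\<in>G. z g *\<^sub>R g) + (\<Sum>g\<in>G. w g *\<^sub>R g) = (\<Sum>g\<in>G. u g *\<^sub>R g)"
    by (intro exI[of _ "\<lambda>g. z g + w g"]) (simp add: scaleR_left_distrib sum.distrib)
qed

lemma gen_cone_scale: "x \<in> gen_cone G \<Longrightarrow> 0 \<le> t \<Longrightarrow> t *\<^sub>R x \<in> gen_cone G"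
  unfolding gen_cone_def
proof safe
  fix z :: "'a \<Rightarrow> real" assume "\<forall>g\<in>G. 0 \<le> z g" "0 \<le> t"
  then show "\<exists>u. (\<forall>g\<in>G. 0 \<le> u g) \<and> t *\<^sub>R (\<Sum>g\<in>G. z g *\<^sub>R g) = (\<Sum>g\<in>G. u g *\<^sub>R g)"
    by (intro exI[of _ "\<lambda>g. t * z g"]) (simp add: scaleR_right.sum)
qed

lemma gen_cone_sum: "(\<And>i. i \<in> I \<Longrightarrow> f i \<in> gen_cone G) \<Longrightarrow> (\<Sum>i\<in>I. f i) \<in> gen_cone G"
  by (induction I rule: infinite_finite_induct) (auto simp: gen_cone_0 gen_cone_add)

lemma gen_cone_base: "finite G \<Longrightarrow> g \<in> G \<Longrightarrow> g \<in> gen_cone G"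
  unfolding gen_cone_def
  by (auto intro!: exI[of _ "\<lambda>h. if h = g then 1 else 0"] simp: if_distrib[of "\<lambda>t. t *\<^sub>R _"] cong: if_cong)

lemma gen_cone_subset: "H \<subseteq> gen_cone G \<Longrightarrow> gen_cone H \<subseteq> gen_cone G"
proof
  fix x assume "H \<subseteq> gen_cone G" "x \<in> gen_cone H"
  then obtain z where z: "\<forall>h\<in>H. 0 \<le> z h" "x = (\<Sum>h\<in>H. z h *\<^sub>R h)" by (auto simp: gen_cone_def)
  show "x \<in> gen_cone G" unfolding z(2)
    using \<open>H \<subseteq> gen_cone G\<close> z(1) by (intro gen_cone_sum gen_cone_scale) auto
qed

lemma gen_cone_subset_span: "gen_cone G \<subseteq> span G"
  by (auto simp: gen_cone_def intro!: span_sum span_scale[OF span_base])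

lemma separating_functional_gen_cone:
  fixes G :: "'a::real_inner set"
  assumes "finite G" "x \<notin> gen_cone G"
  shows "\<exists>d. (\<forall>g\<in>G. g \<bullet> d \<le> 0) \<and> x \<bullet> d > 0"
proof (rule ccontr)
  assume "\<nexists>d. (\<forall>g\<in>G. g \<bullet> d \<le> 0) \<and> x \<bullet> d > 0"
  then have "\<exists>z. (\<forall>g\<in>G. 0 \<le> z g) \<and> x = (\<Sum>g\<in>G. z g *\<^sub>R g)"
    using assms(1) by (intro Farkas) (auto simp: not_le[symmetric])
  with assms(2) show False by (auto simp: gen_cone_def)
qed

text \<open>Normalise the nonzero generators and choose a unit generating set of least cardinality;
  a redundant member could be dropped.\<close>

lemma minimal_unit_generators:
  fixes G :: "'a::real_inner set"
  assumes "finite G"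
  obtains H where "finite H" "\<And>h. h \<in> H \<Longrightarrow> norm h = 1" "gen_cone H = gen_cone G"
    "\<And>h. h \<in> H \<Longrightarrow> h \<notin> gen_cone (H - {h})"
proof -
  let ?Q = "\<lambda>H. finite H \<and> (\<forall>h\<in>H. norm h = 1) \<and> gen_cone H = gen_cone G"
  let ?H = "sgn ` (G - {0})"
  have "gen_cone ?H = gen_cone G"
  proof (rule antisym; rule gen_cone_subset)
    show "?H \<subseteq> gen_cone G"
      using assms by (auto simp: sgn_div_norm intro!: gen_cone_scale[OF gen_cone_base])
    show "G \<subseteq> gen_cone ?H"
    proof
      fix g assume g: "g \<in> G"
      show "g \<in> gen_cone ?H"
      proof (cases "g = 0")
        case False
        then have "norm g *\<^sub>R sgn g \<in> gen_cone ?H"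
          using assms g by (intro gen_cone_scale gen_cone_base) auto
        then show ?thesis using False by (simp add: sgn_div_norm)
      qed (simp add: gen_cone_0)
    qed
  qed
  then have Q: "?Q ?H" using assms by (simp add: norm_sgn)
  obtain H where Hmin: "?Q H \<and> (\<forall>K. ?Q K \<longrightarrow> card H \<le> card K)"
    using ex_has_least_nat[of ?Q, OF Q, of card] by (rule exE)
  then have H: "?Q H" and min: "\<And>K. ?Q K \<Longrightarrow> card H \<le> card K" by simp_all
  have "h \<notin> gen_cone (H - {h})" if "h \<in> H" for h
  proof
    assume h: "h \<in> gen_cone (H - {h})"
    have "gen_cone (H - {h}) = gen_cone H"
    proof (rule antisym; rule gen_cone_subset)
      show "H - {h} \<subseteq> gen_cone H" using H by (auto intro: gen_cone_base)
      show "H \<subseteq> gen_cone (H - {h})"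
      proof
        fix k assume "k \<in> H"
        then show "k \<in> gen_cone (H - {h})" using H h by (cases "k = h") (auto intro: gen_cone_base)
      qed
    qed
    with H have "?Q (H - {h})" by simp
    then have "card H \<le> card (H - {h})" by (rule min)
    with H that card_Diff1_less[of H h] show False by simp
  qed
  with H show thesis by (intro that[of H]) simp_all
qed

text \<open>Identifies the extreme rays, defined through faces, with an irredundant list of
  generators. The functional \<open>d\<close> certifies pointedness, without which a generator need
  not span a face.\<close>

lemma ray_generators_gen_cone:
  fixes G :: "'a::real_inner set"
  assumes "finite G" and unit: "\<And>g. g \<in> G \<Longrightarrow> norm g = 1"
    and minimal: "\<And>g. g \<in> G \<Longrightarrow> g \<notin> gen_cone (G - {g})"
    and pointed: "\<And>g. g \<in> G \<Longrightarrow> g \<bullet> d < 0"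
  shows "ray_generators (gen_cone G) = G"
proof
  let ?N = "gen_cone G"
  show "G \<subseteq> ray_generators ?N"
  proof
    fix g assume g: "g \<in> G"
    let ?R = "{t *\<^sub>R g |t. 0 \<le> t}"
    have on_ray: "x \<in> ?R \<and> y \<in> ?R"
      if x: "x \<in> ?N" and y: "y \<in> ?N" and u: "0 < u" "u < 1" and s: "(1 - u) *\<^sub>R x + u *\<^sub>R y = s *\<^sub>R g" for x y u s
    proof -
      obtain p where p: "\<forall>h\<in>G. 0 \<le> p h" "x = (\<Sum>h\<in>G. p h *\<^sub>R h)" using x by (auto simp: gen_cone_def)
      obtain q where q: "\<forall>h\<in>G. 0 \<le> q h" "y = (\<Sum>h\<in>G. q h *\<^sub>R h)" using y by (auto simp: gen_cone_def)
      define z where "z h = (1 - u) * p h + u * q h" for h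
      have z: "z h \<ge> 0" if "h \<in> G" for h using p q u that by (simp add: z_def)
      have "s *\<^sub>R g = (\<Sum>h\<in>G. z h *\<^sub>R h)"
        unfolding s[symmetric] p(2) q(2) z_def
        by (simp add: scaleR_left_distrib sum.distrib scaleR_right.sum)
      also have "\<dots> = z g *\<^sub>R g + (\<Sum>h\<in>G - {g}. z h *\<^sub>R h)" using g \<open>finite G\<close> by (simp add: sum.remove)
      finally have eq: "(s - z g) *\<^sub>R g = (\<Sum>h\<in>G - {g}. z h *\<^sub>R h)" by (simp add: algebra_simps)
      have rest: "(\<Sum>h\<in>G - {g}. z h *\<^sub>R h) \<in> gen_cone (G - {g})" using z by (auto simp: gen_cone_def)
      \<comment> \<open>Otherwise \<open>g\<close> would be a nonnegative combination of the other
        generators.\<close>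
      have "s \<le> z g"
      proof (rule ccontr)
        assume "\<not> s \<le> z g"
        then have "g = (1 / (s - z g)) *\<^sub>R (\<Sum>h\<in>G - {g}. z h *\<^sub>R h)" unfolding eq[symmetric] by simp
        then have "g \<in> gen_cone (G - {g})"
          using \<open>\<not> s \<le> z g\<close> gen_cone_scale[OF rest, of "1 / (s - z g)"] by simp
        with minimal[OF g] show False by simp
      qed
      have terms: "z h * (h \<bullet> d) \<le> 0" if "h \<in> G" for h
        using z[OF that] pointed[OF that] by (simp add: mult_nonneg_nonpos)
      \<comment> \<open>Pairing \<open>eq\<close> with \<open>d\<close> makes the left side
        nonnegative and each term on the right nonpositive, so all coefficients off \<open>g\<close>
        vanish.\<close>
      have "0 \<le> (s - z g) * (g \<bullet> d)" using \<open>s \<le> z g\<close> pointed[OF g] by (simp add: mult_nonpos_nonpos)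
      also have "(s - z g) * (g \<bullet> d) = (\<Sum>h\<in>G - {g}. z h * (h \<bullet> d))"
        using arg_cong[OF eq, of "\<lambda>x. x \<bullet> d"] by (simp add: inner_sum_left)
      finally have "(\<Sum>h\<in>G - {g}. - (z h * (h \<bullet> d))) \<le> 0" by (simp add: sum_negf)
      moreover have "(\<Sum>h\<in>G - {g}. - (z h * (h \<bullet> d))) \<ge> 0"
        by (rule sum_nonneg) (use terms in auto)
      ultimately have "(\<Sum>h\<in>G - {g}. - (z h * (h \<bullet> d))) = 0" by simp
      then have "\<forall>h\<in>G - {g}. - (z h * (h \<bullet> d)) = 0"
        using \<open>finite G\<close> terms by (subst (asm) sum_nonneg_eq_0_iff) auto
      then have z0: "z h = 0" if "h \<in> G - {g}" for h using that pointed[of h] by auto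
      have pq: "p h = 0" "q h = 0" if "h \<in> G - {g}" for h
      proof -
        have "(1 - u) * p h \<ge> 0" "u * q h \<ge> 0" using p q u that by auto
        then have "(1 - u) * p h = 0" "u * q h = 0" using z0[OF that] unfolding z_def by linarith+
        then show "p h = 0" "q h = 0" using u by auto
      qed
      have "x = p g *\<^sub>R g" "y = q g *\<^sub>R g"
        unfolding p(2) q(2) using g \<open>finite G\<close> pq by (auto simp: sum.remove)
      then show ?thesis using p q g by auto
    qed
    have "?R face_of ?N"
      unfolding face_of_def
    proof (intro conjI ballI impI)
      show "?R \<subseteq> ?N" using g \<open>finite G\<close> by (auto intro!: gen_cone_scale[OF gen_cone_base])
      show "convex ?R"
      proof (rule convexI)
        fix x y and u v :: real assume "x \<in> ?R" "y \<in> ?R" "0 \<le> u" "0 \<le> v"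
        then obtain s t where "x = s *\<^sub>R g" "y = t *\<^sub>R g" "0 \<le> s" "0 \<le> t" by auto
        then show "u *\<^sub>R x + v *\<^sub>R y \<in> ?R" using \<open>0 \<le> u\<close> \<open>0 \<le> v\<close>
          by (auto intro!: exI[of _ "u * s + v * t"] simp: scaleR_left_distrib)
      qed
      fix a b x assume ab: "a \<in> ?N" "b \<in> ?N" and x: "x \<in> ?R" "x \<in> open_segment a b"
      from x(2) obtain u where "0 < u" "u < 1" "x = (1 - u) *\<^sub>R a + u *\<^sub>R b"
        by (auto simp: in_segment)
      with ab x(1) show "a \<in> ?R" "b \<in> ?R" using on_ray[of a b u] by auto
    qed
    then show "g \<in> ray_generators ?N" using unit[OF g] by (simp add: ray_generators_def)
  qed
  show "ray_generators ?N \<subseteq> G"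
  proof
    fix g assume "g \<in> ray_generators ?N"
    then have g: "norm g = 1" and face: "{t *\<^sub>R g |t. 0 \<le> t} face_of ?N" by (auto simp: ray_generators_def)
    let ?R = "{t *\<^sub>R g |t. 0 \<le> t}"
    have gR: "g \<in> ?R" by (auto intro: exI[of _ 1])
    then have "g \<in> ?N" using face face_of_imp_subset by blast
    then obtain z where z: "\<forall>h\<in>G. 0 \<le> z h" "g = (\<Sum>h\<in>G. z h *\<^sub>R h)" by (auto simp: gen_cone_def)
    have "\<exists>h\<in>G. z h \<noteq> 0"
    proof (rule ccontr)
      assume "\<not> (\<exists>h\<in>G. z h \<noteq> 0)"
      then have "g = 0" unfolding z(2) by (intro sum.neutral) auto
      with g show False by simp
    qed
    then obtain h where h: "h \<in> G" "z h > 0" using z(1) by (metis less_eq_real_def)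
    \<comment> \<open>The factor 2 makes \<open>g\<close> the midpoint of \<open>a\<close> and
      \<open>b\<close>. The face property then pulls \<open>a\<close>, and with it \<open>h\<close>,
      onto the ray of \<open>g\<close>; if \<open>a = b\<close> the segment is degenerate and both
      equal \<open>g\<close>.\<close>
    define a where "a = (2 * z h) *\<^sub>R h"
    define b where "b = 2 *\<^sub>R (\<Sum>k\<in>G - {h}. z k *\<^sub>R k)"
    have "g = z h *\<^sub>R h + (\<Sum>k\<in>G - {h}. z k *\<^sub>R k)"
      unfolding z(2) using h \<open>finite G\<close> by (simp add: sum.remove)
    then have mid: "g = (1 - 1/2) *\<^sub>R a + (1/2) *\<^sub>R b" by (simp add: a_def b_def)
    have aN: "a \<in> ?N" using h \<open>finite G\<close> by (auto simp: a_def intro!: gen_cone_scale[OF gen_cone_base])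
    have bN: "b \<in> ?N" unfolding b_def using z(1) \<open>finite G\<close>
      by (intro gen_cone_scale gen_cone_sum) (auto intro: gen_cone_base)
    have "a \<in> ?R"
    proof (cases "a = b")
      case True
      then show ?thesis using mid gR by (simp flip: scaleR_left_distrib)
    next
      case False
      then have "g \<in> open_segment a b" using mid by (auto simp: in_segment intro!: exI[of _ "1/2"])
      then show ?thesis using face aN bN gR unfolding face_of_def by blast
    qed
    then obtain t where t: "0 \<le> t" "(2 * z h) *\<^sub>R h = t *\<^sub>R g" by (auto simp: a_def)
    then have "\<bar>2 * z h\<bar> * norm h = \<bar>t\<bar> * norm g" by (metis norm_scaleR)
    then have "2 * z h = t" using g unit[OF h(1)] h(2) t(1) by simp
    then have "h = g" using t(2) h(2) by simp
    then show "g \<in> G" using h by simp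
  qed
qed

section \<open>Uniqueness of the affine dimension\<close>

lemma card_affine_independent_le:
  assumes "finite B" "B \<noteq> {}" "\<not> affine_dependent C" "C \<subseteq> affine hull B"
  shows "card C \<le> card B"
proof (cases "C = {}")
  case False
  obtain b where b: "b \<in> B" using assms by blast
  obtain c where c: "c \<in> C" using False by blast
  \<comment> \<open>Differences from one chosen point on each side turn the claim into the linear
    bound of an independent set by a spanning one.\<close>
  let ?D = "(\<lambda>x. - b + x) ` (B - {b})"
  have hull: "affine hull B = (\<lambda>x. b + x) ` span ?D"
    using affine_hull_insert_span_gen[of b "B - {b}"] b by (simp add: insert_absorb)
  have "independent ((\<lambda>x. - c + x) ` (C - {c}))"
    using assms(3) affine_dependent_iff_dependent2[OF c] by simp
  moreover have "(\<lambda>x. - c + x) ` (C - {c}) \<subseteq> span ?D"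
  proof
    fix y assume "y \<in> (\<lambda>x. - c + x) ` (C - {c})"
    then obtain x where x: "x \<in> C" "y = - c + x" by blast
    then obtain p q where "p \<in> span ?D" "q \<in> span ?D" "x = b + p" "c = b + q"
      using assms(4) c unfolding hull by blast
    then show "y \<in> span ?D" unfolding x(2) using span_diff[of p ?D q] by (simp add: algebra_simps)
  qed
  ultimately have "finite ((\<lambda>x. - c + x) ` (C - {c})) \<and> card ((\<lambda>x. - c + x) ` (C - {c})) \<le> card ?D"
    using assms(1) by (intro independent_span_bound) auto
  then have "finite (C - {c})" "card (C - {c}) \<le> card (B - {b})"
    by (auto simp: card_image finite_image_iff)
  then show ?thesis
    using card.remove[OF _ c] card.remove[OF assms(1) b] by simp
qed simp

lemma has_aff_dim_unique:
  assumes "has_aff_dim S d" "has_aff_dim S e"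
  shows "d = e"
proof -
  have "d \<le> e" if d: "has_aff_dim S d" and e: "has_aff_dim S e" for d e
  proof -
    obtain B where B: "finite B" "\<not> affine_dependent B" "affine hull B = affine hull S" "card B = d + 1"
      using d by (auto simp: has_aff_dim_def)
    obtain C where C: "finite C" "\<not> affine_dependent C" "affine hull C = affine hull S" "card C = e + 1"
      using e by (auto simp: has_aff_dim_def)
    have "card B \<le> card C"
      using B C hull_subset[of B affine] by (intro card_affine_independent_le) auto
    with B C show ?thesis by simp
  qed
  with assms show ?thesis by (meson antisym)
qed

section \<open>Normal cones of polyhedra\<close>

text \<open>
  The reflection taking \<open>unit_vec k\<close> to \<open>\<nu>\<close> turns the standard basis into one that ends with \<open>\<nu>\<close>.
\<close>

definition adapted_basis :: "nat \<Rightarrow> rvec \<Rightarrow> nat \<Rightarrow> rvec" where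
  "adapted_basis k \<nu> i = reflect (unit_vec k - \<nu>) (unit_vec i)"

context
  fixes k :: nat and \<nu> :: rvec
  assumes \<nu>: "\<nu> \<in> Rn (Suc k)" "norm \<nu> = 1"
begin

lemma adapted_basis_last: "adapted_basis k \<nu> k = \<nu>"
  unfolding adapted_basis_def using \<nu> by (intro reflect_diff_eq) simp

lemma orthonormal_adapted_basis: "orthonormal_upto n (adapted_basis k \<nu>)"
  unfolding adapted_basis_def
  by (rule orthonormal_upto_linear_image[OF orthogonal_transformation_reflect])
    (simp add: orthonormal_upto_def inner_unit_vec_unit_vec)

lemma span_adapted_basis: "span (adapted_basis k \<nu> ` {..<Suc k}) = Rn (Suc k)"
proof -
  let ?w = "unit_vec k - \<nu>"
  have "adapted_basis k \<nu> ` {..<Suc k} = reflect ?w ` unit_vec ` {..<Suc k}"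
    by (simp add: adapted_basis_def image_image)
  then have "span (adapted_basis k \<nu> ` {..<Suc k}) = reflect ?w ` Rn (Suc k)"
    by (simp only: linear_span_image[OF reflect_linear] span_unit_vec)
  also have "\<dots> = Rn (Suc k)"
    using \<nu> by (intro reflect_image_subspace subspace_Rn subspace_diff unit_vec_Rn) auto
  finally show ?thesis .
qed

lemma span_adapted_basis_hyperplane:
  "span (adapted_basis k \<nu> ` {..<k}) = {x \<in> Rn (Suc k). x \<bullet> \<nu> = 0}"
proof (intro equalityI subsetI)
  fix x assume x: "x \<in> span (adapted_basis k \<nu> ` {..<k})"
  have "x \<in> span (adapted_basis k \<nu> ` {..<Suc k})"
    by (rule subsetD[OF span_mono x]) auto
  moreover have "x \<bullet> adapted_basis k \<nu> k = 0"
    by (rule span_inner_orthonormal_last[OF orthonormal_adapted_basis x])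
  ultimately show "x \<in> {x \<in> Rn (Suc k). x \<bullet> \<nu> = 0}"
    by (simp add: span_adapted_basis adapted_basis_last)
next
  fix x assume x: "x \<in> {x \<in> Rn (Suc k). x \<bullet> \<nu> = 0}"
  then have "x = lincomb (Suc k) (adapted_basis k \<nu>) (\<lambda>i. x \<bullet> adapted_basis k \<nu> i)"
    using span_orthonormal_upto[OF orthonormal_adapted_basis, of x "Suc k"] span_adapted_basis by simp
  also have "\<dots> = lincomb k (adapted_basis k \<nu>) (\<lambda>i. x \<bullet> adapted_basis k \<nu> i)"
    using x by (simp add: lincomb_def adapted_basis_last)
  finally show "x \<in> span (adapted_basis k \<nu> ` {..<k})"
    using span_orthonormal_upto[OF orthonormal_adapted_basis] by blast
qed

end

text \<open>Separating functionals are found in the ambient space; projecting them brings them into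
  \<open>Rn n\<close> without changing their values on vectors of \<open>Rn n\<close>.\<close>

definition proj_Rn :: "nat \<Rightarrow> rvec \<Rightarrow> rvec" where
  "proj_Rn n x = (\<Sum>i<n. coord x i *\<^sub>R unit_vec i)"

lemma proj_Rn_in: "proj_Rn n x \<in> Rn n"
  unfolding proj_Rn_def by (intro subspace_sum subspace_Rn subspace_scale unit_vec_Rn) auto

lemma inner_proj_Rn: "y \<in> Rn n \<Longrightarrow> y \<bullet> proj_Rn n x = y \<bullet> x"
  by (subst (1 2) inner_Rn[of y n]) (auto simp: proj_Rn_def if_distrib cong: if_cong)

lemma card_independent_Rn: "independent S \<Longrightarrow> S \<subseteq> Rn n \<Longrightarrow> finite S \<and> card S \<le> n"
  using independent_span_bound[of "unit_vec ` {..<n}" S] card_image_le[of "{..<n}" unit_vec]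
  by (simp add: span_unit_vec)

lemma card_spanning_Rn:
  assumes "finite G" "Rn n \<subseteq> span G"
  shows "n \<le> card G"
proof -
  have "inj_on unit_vec {..<n}"
    by (rule inj_onI) (metis coord_unit_vec zero_neq_one)
  then have "card (unit_vec ` {..<n}) = n" by (simp add: card_image)
  moreover have "independent (unit_vec ` {..<n})"
  proof (rule pairwise_orthogonal_independent)
    show "pairwise orthogonal (unit_vec ` {..<n})"
      by (auto simp: pairwise_def orthogonal_def inner_unit_vec_unit_vec)
    show "0 \<notin> unit_vec ` {..<n}"
      by (metis imageE norm_unit_vec norm_zero zero_neq_one)
  qed
  moreover have "unit_vec ` {..<n} \<subseteq> span G" using assms(2) by (auto simp: unit_vec_Rn)
  ultimately show ?thesis using independent_span_bound[OF assms(1)] by force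
qed

text \<open>An affine basis inside the hyperplane would give n independent directions orthogonal to
  \<open>c\<close>; together with \<open>c\<close> these are too many for
  \<open>Rn n\<close>.\<close>

lemma has_aff_dim_not_in_hyperplane:
  assumes "has_aff_dim P n" "P \<subseteq> Rn n" "c \<in> Rn n" "c \<noteq> 0" "\<And>x. x \<in> P \<Longrightarrow> c \<bullet> x = \<beta>"
  shows False
proof -
  obtain B where B: "finite B" "\<not> affine_dependent B" "affine hull B = affine hull P" "card B = n + 1"
    using assms(1) by (auto simp: has_aff_dim_def)
  have "affine {x \<in> Rn n. c \<bullet> x = \<beta>}"
    unfolding affine_def
  proof (intro ballI allI impI)
    fix x y :: rvec and u v :: real
    assume xy: "x \<in> {x \<in> Rn n. c \<bullet> x = \<beta>}" "y \<in> {x \<in> Rn n. c \<bullet> x = \<beta>}" and uv: "u + v = 1"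
    have "u * \<beta> + v * \<beta> = \<beta>" using uv by (metis distrib_right mult_1)
    with xy show "u *\<^sub>R x + v *\<^sub>R y \<in> {x \<in> Rn n. c \<bullet> x = \<beta>}"
      by (auto simp: inner_add_right intro!: subspace_add subspace_scale subspace_Rn)
  qed
  then have "affine hull P \<subseteq> {x \<in> Rn n. c \<bullet> x = \<beta>}"
    using assms by (intro hull_minimal) auto
  then have BH: "B \<subseteq> {x \<in> Rn n. c \<bullet> x = \<beta>}" using hull_subset[of B affine] B(3) by auto
  obtain b where b: "b \<in> B" using B(4) by fastforce
  let ?D = "(\<lambda>x. - b + x) ` (B - {b})"
  have D: "independent ?D" using B(2) affine_dependent_iff_dependent2[OF b] by simp
  have DH: "?D \<subseteq> {x. x \<bullet> c = 0}" "?D \<subseteq> Rn n"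
    using BH b subspace_diff[OF subspace_Rn]
    by (auto simp: inner_diff_left inner_commute[of _ c] inner_diff_right subset_iff)
  have "span ?D \<subseteq> {x. x \<bullet> c = 0}"
    using DH(1) by (intro span_minimal) (auto simp: subspace_def inner_add_left)
  then have c: "c \<notin> span ?D" using \<open>c \<noteq> 0\<close> by auto
  then have "independent (insert c ?D)" by (rule independent_insertI[OF _ D])
  then have "card (insert c ?D) \<le> n" using card_independent_Rn[of "insert c ?D" n] DH assms(3) by auto
  moreover have "card (insert c ?D) = Suc (card ?D)"
    using c B(1) span_base[of c ?D] by (intro card_insert_disjoint) blast+
  moreover have "card ?D = n" using B b by (simp add: card_image)
  ultimately show False by simp
qed

section \<open>Active constraints at a point of a polyhedron\<close>

locale hpolyhedron =
  fixes n m :: nat and a :: "nat \<Rightarrow> rvec" and b :: "nat \<Rightarrow> real" and P :: "rvec set"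
  assumes P_def: "P = {x \<in> Rn n. \<forall>i<m. a i \<bullet> x \<le> b i}"
    and row_in_Rn: "\<And>i. a i \<in> Rn n"
begin

lemma convex_P: "convex P"
  unfolding P_def convex_def
proof (intro ballI allI impI)
  fix x y :: rvec and u v :: real
  assume x: "x \<in> {x \<in> Rn n. \<forall>i<m. a i \<bullet> x \<le> b i}" and y: "y \<in> {x \<in> Rn n. \<forall>i<m. a i \<bullet> x \<le> b i}"
    and uv: "0 \<le> u" "0 \<le> v" "u + v = 1"
  have "a i \<bullet> (u *\<^sub>R x + v *\<^sub>R y) \<le> b i" if "i < m" for i
    using convex_bound_le[of "a i \<bullet> x" "b i" "a i \<bullet> y" u v] x y uv that by (simp add: inner_add_right)
  then show "u *\<^sub>R x + v *\<^sub>R y \<in> {x \<in> Rn n. \<forall>i<m. a i \<bullet> x \<le> b i}"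
    using x y by (auto intro!: subspace_add subspace_scale subspace_Rn)
qed

definition active :: "rvec \<Rightarrow> nat set" where
  "active v = {i. i < m \<and> a i \<bullet> v = b i}"

lemma finite_active: "finite (active v)"
  by (simp add: active_def)

text \<open>Inactive constraints have slack and survive a small step by continuity; active ones do
  not increase along \<open>d\<close>.\<close>

lemma feasible_step:
  assumes "v \<in> P" "d \<in> Rn n" "\<And>i. i \<in> active v \<Longrightarrow> a i \<bullet> d \<le> 0"
  shows "\<exists>e>0. v + e *\<^sub>R d \<in> P"
proof -
  have "eventually (\<lambda>e. a i \<bullet> (v + e *\<^sub>R d) \<le> b i) (at_right 0)" if i: "i < m" for i
  proof (cases "i \<in> active v")
    case True
    have "eventually (\<lambda>e::real. e > 0) (at_right 0)" by (simp add: eventually_at_right_less)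
    then show ?thesis
    proof eventually_elim
      case (elim e)
      then have "e * (a i \<bullet> d) \<le> 0" using assms(3)[OF True] by (simp add: mult_nonneg_nonpos)
      then show ?case using True by (simp add: active_def inner_add_right)
    qed
  next
    case False
    then have "a i \<bullet> (v + 0 *\<^sub>R d) < b i" using i assms(1) by (auto simp: active_def P_def less_le)
    moreover have "((\<lambda>e. a i \<bullet> (v + e *\<^sub>R d)) \<longlongrightarrow> a i \<bullet> (v + 0 *\<^sub>R d)) (at_right 0)"
      by (intro tendsto_intros)
    ultimately have "eventually (\<lambda>e. a i \<bullet> (v + e *\<^sub>R d) < b i) (at_right 0)"
      by (rule order_tendstoD(2)[rotated])
    then show ?thesis by eventually_elim simp
  qed
  then have "eventually (\<lambda>e. \<forall>i\<in>{..<m}. a i \<bullet> (v + e *\<^sub>R d) \<le> b i) (at_right 0)"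
    by (intro eventually_ball_finite) auto
  moreover have "eventually (\<lambda>e::real. e > 0) (at_right 0)" by (simp add: eventually_at_right_less)
  ultimately have "eventually (\<lambda>e. e > 0 \<and> v + e *\<^sub>R d \<in> P) (at_right 0)"
  proof eventually_elim
    case (elim e)
    then show ?case using assms(1,2) by (auto simp: P_def intro!: subspace_add subspace_scale subspace_Rn)
  qed
  then show ?thesis using eventually_happens[of _ "at_right (0::real)"] by force
qed

text \<open>If \<open>c\<close> were outside the generated cone, a separating direction would be
  feasible at \<open>v\<close> and would increase \<open>c\<close>.\<close>

lemma normal_cone_eq_gen_cone:
  assumes "v \<in> P"
  shows "normal_cone n P v = gen_cone (a ` active v)"
proof
  show "gen_cone (a ` active v) \<subseteq> normal_cone n P v"
  proof
    fix c assume "c \<in> gen_cone (a ` active v)"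
    then obtain z where z: "\<forall>g\<in>a ` active v. 0 \<le> z g" "c = (\<Sum>g\<in>a ` active v. z g *\<^sub>R g)"
      by (auto simp: gen_cone_def)
    have "c \<in> Rn n" unfolding z(2)
      by (intro subspace_sum subspace_Rn subspace_scale) (auto simp: row_in_Rn)
    moreover have "c \<bullet> x \<le> c \<bullet> v" if "x \<in> P" for x
      unfolding z(2) inner_sum_left
      using z(1) that by (intro sum_mono) (auto simp: active_def P_def intro!: mult_left_mono)
    ultimately show "c \<in> normal_cone n P v" by (simp add: normal_cone_def)
  qed
  show "normal_cone n P v \<subseteq> gen_cone (a ` active v)"
  proof (rule subsetI, rule ccontr)
    fix c assume c: "c \<in> normal_cone n P v" "c \<notin> gen_cone (a ` active v)"
    then obtain d where d: "\<forall>g\<in>a ` active v. g \<bullet> d \<le> 0" "c \<bullet> d > 0"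
      using separating_functional_gen_cone[of "a ` active v" c] finite_active by auto
    have "\<exists>e>0. v + e *\<^sub>R proj_Rn n d \<in> P"
      using assms d(1) by (intro feasible_step) (auto simp: inner_proj_Rn row_in_Rn proj_Rn_in)
    then obtain e where e: "e > 0" "v + e *\<^sub>R proj_Rn n d \<in> P" by blast
    then have "c \<bullet> (v + e *\<^sub>R proj_Rn n d) \<le> c \<bullet> v" using c(1) by (simp add: normal_cone_def)
    then have "e * (c \<bullet> d) \<le> 0" using c(1) by (simp add: inner_add_right inner_proj_Rn normal_cone_def)
    then show False using e d by (simp add: mult_le_0_iff)
  qed
qed

text \<open>A nonzero direction orthogonal to all active rows could be followed both ways inside
  \<open>P\<close>, placing \<open>v\<close> in the interior of a segment.\<close>

lemma vertex_active_span:
  assumes "v extreme_point_of P"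
  shows "Rn n \<subseteq> span (a ` active v)"
proof (rule subsetI, rule ccontr)
  fix x assume x: "x \<in> Rn n" "x \<notin> span (a ` active v)"
  then obtain d where d: "\<forall>g\<in>a ` active v. g \<bullet> d = 0" "x \<bullet> d > 0"
    using separating_functional_span[of "a ` active v" x] finite_active by auto
  define y where "y = proj_Rn n d"
  have y: "y \<in> Rn n" "\<And>i. i \<in> active v \<Longrightarrow> a i \<bullet> y = 0" "x \<bullet> y > 0"
    using d x by (auto simp: y_def proj_Rn_in inner_proj_Rn row_in_Rn)
  then have "y \<noteq> 0" by auto
  have v: "v \<in> P" using assms by (simp add: extreme_point_of_def)
  obtain s where s: "s > 0" "v + s *\<^sub>R y \<in> P" using feasible_step[OF v y(1)] y(2) by force
  obtain t where t: "t > 0" "v + t *\<^sub>R (- y) \<in> P"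
    using feasible_step[OF v, of "- y"] y by (auto simp: subspace_neg[OF subspace_Rn])
  have "v \<in> open_segment (v + t *\<^sub>R (- y)) (v + s *\<^sub>R y)"
    unfolding in_segment
  \<comment> \<open>This weight balances a step of length \<open>t\<close> backwards against one of
    length \<open>s\<close> forwards.\<close>
  proof (intro conjI exI[of _ "t / (s + t)"])
    have "v + t *\<^sub>R (- y) \<noteq> v + s *\<^sub>R y"
    proof
      assume "v + t *\<^sub>R (- y) = v + s *\<^sub>R y"
      then have "(s + t) *\<^sub>R y = 0" by (simp add: algebra_simps)
      then show False using s t \<open>y \<noteq> 0\<close> by auto
    qed
    then show "v + t *\<^sub>R - y \<noteq> v + s *\<^sub>R y" .
    have "(1 - t / (s + t)) *\<^sub>R (v + t *\<^sub>R - y) + (t / (s + t)) *\<^sub>R (v + s *\<^sub>R y)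
        = v + ((t / (s + t)) * s - (1 - t / (s + t)) * t) *\<^sub>R y"
      by (simp add: algebra_simps)
    also have "(t / (s + t)) * s - (1 - t / (s + t)) * t = 0" using s t by (simp add: field_simps)
    finally show "v = (1 - t / (s + t)) *\<^sub>R (v + t *\<^sub>R - y) + (t / (s + t)) *\<^sub>R (v + s *\<^sub>R y)" by simp
  qed (use s t in auto)
  then show False using assms s t by (auto simp: extreme_point_of_def)
qed

text \<open>Full dimension gives each nonzero active row a point of \<open>P\<close> where it is
  strictly smaller than at \<open>v\<close>. The sum of the steps to these points decreases all such
  rows strictly, since no step increases any of them. The result is the certificate that the normal
  cone is pointed.\<close>

lemma strictly_feasible_direction:
  assumes "has_aff_dim P n" "v \<in> P"
  shows "\<exists>d\<in>Rn n. \<forall>c\<in>normal_cone n P v. c \<noteq> 0 \<longrightarrow> c \<bullet> d < 0"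
proof -
  let ?J = "a ` active v - {0}"
  have "finite ?J" by (simp add: finite_active)
  have "\<exists>x\<in>P. c \<bullet> x < c \<bullet> v" if c: "c \<in> normal_cone n P v" "c \<noteq> 0" for c
  proof (rule ccontr)
    assume "\<not> (\<exists>x\<in>P. c \<bullet> x < c \<bullet> v)"
    then have "\<And>x. x \<in> P \<Longrightarrow> c \<bullet> x = c \<bullet> v" using c(1) by (force simp: normal_cone_def)
    then show False
      using has_aff_dim_not_in_hyperplane[OF assms(1), of c "c \<bullet> v"] c by (auto simp: P_def normal_cone_def)
  qed
  moreover have JN: "?J \<subseteq> normal_cone n P v"
    unfolding normal_cone_eq_gen_cone[OF assms(2)] using finite_active by (auto intro: gen_cone_base)
  ultimately have "\<forall>g\<in>?J. \<exists>x\<in>P. g \<bullet> x < g \<bullet> v" by blast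
  then obtain f where f: "\<And>g. g \<in> ?J \<Longrightarrow> f g \<in> P \<and> g \<bullet> f g < g \<bullet> v" by metis
  define d where "d = (\<Sum>g\<in>?J. f g - v)"
  have "d \<in> Rn n" unfolding d_def
    using f assms(2) by (intro subspace_sum subspace_Rn subspace_diff) (auto simp: P_def)
  have le: "h \<bullet> (f g - v) \<le> 0" if "g \<in> ?J" "h \<in> normal_cone n P v" for g h
    using f[OF that(1)] that(2) by (auto simp: normal_cone_def inner_diff_right)
  have Jd: "h \<bullet> d < 0" if "h \<in> ?J" for h
  proof -
    have "h \<bullet> d = h \<bullet> (f h - v) + (\<Sum>g\<in>?J - {h}. h \<bullet> (f g - v))"
      unfolding d_def inner_sum_right using \<open>finite ?J\<close> that by (rule sum.remove)
    moreover have "(\<Sum>g\<in>?J - {h}. h \<bullet> (f g - v)) \<le> 0"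
      using le that JN by (intro sum_nonpos) blast
    moreover have "h \<bullet> (f h - v) < 0" using f[OF that] by (simp add: inner_diff_right)
    ultimately show ?thesis by simp
  qed
  have "c \<bullet> d < 0" if c: "c \<in> normal_cone n P v" "c \<noteq> 0" for c
  proof -
    obtain z where z: "\<forall>g\<in>a ` active v. 0 \<le> z g" "c = (\<Sum>g\<in>a ` active v. z g *\<^sub>R g)"
      using c(1) unfolding normal_cone_eq_gen_cone[OF assms(2)] by (auto simp: gen_cone_def)
    have le0: "z g * (g \<bullet> d) \<le> 0" if "g \<in> a ` active v" for g
      using z(1) Jd[of g] that by (cases "g = 0") (auto simp: mult_nonneg_nonpos)
    have cd: "c \<bullet> d = (\<Sum>g\<in>a ` active v. z g * (g \<bullet> d))" unfolding z(2) by (simp add: inner_sum_left)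
    have "\<exists>g\<in>a ` active v. z g *\<^sub>R g \<noteq> 0"
      using c(2) unfolding z(2) by (meson sum.neutral)
    then obtain h where h: "h \<in> a ` active v" "z h \<noteq> 0" "h \<noteq> 0" by auto
    then have "z h > 0" "h \<bullet> d < 0" using z(1) Jd[of h] by (auto simp: less_le)
    then have "z h * (h \<bullet> d) < 0" by (rule mult_pos_neg)
    moreover have "c \<bullet> d = z h * (h \<bullet> d) + (\<Sum>g\<in>a ` active v - {h}. z g * (g \<bullet> d))"
      unfolding cd using h finite_active by (intro sum.remove) auto
    moreover have "(\<Sum>g\<in>a ` active v - {h}. z g * (g \<bullet> d)) \<le> 0" using le0 by (intro sum_nonpos) auto
    ultimately show ?thesis by simp
  qed
  with \<open>d \<in> Rn n\<close> show ?thesis by blast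
qed

end

text \<open>In a generating set of least cardinality no point lies in the hull of the others, so
  each is extreme.\<close>

lemma polytope_eq_convex_hull_vertices:
  assumes "polytope P"
  shows "finite (vertices P)" and "P = convex hull (vertices P)"
proof -
  let ?Q = "\<lambda>W. finite W \<and> P = convex hull W"
  obtain W0 where W0: "?Q W0" using assms by (auto simp: polytope_def)
  obtain W where "?Q W \<and> (\<forall>K. ?Q K \<longrightarrow> card W \<le> card K)"
    using ex_has_least_nat[of ?Q, OF W0, of card] by (rule exE)
  then have W: "finite W" "P = convex hull W" and min: "\<And>K. ?Q K \<Longrightarrow> card W \<le> card K" by simp_all
  have "w extreme_point_of P" if w: "w \<in> W" for w
  proof -
    have "w \<notin> convex hull (W - {w})"
    proof
      assume *: "w \<in> convex hull (W - {w})"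
      have "convex hull W = convex hull (W - {w})"
        using hull_redundant[OF *] w by (simp add: insert_absorb)
      then have "card W \<le> card (W - {w})" using W by (intro min) simp
      then show False using card_Diff1_less[OF W(1) w] by simp
    qed
    then have "w extreme_point_of (convex hull (insert w (W - {w})))"
      using W(1) by (intro extreme_point_of_convex_hull_insert) auto
    then show ?thesis using w W(2) by (simp add: insert_absorb)
  qed
  moreover have "w \<in> W" if "w extreme_point_of P" for w
    using that W(2) extreme_point_of_convex_hull by blast
  ultimately have "vertices P = W" by (auto simp: vertices_def)
  then show "finite (vertices P)" "P = convex hull (vertices P)" using W by simp_all
qed

section \<open>Facets through a vertex and simplicial normal cones\<close>

context hpolyhedron
begin

text \<open>Irredundancy yields a direction that keeps \<open>g\<close> constant and strictly
  decreases every other generator. A short step along it reaches a point whose active rows are all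
  multiples of \<open>g\<close>, from which every direction orthogonal to \<open>g\<close> is
  feasible.\<close>

lemma facet_relative_interior_point:
  assumes v: "v \<in> P" and "finite G" and N: "normal_cone n P v = gen_cone G"
    and minimal: "\<And>g. g \<in> G \<Longrightarrow> g \<notin> gen_cone (G - {g})"
    and d0: "d0 \<in> Rn n" "\<And>g. g \<in> G \<Longrightarrow> g \<bullet> d0 < 0" and g: "g \<in> G"
  shows "\<exists>x\<in>P. g \<bullet> x = g \<bullet> v \<and> (\<forall>y\<in>Rn n. g \<bullet> y = 0 \<longrightarrow> (\<exists>e>0. x + e *\<^sub>R y \<in> P))"
proof -
  have GR: "h \<in> Rn n" if "h \<in> G" for h
    using gen_cone_base[OF \<open>finite G\<close> that] N[symmetric] by (simp add: normal_cone_def)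
  obtain d' where d': "\<forall>h\<in>G - {g}. h \<bullet> d' \<le> 0" "g \<bullet> d' > 0"
    using separating_functional_gen_cone[OF _ minimal[OF g]] \<open>finite G\<close> by auto
  define d1 where "d1 = proj_Rn n d'"
  have d1: "d1 \<in> Rn n" "\<And>h. h \<in> G - {g} \<Longrightarrow> h \<bullet> d1 \<le> 0" "g \<bullet> d1 > 0"
    using d' GR g by (auto simp: d1_def proj_Rn_in inner_proj_Rn)
  \<comment> \<open>\<open>d0\<close> decreases all generators and \<open>d1\<close> increases only
    \<open>g\<close>; this multiple makes the two effects on \<open>g\<close> cancel.\<close>
  define t where "t = - (g \<bullet> d0) / (g \<bullet> d1)"
  have t: "t > 0" using d1(3) d0(2)[OF g] by (simp add: t_def divide_neg_pos)
  define d where "d = d0 + t *\<^sub>R d1"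
  have dR: "d \<in> Rn n" using d0 d1 by (auto simp: d_def intro!: subspace_add subspace_scale subspace_Rn)
  have gd: "g \<bullet> d = 0" using d1(3) by (simp add: d_def t_def inner_diff_right)
  have hd: "h \<bullet> d < 0" if "h \<in> G - {g}" for h
    using d0(2)[of h] d1(2)[OF that] t that by (simp add: d_def inner_add_right add_neg_nonpos mult_nonneg_nonpos)
  have row: "a i \<bullet> d \<le> 0 \<and> (a i \<bullet> d = 0 \<longrightarrow> (\<exists>s. a i = s *\<^sub>R g))" if "i \<in> active v" for i
  proof -
    have "a i \<in> gen_cone G"
      unfolding N[symmetric] normal_cone_eq_gen_cone[OF v] using that finite_active by (auto intro: gen_cone_base)
    then obtain z where z: "\<forall>h\<in>G. 0 \<le> z h" "a i = (\<Sum>h\<in>G. z h *\<^sub>R h)" by (auto simp: gen_cone_def)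
    have "a i \<bullet> d = (\<Sum>h\<in>G. z h * (h \<bullet> d))" unfolding z(2) by (simp add: inner_sum_left)
    also have "\<dots> = (\<Sum>h\<in>G - {g}. z h * (h \<bullet> d))" using g \<open>finite G\<close> gd by (simp add: sum.remove)
    finally have eq: "a i \<bullet> d = (\<Sum>h\<in>G - {g}. z h * (h \<bullet> d))" .
    have le: "z h * (h \<bullet> d) \<le> 0" if "h \<in> G - {g}" for h
      using z(1) hd[OF that] that by (simp add: mult_nonneg_nonpos)
    then have "a i \<bullet> d \<le> 0" unfolding eq by (intro sum_nonpos)
    moreover have "\<exists>s. a i = s *\<^sub>R g" if "a i \<bullet> d = 0"
    proof -
      have "(\<Sum>h\<in>G - {g}. - (z h * (h \<bullet> d))) = 0" using that eq by (simp add: sum_negf)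
      then have "\<forall>h\<in>G - {g}. - (z h * (h \<bullet> d)) = 0"
        using \<open>finite G\<close> le by (subst (asm) sum_nonneg_eq_0_iff) auto
      then have "z h = 0" if "h \<in> G - {g}" for h using that hd[OF that] by auto
      then have "(\<Sum>h\<in>G - {g}. z h *\<^sub>R h) = 0" by (intro sum.neutral) simp
      then have "a i = z g *\<^sub>R g" unfolding z(2) using g \<open>finite G\<close> by (simp add: sum.remove)
      then show ?thesis by blast
    qed
    ultimately show ?thesis by blast
  qed
  obtain e where e: "e > 0" "v + e *\<^sub>R d \<in> P" using feasible_step[OF v dR] row by blast
  \<comment> \<open>Half the admissible step: a row active at the midpoint must be active at both
    ends, hence is constant along \<open>d\<close>.\<close>
  define x where "x = v + (e / 2) *\<^sub>R d"
  have x: "x = (1/2) *\<^sub>R v + (1/2) *\<^sub>R (v + e *\<^sub>R d)"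
    by (simp add: x_def algebra_simps flip: scaleR_left_distrib)
  have xP: "x \<in> P" unfolding x using convex_P v e(2) by (auto simp: convex_def)
  have "\<exists>s. a i = s *\<^sub>R g" if "i \<in> active x" for i
  proof -
    have i: "i < m" "a i \<bullet> x = b i" using that by (auto simp: active_def)
    have "a i \<bullet> v \<le> b i" "a i \<bullet> (v + e *\<^sub>R d) \<le> b i" using v e(2) i by (auto simp: P_def)
    moreover have "a i \<bullet> v + a i \<bullet> (v + e *\<^sub>R d) = 2 * b i"
      using i(2) by (simp add: x_def inner_add_right)
    ultimately have "a i \<bullet> v = b i" "a i \<bullet> (v + e *\<^sub>R d) = b i" by auto
    then have "i \<in> active v" "a i \<bullet> d = 0" using i e(1) by (auto simp: active_def inner_add_right)
    then show ?thesis using row by blast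
  qed
  then have "\<exists>e>0. x + e *\<^sub>R y \<in> P" if "y \<in> Rn n" "g \<bullet> y = 0" for y
    using that by (intro feasible_step xP) force+
  moreover have "g \<bullet> x = g \<bullet> v" using gd by (simp add: x_def inner_add_right)
  ultimately show ?thesis using xP by blast
qed

text \<open>Small steps from \<open>x\<close> along an orthonormal basis of the hyperplane stay in
  the face, which gives \<open>k + 1\<close> affinely independent points in it.\<close>

lemma is_facet_of_relative_interior_point:
  assumes dimP: "has_aff_dim P n" and n: "n = Suc k" and g: "g \<in> Rn n" "norm g = 1"
    and le: "\<And>x. x \<in> P \<Longrightarrow> g \<bullet> x \<le> \<beta>"
    and x: "x \<in> P" "g \<bullet> x = \<beta>" "\<And>y. y \<in> Rn n \<Longrightarrow> g \<bullet> y = 0 \<Longrightarrow> \<exists>e>0. x + e *\<^sub>R y \<in> P"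
  shows "is_facet (P \<inter> {x. g \<bullet> x = \<beta>}) P"
proof -
  let ?F = "P \<inter> {x. g \<bullet> x = \<beta>}" and ?b = "adapted_basis k g"
  have g': "g \<in> Rn (Suc k)" "norm g = 1" using g n by auto
  note orth = orthonormal_adapted_basis[OF g'] and sp = span_adapted_basis_hyperplane[OF g']
  have face: "?F face_of P" using convex_P le by (rule face_of_Int_supporting_hyperplane_le)
  have bi: "?b i \<in> Rn n" "g \<bullet> ?b i = 0" if "i < k" for i
    using sp span_base[of "?b i" "?b ` {..<k}"] that n by (auto simp: inner_commute)
  have "\<forall>i\<in>{..<k}. \<exists>e>0. x + e *\<^sub>R ?b i \<in> P" using x(3) bi by blast
  then obtain \<eta> where \<eta>: "\<And>i. i < k \<Longrightarrow> \<eta> i > 0 \<and> x + \<eta> i *\<^sub>R ?b i \<in> P" by (metis lessThan_iff)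
  define C where "C = (\<lambda>i. \<eta> i *\<^sub>R ?b i) ` {..<k}"
  have bb: "?b i \<bullet> ?b j = (if i = j then 1 else 0)" if "i < k" "j < k" for i j
    using orth[of k] that by (simp add: orthonormal_upto_def)
  have nz: "\<eta> i *\<^sub>R ?b i \<noteq> 0" if "i < k" for i using \<eta>[OF that] bb[OF that that] by auto
  have inj: "inj_on (\<lambda>i. \<eta> i *\<^sub>R ?b i) {..<k}"
  proof (rule inj_onI)
    fix i j assume ij: "i \<in> {..<k}" "j \<in> {..<k}" "\<eta> i *\<^sub>R ?b i = \<eta> j *\<^sub>R ?b j"
    have *: "\<eta> i * (?b i \<bullet> ?b i) = \<eta> j * (?b j \<bullet> ?b i)" by (metis ij(3) inner_scaleR_left)
    have "\<eta> i \<noteq> 0" "?b i \<bullet> ?b i = 1" using \<eta>[of i] bb[of i i] ij(1) by auto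
    with * have "?b j \<bullet> ?b i \<noteq> 0" by force
    then show "i = j" using bb[of j i] ij(1,2) by (cases "i = j") auto
  qed
  have indep: "independent C"
  proof (rule pairwise_orthogonal_independent)
    show "pairwise orthogonal C"
      unfolding C_def pairwise_def orthogonal_def using bb by auto
    show "0 \<notin> C" unfolding C_def using nz by force
  qed
  have spC: "span C = span (?b ` {..<k})"
  proof (rule antisym; rule span_minimal)
    show "C \<subseteq> span (?b ` {..<k})" by (auto simp: C_def intro!: span_scale[OF span_base])
    show "?b ` {..<k} \<subseteq> span C"
    proof
      fix y assume "y \<in> ?b ` {..<k}"
      then obtain i where i: "i < k" "y = ?b i" by auto
      have "(1 / \<eta> i) *\<^sub>R (\<eta> i *\<^sub>R ?b i) \<in> span C" using i by (intro span_scale span_base) (auto simp: C_def)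
      then show "y \<in> span C" using i \<eta>[OF i(1)] by simp
    qed
  qed (auto simp: subspace_span)
  define B where "B = insert x ((\<lambda>y. x + y) ` C)"
  have shift: "(\<lambda>y. - x + y) ` (\<lambda>y. x + y) ` C = C" by (simp add: image_image)
  have xC: "x \<notin> (\<lambda>y. x + y) ` C" using nz by (force simp: C_def)
  have "finite C" by (simp add: C_def)
  have "\<not> affine_dependent B" unfolding B_def affine_dependent_iff_dependent[OF xC] shift using indep by simp
  moreover have "card B = k + 1"
    using xC \<open>finite C\<close> inj by (simp add: B_def card_image C_def)
  moreover have "affine hull B = affine hull ?F"
  proof (rule antisym; rule hull_minimal)
    have "B \<subseteq> ?F"
      using x \<eta> bi by (auto simp: B_def C_def inner_add_right)
    then show "B \<subseteq> affine hull ?F" using hull_subset[of ?F affine] by blast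
    show "?F \<subseteq> affine hull B"
    proof
      fix y assume y: "y \<in> ?F"
      have "y - x \<in> {x \<in> Rn (Suc k). x \<bullet> g = 0}"
        using x(1,2) y n
        by (auto simp: P_def inner_diff_right inner_commute[of _ g] intro!: subspace_diff subspace_Rn)
      then have "y - x \<in> span C" unfolding spC sp .
      then show "y \<in> affine hull B"
        unfolding B_def affine_hull_insert_span_gen shift by (auto intro!: image_eqI[of _ _ "y - x"])
    qed
  qed (auto simp: affine_affine_hull)
  ultimately have "has_aff_dim ?F k" unfolding has_aff_dim_def
    using \<open>finite C\<close> by (intro exI[of _ B]) (auto simp: B_def)
  then show ?thesis using face dimP n unfolding is_facet_def by auto
qed

text \<open>Distinct irredundant generators expose distinct facets through \<open>v\<close>.
  Simplicity leaves room for at most n of them, while spanning \<open>Rn n\<close> needs at least n,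
  so they form a basis.\<close>

lemma normal_cone_simplicial:
  assumes dimP: "has_aff_dim P n" and n: "n = Suc k" and "is_simple P" and v: "v extreme_point_of P"
  obtains G where "finite G" "card G = n" "independent G" "span G = Rn n" "\<And>g. g \<in> G \<Longrightarrow> norm g = 1"
    "normal_cone n P v = gen_cone G" "ray_generators (normal_cone n P v) = G"
proof -
  have vP: "v \<in> P" using v by (simp add: extreme_point_of_def)
  obtain G where G: "finite G" "\<And>g. g \<in> G \<Longrightarrow> norm g = 1" "gen_cone G = gen_cone (a ` active v)"
    and minimal: "\<And>g. g \<in> G \<Longrightarrow> g \<notin> gen_cone (G - {g})"
    using minimal_unit_generators[of "a ` active v"] finite_active by (metis finite_imageI)
  have N: "normal_cone n P v = gen_cone G" using G(3) normal_cone_eq_gen_cone[OF vP] by simp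
  obtain d0 where d0: "d0 \<in> Rn n" "\<And>c. c \<in> normal_cone n P v \<Longrightarrow> c \<noteq> 0 \<Longrightarrow> c \<bullet> d0 < 0"
    using strictly_feasible_direction[OF dimP vP] by blast
  have Gd0: "g \<bullet> d0 < 0" if "g \<in> G" for g
    using d0(2)[of g] gen_cone_base[OF G(1) that] G(2)[OF that] N by force
  have GN: "g \<in> normal_cone n P v" if "g \<in> G" for g using gen_cone_base[OF G(1) that] N by simp
  then have GR: "g \<in> Rn n" if "g \<in> G" for g using that by (auto simp: normal_cone_def)
  have rays: "ray_generators (normal_cone n P v) = G"
    unfolding N using G minimal Gd0 by (intro ray_generators_gen_cone[where d = d0]) auto
  have "a ` active v \<subseteq> span G"
    using gen_cone_subset_span[of G] gen_cone_base[of "a ` active v"] finite_active unfolding G(3) by blast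
  then have "Rn n \<subseteq> span G" using vertex_active_span[OF v] span_minimal[OF _ subspace_span] by blast
  moreover have "span G \<subseteq> Rn n" using GR by (intro span_minimal subspace_Rn) auto
  ultimately have span: "span G = Rn n" by simp
  let ?F = "\<lambda>g. P \<inter> {x. g \<bullet> x = g \<bullet> v}"
  have pt: "\<exists>x\<in>P. g \<bullet> x = g \<bullet> v \<and> (\<forall>y\<in>Rn n. g \<bullet> y = 0 \<longrightarrow> (\<exists>e>0. x + e *\<^sub>R y \<in> P))" if "g \<in> G" for g
    by (rule facet_relative_interior_point[OF vP G(1) N minimal d0(1) Gd0 that])
  have facet: "is_facet (?F g) P" if gG: "g \<in> G" for g
  proof -
    obtain x where "x \<in> P" "g \<bullet> x = g \<bullet> v" "\<forall>y\<in>Rn n. g \<bullet> y = 0 \<longrightarrow> (\<exists>e>0. x + e *\<^sub>R y \<in> P)"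
      using pt[OF gG] by blast
    then show ?thesis
      using GN[OF gG] GR[OF gG] G(2)[OF gG]
      by (intro is_facet_of_relative_interior_point[OF dimP n, of g "g \<bullet> v" x]) (auto simp: normal_cone_def)
  qed
  have inj: "inj_on ?F G"
  proof (rule inj_onI)
    fix g h assume gh: "g \<in> G" "h \<in> G" "?F g = ?F h"
    obtain x where x: "x \<in> P" "g \<bullet> x = g \<bullet> v" "\<forall>y\<in>Rn n. g \<bullet> y = 0 \<longrightarrow> (\<exists>e>0. x + e *\<^sub>R y \<in> P)"
      using pt[OF gh(1)] by blast
    have hx: "h \<bullet> x = h \<bullet> v" using gh(3) x by blast
    \<comment> \<open>The face of \<open>g\<close> contains a small step from \<open>x\<close> in
      each direction orthogonal to \<open>g\<close>. If \<open>h\<close> exposes the same face, it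
      is constant along these directions and is therefore a multiple of \<open>g\<close>.\<close>
    have orth: "h \<bullet> y = 0" if y: "y \<in> Rn n" "g \<bullet> y = 0" for y
    proof -
      obtain e where e: "e > 0" "x + e *\<^sub>R y \<in> P" using x(3) y by blast
      then have "x + e *\<^sub>R y \<in> ?F g" using x(2) y(2) by (simp add: inner_add_right)
      then have "x + e *\<^sub>R y \<in> ?F h" using gh(3) by simp
      then show ?thesis using hx e by (simp add: inner_add_right)
    qed
    define y where "y = h - (g \<bullet> h) *\<^sub>R g"
    have gg: "g \<bullet> g = 1" using G(2)[OF gh(1)] by (simp add: norm_eq_sqrt_inner)
    have "y \<in> Rn n" using GR gh by (auto simp: y_def intro!: subspace_diff subspace_scale subspace_Rn)
    moreover have gy: "g \<bullet> y = 0" using gg by (simp add: y_def inner_diff_right)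
    ultimately have "h \<bullet> y = 0" by (rule orth)
    then have "y \<bullet> y = 0" using gy by (simp add: y_def inner_diff_left)
    then have h: "h = (g \<bullet> h) *\<^sub>R g" by (simp add: y_def)
    then have "\<bar>g \<bullet> h\<bar> = 1" using G(2)[OF gh(1)] G(2)[OF gh(2)] by (metis mult.right_neutral norm_scaleR)
    \<comment> \<open>Being unit vectors, \<open>h\<close> and \<open>g\<close> agree up to sign;
      \<open>d0\<close>, negative on both, excludes opposite signs.\<close>
    moreover have "g \<bullet> h > 0"
    proof -
      have "h \<bullet> d0 = (g \<bullet> h) * (g \<bullet> d0)" by (metis h inner_scaleR_left)
      then show ?thesis using Gd0[OF gh(1)] Gd0[OF gh(2)] by (metis mult_neg_neg not_less_iff_gr_or_eq mult_zero_left less_asym)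
    qed
    ultimately show "g = h" using h by simp
  qed
  have cardF: "card {F. is_facet F P \<and> v \<in> F} = n"
  proof -
    obtain d where d: "has_aff_dim P d" "\<forall>v\<in>vertices P. card {F. is_facet F P \<and> v \<in> F} = d"
      using \<open>is_simple P\<close> by (auto simp: is_simple_def)
    then have "d = n" using has_aff_dim_unique dimP by blast
    with d v show ?thesis by (simp add: vertices_def)
  qed
  \<comment> \<open>An infinite set has cardinality 0, so the positive count given by simplicity
    forces finiteness.\<close>
  then have finF: "finite {F. is_facet F P \<and> v \<in> F}" using n by (intro card_ge_0_finite) simp
  have "?F ` G \<subseteq> {F. is_facet F P \<and> v \<in> F}" using facet vP by auto
  then have "card (?F ` G) \<le> n" unfolding cardF[symmetric] by (rule card_mono[OF finF])
  then have le: "card G \<le> n" by (simp add: card_image[OF inj])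
  have "independent G"
    unfolding dependent_def
  proof
    assume "\<exists>g\<in>G. g \<in> span (G - {g})"
    then obtain g where g: "g \<in> G" "g \<in> span (G - {g})" by blast
    then have "span (G - {g}) = span G" using span_redundant[of g "G - {g}"] by (simp add: insert_absorb)
    then have "n \<le> card (G - {g})" using G(1) span by (intro card_spanning_Rn) auto
    then show False using le card_Diff1_less[OF G(1) g(1)] by simp
  qed
  moreover have "card G = n" using le card_spanning_Rn[OF G(1), of n] span by simp
  ultimately show thesis using that G span N rays by blast
qed

end

section \<open>Inner facet normals of a simplicial cone\<close>

lemma facet_normal_exists:
  assumes "finite G" "independent G" "span G = Rn n" "g \<in> G"
  shows "\<exists>\<nu>\<in>Rn n. norm \<nu> = 1 \<and> g \<bullet> \<nu> > 0 \<and> (\<forall>h\<in>G - {g}. h \<bullet> \<nu> = 0)"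
proof -
  have "g \<notin> span (G - {g})" using assms by (auto simp: dependent_def)
  then obtain d where d: "\<forall>h\<in>G - {g}. h \<bullet> d = 0" "g \<bullet> d > 0"
    using separating_functional_span[of "G - {g}" g] assms(1) by auto
  have GR: "h \<in> Rn n" if "h \<in> G" for h using span_base[OF that] assms(3) by simp
  let ?e = "proj_Rn n d"
  have e: "\<forall>h\<in>G - {g}. h \<bullet> ?e = 0" "g \<bullet> ?e > 0" using d GR assms(4) by (auto simp: inner_proj_Rn)
  then have "?e \<noteq> 0" by auto
  with e show ?thesis
    by (intro bexI[of _ "sgn ?e"]) (auto simp: sgn_div_norm norm_sgn intro!: subspace_scale subspace_Rn proj_Rn_in)
qed

text \<open>Up to positive factors the \<nu> form the dual basis, so
  \<open>x \<bullet> \<nu> g\<close> has the sign of the coefficient of \<open>g\<close> in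
  \<open>x\<close>.\<close>

lemma mem_gen_cone_iff_facet_normals:
  assumes "finite G" "span G = Rn n" and x: "x \<in> Rn n"
    and \<nu>: "\<And>g. g \<in> G \<Longrightarrow> g \<bullet> \<nu> g > 0" "\<And>g h. g \<in> G \<Longrightarrow> h \<in> G \<Longrightarrow> h \<noteq> g \<Longrightarrow> h \<bullet> \<nu> g = 0"
  shows "x \<in> gen_cone G \<longleftrightarrow> (\<forall>g\<in>G. 0 \<le> x \<bullet> \<nu> g)"
proof -
  have comb: "(\<Sum>h\<in>G. z h *\<^sub>R h) \<bullet> \<nu> g = z g * (g \<bullet> \<nu> g)" if "g \<in> G" for z g
  proof -
    have "(\<Sum>h\<in>G. z h *\<^sub>R h) \<bullet> \<nu> g = z g * (g \<bullet> \<nu> g) + (\<Sum>h\<in>G - {g}. z h * (h \<bullet> \<nu> g))"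
      unfolding sum.remove[OF assms(1) that, of "\<lambda>h. z h *\<^sub>R h"] by (simp add: inner_add_left inner_sum_left)
    also have "(\<Sum>h\<in>G - {g}. z h * (h \<bullet> \<nu> g)) = 0" using \<nu>(2)[OF that] by (intro sum.neutral) auto
    finally show ?thesis by simp
  qed
  show ?thesis
  proof
    assume "x \<in> gen_cone G"
    then obtain z where "\<forall>g\<in>G. 0 \<le> z g" "x = (\<Sum>g\<in>G. z g *\<^sub>R g)" by (auto simp: gen_cone_def)
    then show "\<forall>g\<in>G. 0 \<le> x \<bullet> \<nu> g" using \<nu>(1) by (auto simp: comb less_imp_le)
  next
    assume nonneg: "\<forall>g\<in>G. 0 \<le> x \<bullet> \<nu> g"
    have "x \<in> span G" using x assms(2) by simp
    then obtain z where z: "x = (\<Sum>g\<in>G. z g *\<^sub>R g)" using span_finite[OF assms(1)] by auto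
    have "0 \<le> z g" if "g \<in> G" for g
    proof -
      have "0 \<le> z g * (g \<bullet> \<nu> g)" using nonneg that unfolding comb[OF that, symmetric] z by blast
      then show ?thesis using \<nu>(1)[OF that] by (simp add: zero_le_mult_iff)
    qed
    then show "x \<in> gen_cone G" using z by (auto simp: gen_cone_def)
  qed
qed

lemma infdist_facet_normal:
  assumes "finite G" "span G = Rn n" and g: "g \<in> G"
    and \<nu>: "\<nu> \<in> Rn n" "norm \<nu> = 1" "g \<bullet> \<nu> > 0" "\<And>h. h \<in> G \<Longrightarrow> h \<noteq> g \<Longrightarrow> h \<bullet> \<nu> = 0"
  shows "infdist g (span (G - {g})) = g \<bullet> \<nu>"
proof -
  have perp: "x \<bullet> \<nu> = 0" if "x \<in> span (G - {g})" for x
    using that by (induction rule: span_induct_alt) (auto simp: inner_add_left \<nu>(4))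
  have \<nu>\<nu>: "\<nu> \<bullet> \<nu> = 1" using \<nu>(2) by (simp add: norm_eq_sqrt_inner)
  define p where "p = g - (g \<bullet> \<nu>) *\<^sub>R \<nu>"
  have pR: "p \<in> Rn n" using \<nu>(1) span_base[OF g] assms(2)
    by (auto simp: p_def intro!: subspace_diff subspace_scale subspace_Rn)
  have p\<nu>: "p \<bullet> \<nu> = 0" using \<nu>\<nu> by (simp add: p_def inner_diff_left)
  have "p \<in> span (insert g (G - {g}))" using pR assms(2) g by (simp add: insert_absorb)
  then have "\<exists>t. p - t *\<^sub>R g \<in> span (G - {g})" unfolding span_insert by (rule CollectD)
  then obtain t where t: "p - t *\<^sub>R g \<in> span (G - {g})" ..
  \<comment> \<open>\<nu> annihilates \<open>p\<close> and the other generators but not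
    \<open>g\<close>. Hence \<open>t = 0\<close>, and the foot of the perpendicular lies in the span
    of the others, not merely in the hyperplane.\<close>
  have "t * (g \<bullet> \<nu>) = 0" using perp[OF t] p\<nu> by (simp add: inner_diff_left)
  then have p: "p \<in> span (G - {g})" using t \<nu>(3) by simp
  show ?thesis
  proof (rule antisym)
    have "infdist g (span (G - {g})) \<le> dist g p" using p by (rule infdist_le)
    also have "\<dots> = g \<bullet> \<nu>" using \<nu> by (simp add: p_def dist_norm)
    finally show "infdist g (span (G - {g})) \<le> g \<bullet> \<nu>" .
    show "g \<bullet> \<nu> \<le> infdist g (span (G - {g}))"
    proof -
      have ne: "span (G - {g}) \<noteq> {}" using span_zero by blast
      have "g \<bullet> \<nu> \<le> dist g x" if "x \<in> span (G - {g})" for x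
        using Cauchy_Schwarz_ineq2[of "g - x" \<nu>] perp[OF that] \<nu>(2) by (simp add: inner_diff_left dist_norm)
      then show ?thesis unfolding infdist_notempty[OF ne] by (intro cINF_greatest[OF ne])
    qed
  qed
qed

section \<open>Random planes and cones\<close>

lemma orthonormal_upto_unit_vec: "orthonormal_upto n unit_vec"
  by (simp add: orthonormal_upto_def inner_unit_vec_unit_vec)

lemma closed_Rn: "closed (Rn n)"
proof -
  have "Rn n = (\<Inter>i\<in>{n..}. {x. unit_vec i \<bullet> x = 0})" by (auto simp: Rn_def inner_unit_vec)
  moreover have "closed {x. unit_vec i \<bullet> x = 0}" for i
    by (intro closed_Collect_eq continuous_intros)
  ultimately show ?thesis by auto
qed

text \<open>
  The plane spanned by \<open>u\<close> and \<open>v\<close> meets the hyperplane orthogonal to \<open>\<nu>\<close> in the line through this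
  vector, unless it is contained in the hyperplane and the vector is \<open>0\<close>.
\<close>

definition crossing :: "'a::real_inner \<Rightarrow> 'a \<times> 'a \<Rightarrow> 'a" where
  "crossing \<nu> = (\<lambda>(u, v). (v \<bullet> \<nu>) *\<^sub>R u - (u \<bullet> \<nu>) *\<^sub>R v)"

lemma crossing_orthogonal: "crossing \<nu> p \<bullet> \<nu> = 0"
  by (simp add: crossing_def case_prod_beta inner_diff_left mult.commute)

lemma crossing_measurable [measurable]:
  "crossing (\<nu> :: 'a::{real_inner, second_countable_topology}) \<in> borel_measurable borel"
  unfolding crossing_def borel_prod[symmetric] by measurable

lemma crossing_reflect:
  assumes "w \<bullet> \<nu> = 0"
  shows "crossing \<nu> (reflect w u, reflect w v) = reflect w (crossing \<nu> (u, v))"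
proof -
  have "reflect w \<nu> = \<nu>" using assms by (simp add: reflect_fixes inner_commute)
  then have "reflect w x \<bullet> \<nu> = x \<bullet> \<nu>" for x by (simp only: inner_reflect_left)
  then show ?thesis
    by (simp add: crossing_def linear_diff[OF reflect_linear] linear_cmul[OF reflect_linear])
qed

lemma crossing_eq_0_iff:
  assumes "(u, v) \<in> orthonormal_pairs n"
  shows "crossing \<nu> (u, v) = 0 \<longleftrightarrow> u \<bullet> \<nu> = 0 \<and> v \<bullet> \<nu> = 0"
proof
  have *: "u \<bullet> u = 1" "v \<bullet> v = 1" "u \<bullet> v = 0" using assms by (auto simp: orthonormal_pairs_def norm_eq_1)
  assume 0: "crossing \<nu> (u, v) = 0"
  have "crossing \<nu> (u, v) \<bullet> u = v \<bullet> \<nu>" "crossing \<nu> (u, v) \<bullet> v = - (u \<bullet> \<nu>)"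
    using * by (auto simp: crossing_def inner_diff_left inner_commute[of v u])
  then show "u \<bullet> \<nu> = 0 \<and> v \<bullet> \<nu> = 0" using 0 by simp
qed (simp add: crossing_def)

lemma plane_meets_hyperplane:
  assumes "crossing \<nu> (u, v) \<noteq> 0" "(\<alpha> *\<^sub>R u + \<beta> *\<^sub>R v) \<bullet> \<nu> = 0"
  shows "\<exists>t. \<alpha> *\<^sub>R u + \<beta> *\<^sub>R v = t *\<^sub>R crossing \<nu> (u, v)"
proof -
  define p q where "p = u \<bullet> \<nu>" and "q = v \<bullet> \<nu>"
  have c: "crossing \<nu> (u, v) = q *\<^sub>R u - p *\<^sub>R v" by (simp add: crossing_def p_def q_def)
  have pq: "p\<^sup>2 + q\<^sup>2 \<noteq> 0" using assms(1) unfolding c by (auto simp: sum_power2_eq_zero_iff)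
  have 0: "\<alpha> * p + \<beta> * q = 0" using assms(2) by (simp add: p_def q_def inner_add_left)
  \<comment> \<open>The vector of coefficients is orthogonal to \<open>(p, q)\<close>, hence a
    multiple of \<open>(q, - p)\<close>; this is the factor.\<close>
  define t where "t = (\<alpha> * q - \<beta> * p) / (p\<^sup>2 + q\<^sup>2)"
  have "(\<alpha> * q - \<beta> * p) * q = \<alpha> * (p\<^sup>2 + q\<^sup>2) - p * (\<alpha> * p + \<beta> * q)"
    and "- ((\<alpha> * q - \<beta> * p) * p) = \<beta> * (p\<^sup>2 + q\<^sup>2) - q * (\<alpha> * p + \<beta> * q)"
    by (simp_all add: power2_eq_square algebra_simps)
  then have "t * q = \<alpha>" "- (t * p) = \<beta>" using pq 0 by (simp_all add: t_def field_simps)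
  then have "\<alpha> *\<^sub>R u + \<beta> *\<^sub>R v = t *\<^sub>R (q *\<^sub>R u - p *\<^sub>R v)" by (auto simp: algebra_simps)
  then show ?thesis using c by auto
qed

section \<open>Distributions derived from the random pair\<close>

locale random_orthonormal_pair =
  fixes n k :: nat and M :: "(rvec \<times> rvec) measure"
  assumes uniform: "uniform_orthonormal_pair n M" and n_Suc: "n = Suc k" and k_pos: "0 < k"
begin

lemma prob_M: "prob_space M"
  and sets_M: "sets M = sets (restrict_space borel (orthonormal_pairs n))"
  using uniform by (auto simp: uniform_orthonormal_pair_def)

lemma space_M: "space M = orthonormal_pairs n"
  using sets_eq_imp_space_eq[OF sets_M] by (simp add: space_restrict_space)

lemma measurable_M: "f \<in> measurable borel N \<Longrightarrow> f \<in> measurable M N"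
  by (subst measurable_cong_sets[OF sets_M refl]) (rule measurable_restrict_space1)

lemma reflect_pair_measurable:
  assumes "w \<in> Rn n"
  shows "map_prod (reflect w) (reflect w) \<in> measurable M M"
proof -
  have "map_prod (reflect w) (reflect w) \<in> measurable (borel :: (rvec \<times> rvec) measure) borel"
    unfolding map_prod_def borel_prod[symmetric] by measurable
  moreover have "map_prod (reflect w) (reflect w) ` orthonormal_pairs n \<subseteq> orthonormal_pairs n"
    using assms by (auto simp: orthonormal_pairs_def reflect_in_subspace[OF subspace_Rn] inner_reflect_left)
  ultimately have "map_prod (reflect w) (reflect w) \<in> measurable
      (restrict_space borel (orthonormal_pairs n)) (restrict_space borel (orthonormal_pairs n))"
    by (intro measurable_restrict_space3) auto
  then show ?thesis by (subst measurable_cong_sets[OF sets_M sets_M])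
qed

text \<open>An equivariant function passes the invariance of the pair on to its own distribution. It
  is applied to the first vector and to the direction of the crossing line.\<close>

lemma emeasure_distr_reflect:
  fixes f :: "rvec \<times> rvec \<Rightarrow> rvec"
  assumes f: "f \<in> borel_measurable borel" and w: "w \<in> Rn n"
    and eqv: "\<And>u v. f (reflect w u, reflect w v) = reflect w (f (u, v))" and A: "A \<in> sets borel"
  shows "emeasure (distr M borel f) (reflect w -` A) = emeasure (distr M borel f) A"
proof -
  let ?T = "map_prod (reflect w) (reflect w)"
  note fM = measurable_M[OF f] and T = reflect_pair_measurable[OF w]
  have rA: "reflect w -` A \<in> sets borel" using measurable_sets[OF reflect_measurable A] by simp
  have inv: "distr M M ?T = M"
    using uniform orthogonal_transformation_reflect reflect_image_subspace[OF subspace_Rn w]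
    unfolding uniform_orthonormal_pair_def by blast
  have fA: "f -` A \<inter> space M \<in> sets M" using fM A by (rule measurable_sets)
  have "emeasure (distr M borel f) A = emeasure M (f -` A \<inter> space M)" by (rule emeasure_distr[OF fM A])
  also have "\<dots> = emeasure (distr M M ?T) (f -` A \<inter> space M)" by (simp add: inv)
  also have "\<dots> = emeasure M (?T -` (f -` A \<inter> space M) \<inter> space M)" by (rule emeasure_distr[OF T fA])
  also have "?T -` (f -` A \<inter> space M) \<inter> space M = f -` (reflect w -` A) \<inter> space M"
    using measurable_space[OF T] by (auto simp: eqv)
  also have "emeasure M \<dots> = emeasure (distr M borel f) (reflect w -` A)"
    by (rule emeasure_distr[OF fM rA, symmetric])
  finally show ?thesis by simp
qed

text \<open>The first vector is uniform on the sphere, so the chance of hitting the hyperplane is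
  its volume fraction, namely 0.\<close>

lemma AE_fst_not_in_hyperplane:
  assumes \<nu>: "\<nu> \<in> Rn n" "norm \<nu> = 1"
  shows "AE p in M. fst p \<bullet> \<nu> \<noteq> 0"
proof -
  have \<nu>': "\<nu> \<in> Rn (Suc k)" using \<nu> n_Suc by simp
  let ?b = "adapted_basis k \<nu>" and ?C = "{x. x \<bullet> \<nu> = 0}" and ?\<rho> = "distr M borel fst"
  note orth = orthonormal_adapted_basis[OF \<nu>' \<nu>(2)]
  have span: "span (?b ` {..<Suc k}) = Rn n" unfolding n_Suc by (rule span_adapted_basis[OF \<nu>' \<nu>(2)])
  have fst_b: "fst \<in> measurable (borel :: (rvec \<times> rvec) measure) borel"
    unfolding borel_prod[symmetric] by measurable
  note fst = measurable_M[OF fst_b]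
  have C: "closed ?C" by (intro closed_Collect_eq continuous_intros)
  have "measure ?\<rho> ?C = cone_frac (Suc k) ?b ?C"
  proof (rule rotation_invariant_eq_cone_frac[OF orth])
    show "prob_space ?\<rho>" by (rule prob_space.prob_space_distr[OF prob_M fst])
    have "{x \<in> space borel. x \<in> Rn n \<and> norm x = 1} \<in> sets borel"
      using closed_Rn[of n] by (simp add: closed_Collect_eq) measurable
    moreover have "AE p in M. fst p \<in> Rn n \<and> norm (fst p) = 1"
      by (rule AE_I2) (auto simp: space_M orthonormal_pairs_def)
    ultimately show "AE x in ?\<rho>. x \<in> span (?b ` {..<Suc k}) \<and> norm x = 1"
      unfolding span by (subst AE_distr_iff[OF fst])
    show "emeasure ?\<rho> (reflect w -` A) = emeasure ?\<rho> A"
      if "w \<in> span (?b ` {..<Suc k})" "A \<in> sets borel" for w A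
      using that unfolding span by (intro emeasure_distr_reflect fst_b) auto
  qed (use C in auto)
  also have "\<dots> = 0"
  proof -
    have "emeasure (subspace_leb (Suc k) ?b) ?C = 0"
      using emeasure_subspace_leb_hyperplane[OF orth, of k] adapted_basis_last[OF \<nu>' \<nu>(2)] by simp
    then have "emeasure (subspace_leb (Suc k) ?b) (?C \<inter> cball 0 1) = 0"
      by (rule emeasure_eq_0[rotated 1]) (use C in auto)
    then show ?thesis by (simp add: cone_frac_def measure_def)
  qed
  finally have "measure M (fst -` ?C \<inter> space M) = 0" using C by (subst (asm) measure_distr[OF fst]) auto
  moreover have "fst -` ?C \<inter> space M \<in> sets M" using C by (intro measurable_sets[OF fst]) auto
  ultimately show ?thesis
    using prob_M by (subst AE_iff_measurable[of "fst -` ?C \<inter> space M"])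
      (auto simp: finite_measure.emeasure_eq_measure prob_space.finite_measure)
qed

lemma AE_crossing_nonzero:
  assumes "\<nu> \<in> Rn n" "norm \<nu> = 1"
  shows "AE p in M. crossing \<nu> p \<noteq> 0"
  using AE_fst_not_in_hyperplane[OF assms] AE_space
proof eventually_elim
  case (elim p)
  then show ?case using crossing_eq_0_iff[of "fst p" "snd p" n \<nu>] by (simp add: space_M)
qed

text \<open>Reflections in vectors of the hyperplane fix \<nu> and commute with
  \<open>crossing\<close>, so its direction is uniform on the unit sphere of the hyperplane, whose
  dimension \<open>k\<close> is positive.\<close>

lemma prob_crossing:
  assumes \<nu>: "\<nu> \<in> Rn n" "norm \<nu> = 1"
    and C: "closed C" and cone: "\<And>x t. x \<in> C \<Longrightarrow> 0 \<le> t \<Longrightarrow> t *\<^sub>R x \<in> C"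
  shows "measure M {p \<in> space M. crossing \<nu> p \<in> C} = cone_frac k (adapted_basis k \<nu>) C"
proof -
  have \<nu>': "\<nu> \<in> Rn (Suc k)" using \<nu> n_Suc by simp
  let ?b = "adapted_basis k \<nu>" and ?f = "\<lambda>p. sgn (crossing \<nu> p)"
  let ?\<rho> = "distr M borel ?f"
  note orth = orthonormal_adapted_basis[OF \<nu>' \<nu>(2)]
  have span: "span (?b ` {..<k}) = {x \<in> Rn n. x \<bullet> \<nu> = 0}"
    unfolding n_Suc by (rule span_adapted_basis_hyperplane[OF \<nu>' \<nu>(2)])
  have f_b: "?f \<in> borel_measurable borel" unfolding sgn_div_norm by measurable
  note f = measurable_M[OF f_b]
  have "measure ?\<rho> C = cone_frac k ?b C"
  proof (rule rotation_invariant_eq_cone_frac[OF orth k_pos])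
    show "prob_space ?\<rho>" by (rule prob_space.prob_space_distr[OF prob_M f])
    have "closed {x \<in> Rn n. x \<bullet> \<nu> = 0}"
      using closed_Rn by (intro closed_Collect_conj closed_Collect_eq continuous_intros) auto
    then have [measurable]: "{x \<in> Rn n. x \<bullet> \<nu> = 0} \<in> sets borel" by simp
    have "{x \<in> space borel. x \<in> {x \<in> Rn n. x \<bullet> \<nu> = 0} \<and> norm x = 1} \<in> sets borel" by measurable
    moreover have "AE p in M. ?f p \<in> {x \<in> Rn n. x \<bullet> \<nu> = 0} \<and> norm (?f p) = 1"
      using AE_crossing_nonzero[OF \<nu>] AE_space
    proof eventually_elim
      case (elim p)
      have "crossing \<nu> p \<in> Rn n"
        using elim(2) unfolding space_M crossing_def
        by (auto simp: orthonormal_pairs_def intro!: subspace_diff subspace_scale subspace_Rn)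
      then show ?case using elim(1) crossing_orthogonal[of \<nu> p]
        by (auto simp: norm_sgn) (auto simp: sgn_div_norm intro!: subspace_scale subspace_Rn)
    qed
    ultimately show "AE x in ?\<rho>. x \<in> span (?b ` {..<k}) \<and> norm x = 1"
      unfolding span by (subst AE_distr_iff[OF f])
    show "emeasure ?\<rho> (reflect w -` A) = emeasure ?\<rho> A"
      if "w \<in> span (?b ` {..<k})" "A \<in> sets borel" for w A
      using that unfolding span
      by (intro emeasure_distr_reflect f_b) (auto simp: crossing_reflect sgn_reflect)
  qed (use C cone in auto)
  moreover have "measure ?\<rho> C = measure M (?f -` C \<inter> space M)" using C by (intro measure_distr[OF f]) auto
  moreover have "?f -` C \<inter> space M = {p \<in> space M. crossing \<nu> p \<in> C}"
  proof -
    have "sgn x \<in> C \<longleftrightarrow> x \<in> C" for x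
    proof
      assume "sgn x \<in> C"
      then have "norm x *\<^sub>R sgn x \<in> C" by (intro cone) auto
      then show "x \<in> C" by (cases "x = 0") (auto simp: sgn_div_norm)
    qed (simp add: sgn_div_norm cone)
    then show ?thesis by auto
  qed
  ultimately show ?thesis by simp
qed

end

text \<open>Move within the plane along a line on which the functional \<open>d\<close> keeps its
  negative value, so the origin is never met. Since neither the direction nor its negative stays in
  the pointed cone, the line leaves the cone through a facet.\<close>

lemma plane_meets_facet:
  assumes "finite G" "span G = Rn n"
    and \<nu>: "\<And>g. g \<in> G \<Longrightarrow> g \<bullet> \<nu> g > 0" "\<And>g h. g \<in> G \<Longrightarrow> h \<in> G \<Longrightarrow> h \<noteq> g \<Longrightarrow> h \<bullet> \<nu> g = 0"
    and pointed: "\<And>x. x \<in> gen_cone G \<Longrightarrow> x \<noteq> 0 \<Longrightarrow> x \<bullet> d < 0"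
    and uv: "(u, v) \<in> orthonormal_pairs n"
    and x: "\<alpha> *\<^sub>R u + \<beta> *\<^sub>R v \<in> gen_cone G" "\<alpha> *\<^sub>R u + \<beta> *\<^sub>R v \<noteq> 0"
  shows "\<exists>g\<in>G. \<exists>\<alpha> \<beta>. \<alpha> *\<^sub>R u + \<beta> *\<^sub>R v \<noteq> 0 \<and> \<alpha> *\<^sub>R u + \<beta> *\<^sub>R v \<in> gen_cone G \<and> (\<alpha> *\<^sub>R u + \<beta> *\<^sub>R v) \<bullet> \<nu> g = 0"
proof -
  note mem = mem_gen_cone_iff_facet_normals[OF assms(1,2) _ \<nu>]
  have R: "s *\<^sub>R u + t *\<^sub>R v \<in> Rn n" for s t
    using uv by (auto simp: orthonormal_pairs_def intro!: subspace_add subspace_scale subspace_Rn)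
  define x where "x = \<alpha> *\<^sub>R u + \<beta> *\<^sub>R v"
  \<comment> \<open>The direction in the plane orthogonal to \<open>d\<close>, that is
    \<open>crossing d (u, v)\<close>.\<close>
  define z where "z = (v \<bullet> d) *\<^sub>R u + (- (u \<bullet> d)) *\<^sub>R v"
  have xd: "x \<bullet> d < 0" using pointed x by (simp add: x_def)
  have zd: "z \<bullet> d = 0" by (simp add: z_def inner_diff_left)
  have "z \<noteq> 0"
  proof
    assume "z = 0"
    then have "crossing d (u, v) = 0" by (simp add: z_def crossing_def)
    then have "u \<bullet> d = 0 \<and> v \<bullet> d = 0" using crossing_eq_0_iff[OF uv] by blast
    with xd show False by (simp add: x_def inner_add_left)
  qed
  then have "z \<notin> gen_cone G" using pointed[of z] zd by auto
  moreover have zR: "z \<in> Rn n" and xR: "x \<in> Rn n" using R by (simp_all only: z_def x_def)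
  ultimately obtain g0 where g0: "g0 \<in> G" "z \<bullet> \<nu> g0 < 0" using mem[of z] by (auto simp: not_le)
  define J where "J = {g \<in> G. z \<bullet> \<nu> g < 0}"
  define r where "r g = (x \<bullet> \<nu> g) / (- (z \<bullet> \<nu> g))" for g
  have J: "finite J" "J \<noteq> {}" using assms(1) g0 by (auto simp: J_def)
  \<comment> \<open>A ratio test: the first time at which a decreasing facet inequality becomes
    tight, so all the others still hold.\<close>
  define t where "t = Min (r ` J)"
  have "t \<in> r ` J" unfolding t_def using J by (intro Min_in) auto
  then obtain g where g: "g \<in> G" "z \<bullet> \<nu> g < 0" "t = r g" by (auto simp: J_def)
  have x\<nu>: "x \<bullet> \<nu> h \<ge> 0" if "h \<in> G" for h using mem[OF xR] x(1) that by (simp add: x_def)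
  have "t \<ge> 0" using g x\<nu>[OF g(1)] by (simp add: r_def divide_nonneg_neg)
  define y where "y = x + t *\<^sub>R z"
  have y: "y = (\<alpha> + t * (v \<bullet> d)) *\<^sub>R u + (\<beta> + t * (- (u \<bullet> d))) *\<^sub>R v"
    by (simp add: y_def x_def z_def algebra_simps)
  have "y \<bullet> \<nu> h \<ge> 0" if h: "h \<in> G" for h
  proof (cases "z \<bullet> \<nu> h < 0")
    case True
    then have "t \<le> r h" unfolding t_def using J h by (intro Min_le) (auto simp: J_def)
    then have "t * (- (z \<bullet> \<nu> h)) \<le> x \<bullet> \<nu> h" 
      using True unfolding r_def by (subst (asm) pos_le_divide_eq) auto
    then show ?thesis by (simp add: y_def inner_add_left)
  next
    case False
    then show ?thesis using x\<nu>[OF h] \<open>t \<ge> 0\<close> by (simp add: y_def inner_add_left)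
  qed
  moreover have "y \<in> Rn n" unfolding y by (rule R)
  ultimately have "y \<in> gen_cone G" using mem[of y] by blast
  moreover have "y \<bullet> \<nu> g = 0" using g by (simp add: y_def inner_diff_left r_def)
  moreover have "y \<bullet> d < 0" using xd zd by (simp add: y_def inner_add_left)
  then have "y \<noteq> 0" by auto
  ultimately show ?thesis unfolding y using g(1) by blast
qed

section \<open>Vertices of shadows\<close>

lemma extreme_point_of_convex_hull_iff_separated:
  fixes S :: "'a::euclidean_space set"
  assumes "finite S" "x \<in> S"
  shows "x extreme_point_of (convex hull S) \<longleftrightarrow> (\<exists>c. \<forall>y\<in>S. y \<noteq> x \<longrightarrow> c \<bullet> y < c \<bullet> x)"
proof -
  have ins: "insert x (S - {x}) = S" using assms(2) by (simp add: insert_absorb)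
  show ?thesis
  proof
    assume ext: "x extreme_point_of (convex hull S)"
    have "x \<notin> convex hull (S - {x})"
    proof
      assume "x \<in> convex hull (S - {x})"
      then have "convex hull S = convex hull (S - {x})" using hull_redundant[of x convex "S - {x}"] ins by simp
      then show False using ext extreme_point_of_convex_hull[of x "S - {x}"] by simp
    qed
    moreover have "closed (convex hull (S - {x}))"
      using assms(1) by (intro compact_imp_closed finite_imp_compact_convex_hull) auto
    ultimately obtain a b where ab: "a \<bullet> x < b" "\<forall>y\<in>convex hull (S - {x}). a \<bullet> y > b"
      using separating_hyperplane_closed_point[OF convex_convex_hull] by blast
    then have "(- a) \<bullet> y < (- a) \<bullet> x" if "y \<in> S" "y \<noteq> x" for y
      using that hull_inc[of y "S - {x}" convex] by force
    then show "\<exists>c. \<forall>y\<in>S. y \<noteq> x \<longrightarrow> c \<bullet> y < c \<bullet> x" by blast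
  next
    assume "\<exists>c. \<forall>y\<in>S. y \<noteq> x \<longrightarrow> c \<bullet> y < c \<bullet> x"
    then obtain c where c: "\<forall>y\<in>S. y \<noteq> x \<longrightarrow> c \<bullet> y < c \<bullet> x" by blast
    have "convex hull (S - {x}) \<subseteq> {y. c \<bullet> y < c \<bullet> x}"
      using c by (intro hull_minimal convex_halfspace_lt) auto
    then have "x extreme_point_of (convex hull (insert x (S - {x})))"
      using assms(1) by (intro extreme_point_of_convex_hull_insert) auto
    then show "x extreme_point_of (convex hull S)" unfolding ins .
  qed
qed

section \<open>Projection to the shadow plane\<close>

definition proj_pair :: "rvec \<times> rvec \<Rightarrow> rvec \<Rightarrow> real \<times> real" where
  "proj_pair p x = (fst p \<bullet> x, snd p \<bullet> x)"

lemma inner_proj_pair: "c \<bullet> proj_pair p x = (fst c *\<^sub>R fst p + snd c *\<^sub>R snd p) \<bullet> x"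
  by (simp add: proj_pair_def inner_prod_def inner_add_left)

lemma shadow_convex_hull: "shadow u v (convex hull V) = convex hull (proj_pair (u, v) ` V)"
proof -
  have "linear (proj_pair (u, v))"
    by (rule linearI) (auto simp: proj_pair_def inner_add_right)
  then show ?thesis
    unfolding shadow_def proj_pair_def by (simp add: convex_hull_linear_image)
qed

text \<open>Several points of \<open>V\<close> may share a projection, so strict separation is
  demanded only from points projecting elsewhere.\<close>

lemma vertices_shadow:
  assumes "finite V"
  shows "vertices (shadow u v (convex hull V)) = proj_pair (u, v) ` {x \<in> V.
    \<exists>c. \<forall>y\<in>V. proj_pair (u, v) y \<noteq> proj_pair (u, v) x \<longrightarrow> c \<bullet> proj_pair (u, v) y < c \<bullet> proj_pair (u, v) x}"
proof -
  let ?\<pi> = "proj_pair (u, v)"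
  have "q extreme_point_of (convex hull (?\<pi> ` V)) \<longleftrightarrow> q \<in> ?\<pi> ` V \<and> (\<exists>c. \<forall>y\<in>?\<pi> ` V. y \<noteq> q \<longrightarrow> c \<bullet> y < c \<bullet> q)" for q
    using extreme_point_of_convex_hull[of q "?\<pi> ` V"]
      extreme_point_of_convex_hull_iff_separated[of "?\<pi> ` V" q] assms by blast
  then show ?thesis unfolding shadow_convex_hull vertices_def by (intro set_eqI) (simp only: mem_Collect_eq, blast)
qed

lemma card_vertices_shadow_le:
  assumes "finite V" and P: "P = convex hull V" "P \<subseteq> Rn n" and uv: "(u, v) \<in> orthonormal_pairs n"
  shows "card (vertices (shadow u v P))
    \<le> card {x \<in> V. \<exists>\<alpha> \<beta>. \<alpha> *\<^sub>R u + \<beta> *\<^sub>R v \<noteq> 0 \<and> \<alpha> *\<^sub>R u + \<beta> *\<^sub>R v \<in> normal_cone n P x}" (is "_ \<le> card ?X")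
proof -
  let ?\<pi> = "proj_pair (u, v)"
  have nz: "\<alpha> *\<^sub>R u + \<beta> *\<^sub>R v \<noteq> 0" if "(\<alpha>, \<beta>) \<noteq> (0, 0)" for \<alpha> \<beta> :: real
  proof
    assume 0: "\<alpha> *\<^sub>R u + \<beta> *\<^sub>R v = 0"
    have *: "u \<bullet> u = 1" "v \<bullet> v = 1" "u \<bullet> v = 0" using uv by (auto simp: orthonormal_pairs_def norm_eq_1)
    have "(\<alpha> *\<^sub>R u + \<beta> *\<^sub>R v) \<bullet> u = \<alpha>" "(\<alpha> *\<^sub>R u + \<beta> *\<^sub>R v) \<bullet> v = \<beta>"
      using * by (auto simp: inner_add_left inner_commute[of v u])
    then show False using that unfolding 0 by simp
  qed
  have "vertices (shadow u v P) \<subseteq> ?\<pi> ` ?X"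
  proof
    fix q assume "q \<in> vertices (shadow u v P)"
    then obtain x c where x: "x \<in> V" "q = ?\<pi> x" and c: "\<forall>y\<in>V. ?\<pi> y \<noteq> ?\<pi> x \<longrightarrow> c \<bullet> ?\<pi> y < c \<bullet> ?\<pi> x"
      unfolding P(1) vertices_shadow[OF assms(1)] by blast
    \<comment> \<open>The separating functional may be 0 when all of \<open>V\<close> projects to
      one point. Then every functional is maximal there, and a nonzero one is substituted to get a
      nonzero vector of the plane.\<close>
    define c' where "c' = (if c = 0 then (1, 0) else c)"
    have c': "c' \<noteq> 0" by (auto simp: c'_def zero_prod_def)
    have le: "c' \<bullet> ?\<pi> y \<le> c' \<bullet> ?\<pi> x" if "y \<in> V" for y
      using c that by (cases "?\<pi> y = ?\<pi> x") (auto simp: c'_def less_imp_le)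
    let ?w = "fst c' *\<^sub>R u + snd c' *\<^sub>R v"
    have "V \<subseteq> {y. ?w \<bullet> y \<le> ?w \<bullet> x}" using le inner_proj_pair[of c' "(u, v)"] by auto
    then have "P \<subseteq> {y. ?w \<bullet> y \<le> ?w \<bullet> x}" unfolding P(1) by (intro hull_minimal convex_halfspace_le)
    moreover have "?w \<in> Rn n" using uv
      by (auto simp: orthonormal_pairs_def intro!: subspace_add subspace_scale subspace_Rn)
    ultimately have "?w \<in> normal_cone n P x" by (auto simp: normal_cone_def)
    moreover have "?w \<noteq> 0" using nz[of "fst c'" "snd c'"] c' by (auto simp: zero_prod_def prod_eq_iff)
    ultimately show "q \<in> ?\<pi> ` ?X" using x by blast
  qed
  then have "card (vertices (shadow u v P)) \<le> card (?\<pi> ` ?X)" using assms(1) by (intro card_mono) auto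
  also have "\<dots> \<le> card ?X" using assms(1) by (intro card_image_le) auto
  finally show ?thesis .
qed

lemma continuous_inner_proj_pair: "continuous_on UNIV (\<lambda>p. c \<bullet> proj_pair p x)"
  unfolding proj_pair_def inner_prod_def by (auto intro!: continuous_intros)

lemma closed_proj_pair_eq: "closed {p. proj_pair p y = proj_pair p x}"
  unfolding proj_pair_def by (intro closed_Collect_eq continuous_intros)

lemmas borel_proj_pair_eq = borel_closed[OF closed_proj_pair_eq]

text \<open>
  Once the set \<open>W\<close> of points whose projection differs from that of \<open>x\<close> is fixed, strict separation
  of \<open>x\<close> from \<open>W\<close> is an open condition on \<open>p\<close>.
\<close>

lemma borel_proj_pair_extreme:
  assumes "finite V"
  shows "{p. \<exists>c. \<forall>y\<in>V. proj_pair p y \<noteq> proj_pair p x \<longrightarrow> c \<bullet> proj_pair p y < c \<bullet> proj_pair p x} \<in> sets borel"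
proof -
  define E where "E W = (- (\<Union>y\<in>W. {p. proj_pair p y = proj_pair p x})) \<inter> (\<Inter>y\<in>V - W. {p. proj_pair p y = proj_pair p x})
      \<inter> {p. \<exists>c. \<forall>y\<in>W. c \<bullet> proj_pair p y < c \<bullet> proj_pair p x}" for W
  have "{p. \<exists>c. \<forall>y\<in>V. proj_pair p y \<noteq> proj_pair p x \<longrightarrow> c \<bullet> proj_pair p y < c \<bullet> proj_pair p x} = (\<Union>W\<in>Pow V. E W)"
  proof (intro equalityI subsetI)
    fix p assume p: "p \<in> {p. \<exists>c. \<forall>y\<in>V. proj_pair p y \<noteq> proj_pair p x \<longrightarrow> c \<bullet> proj_pair p y < c \<bullet> proj_pair p x}"
    then have "p \<in> E {y \<in> V. proj_pair p y \<noteq> proj_pair p x}" by (auto simp: E_def)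
    then show "p \<in> (\<Union>W\<in>Pow V. E W)" by (rule UN_I[rotated]) simp
  next
    fix p assume "p \<in> (\<Union>W\<in>Pow V. E W)"
    then obtain W where W: "W \<subseteq> V" "p \<in> E W" by (elim UN_E) (use PowD in blast)
    obtain c where c: "\<forall>y\<in>W. c \<bullet> proj_pair p y < c \<bullet> proj_pair p x"
      using W(2) unfolding E_def by blast
    have "y \<in> W" if "y \<in> V" "proj_pair p y \<noteq> proj_pair p x" for y
      using W(2) that unfolding E_def by blast
    with c show "p \<in> {p. \<exists>c. \<forall>y\<in>V. proj_pair p y \<noteq> proj_pair p x \<longrightarrow> c \<bullet> proj_pair p y < c \<bullet> proj_pair p x}"
      by blast
  qed
  moreover have "E W \<in> sets borel" if "W \<in> Pow V" for W
  proof -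
    have fin: "finite W" "finite (V - W)" using that assms by (auto intro: finite_subset)
    have "{p. \<exists>c. \<forall>y\<in>W. c \<bullet> proj_pair p y < c \<bullet> proj_pair p x}
        = (\<Union>c. \<Inter>y\<in>W. {p. c \<bullet> proj_pair p y < c \<bullet> proj_pair p x})" by auto
    moreover have "open (\<Union>c. \<Inter>y\<in>W. {p. c \<bullet> proj_pair p y < c \<bullet> proj_pair p x})"
      by (intro open_UN ballI open_INT open_Collect_less continuous_inner_proj_pair fin(1))
    ultimately have "{p. \<exists>c. \<forall>y\<in>W. c \<bullet> proj_pair p y < c \<bullet> proj_pair p x} \<in> sets borel" by simp
    moreover have "(- (\<Union>y\<in>W. {p. proj_pair p y = proj_pair p x})) \<in> sets borel"
      by (intro borel_comp sets.finite_UN fin(1) borel_proj_pair_eq)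
    moreover have "(\<Inter>y\<in>V - W. {p. proj_pair p y = proj_pair p x}) \<in> sets borel"
      by (intro borel_closed closed_INT ballI closed_proj_pair_eq)
    ultimately show ?thesis unfolding E_def by (intro sets.Int)
  qed
  ultimately show ?thesis using assms by (auto intro!: sets.finite_UN)
qed

text \<open>Points with equal projection must be counted once. Numbering \<open>V\<close> and
  keeping the least-numbered point of each fibre turns the count into a sum of indicators of Borel
  sets.\<close>

lemma borel_measurable_card_vertices_shadow:
  assumes "finite V"
  shows "(\<lambda>(u, v). real (card (vertices (shadow u v (convex hull V))))) \<in> borel_measurable borel"
proof -
  obtain f :: "rvec \<Rightarrow> nat" where f: "inj_on f V"
    using finite_imp_inj_to_nat_seg[OF assms] by blast
  let ?E = "\<lambda>x. {p. \<exists>c. \<forall>y\<in>V. proj_pair p y \<noteq> proj_pair p x \<longrightarrow> c \<bullet> proj_pair p y < c \<bullet> proj_pair p x}"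
  let ?Q = "\<lambda>x. - (\<Union>y\<in>{y \<in> V. f y < f x}. {p. proj_pair p y = proj_pair p x})"
  have Q: "?Q x \<in> sets borel" for x
    using assms by (intro borel_comp sets.finite_UN borel_proj_pair_eq) simp
  have "(\<lambda>(u, v). real (card (vertices (shadow u v (convex hull V))))) = (\<lambda>p. \<Sum>x\<in>V. indicator (?E x \<inter> ?Q x) p)"
  proof
    fix p :: "rvec \<times> rvec"
    obtain u v where p: "p = (u, v)" by (cases p)
    let ?\<pi> = "proj_pair p"
    let ?X = "{x \<in> V. p \<in> ?E x}" and ?Y = "{x \<in> V. p \<in> ?E x \<inter> ?Q x}"
    have inj: "inj_on ?\<pi> ?Y"
    proof (rule inj_onI)
      fix x y assume xy: "x \<in> ?Y" "y \<in> ?Y" "?\<pi> x = ?\<pi> y"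
      have "\<not> f x < f y" "\<not> f y < f x" using xy by fastforce+
      then show "x = y" using f xy by (auto simp: inj_on_def)
    qed
    have "?\<pi> ` ?X = ?\<pi> ` ?Y"
    proof (intro equalityI subsetI)
      fix q assume "q \<in> ?\<pi> ` ?X"
      then obtain x where x: "x \<in> V" "p \<in> ?E x" "q = ?\<pi> x" by blast
      obtain y where y: "y \<in> V \<and> ?\<pi> y = q" and min: "\<And>z. z \<in> V \<and> ?\<pi> z = q \<Longrightarrow> f y \<le> f z"
        using ex_has_least_nat[of "\<lambda>y. y \<in> V \<and> ?\<pi> y = q" x f] x by blast
      have "p \<in> ?Q y" using min y by (auto simp: not_le[symmetric])
      moreover have "p \<in> ?E y" using x(2,3) y by simp
      ultimately show "q \<in> ?\<pi> ` ?Y" using y by blast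
    qed auto
    then have "card (vertices (shadow u v (convex hull V))) = card (?\<pi> ` ?Y)"
      unfolding vertices_shadow[OF assms] by (simp add: p)
    also have "\<dots> = card ?Y" by (rule card_image[OF inj])
    finally have "real (card (vertices (shadow u v (convex hull V)))) = real (card ?Y)" by simp
    also have "real (card ?Y) = (\<Sum>x\<in>V. indicator (?E x \<inter> ?Q x) p)"
      using assms by (simp add: indicator_def sum.If_cases Int_def)
    finally show "(case p of (u, v) \<Rightarrow> real (card (vertices (shadow u v (convex hull V)))))
        = (\<Sum>x\<in>V. indicator (?E x \<inter> ?Q x) p)" by (simp add: p)
  qed
  also have "\<dots> \<in> borel_measurable borel"
    by (intro borel_measurable_sum borel_measurable_indicator sets.Int borel_proj_pair_extreme[OF assms] Q)
  finally show ?thesis .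
qed

section \<open>The expected number of shadow vertices\<close>

text \<open>A functional in two of these cones takes equal values at \<open>v\<close> and
  \<open>w\<close>, so it lies in the null hyperplane orthogonal to \<open>v - w\<close>.\<close>

lemma sum_normal_cone_frac_le_1:
  assumes "n = Suc k" "finite V" "V \<subseteq> Rn n" "V \<subseteq> P" "\<And>w. w \<in> V \<Longrightarrow> closed (normal_cone n P w)"
  shows "(\<Sum>w\<in>V. cone_frac n unit_vec (normal_cone n P w)) \<le> 1"
proof (rule sum_cone_frac_le_1[OF orthonormal_upto_unit_vec assms(2)])
  fix v w assume vw: "v \<in> V" "w \<in> V" "v \<noteq> w"
  define d where "d = sgn (v - w)"
  have d: "d \<in> Rn (Suc k)" "norm d = 1"
    using vw assms(1,3) by (auto simp: d_def norm_sgn) (auto simp: sgn_div_norm intro!: subspace_scale subspace_diff subspace_Rn)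
  have leb: "subspace_leb n unit_vec = subspace_leb (Suc k) (adapted_basis k d)"
    unfolding assms(1) using orthonormal_upto_unit_vec orthonormal_adapted_basis[OF d]
    by (rule subspace_leb_eq) (simp only: span_unit_vec span_adapted_basis[OF d])
  have "{x. x \<bullet> d = 0} \<in> null_sets (subspace_leb n unit_vec)"
    using emeasure_subspace_leb_hyperplane[OF orthonormal_adapted_basis[OF d], of k]
    unfolding leb adapted_basis_last[OF d] by (auto simp: null_sets_def)
  then have "AE x in subspace_leb n unit_vec. x \<notin> {x. x \<bullet> d = 0}" by (rule AE_not_in)
  then show "AE x in subspace_leb n unit_vec. \<not> (x \<in> normal_cone n P v \<and> x \<in> normal_cone n P w)"
  proof eventually_elim
    case (elim x)
    show ?case
    proof
      assume "x \<in> normal_cone n P v \<and> x \<in> normal_cone n P w"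
      then have "x \<bullet> w \<le> x \<bullet> v" "x \<bullet> v \<le> x \<bullet> w" using vw assms(4) by (auto simp: normal_cone_def)
      then have "x \<bullet> d = 0" by (simp add: d_def sgn_div_norm inner_diff_right)
      with elim show False by simp
    qed
  qed
qed (use assms in auto)

lemma expected_shadow_vertices_le:
  assumes "2 \<le> n" and P: "P = polyhedron_of m n A b" and "polytope P" and dimP: "has_aff_dim P n"
    and "is_simple P" and M: "uniform_orthonormal_pair n M"
  shows "integrable M (\<lambda>(u, v). real (card (vertices (shadow u v P))))"
    and "(\<integral>(u, v). real (card (vertices (shadow u v P))) \<partial>M) \<le> 4 * exp 1 * (real n)\<^sup>2 / delta n P"
proof -
  obtain k where n: "n = Suc k" using \<open>2 \<le> n\<close> by (metis Suc_le_D numeral_2_eq_2)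
  have "0 < k" using n \<open>2 \<le> n\<close> by simp
  define a where "a i = (\<Sum>j<n. A i j *\<^sub>R unit_vec j)" for i
  have row: "a i \<bullet> x = (\<Sum>j<n. A i j * coord x j)" for i x
    by (simp add: a_def inner_sum_left inner_unit_vec)
  interpret hpolyhedron n m a b P
  proof
    show "P = {x \<in> Rn n. \<forall>i<m. a i \<bullet> x \<le> b i}" by (simp add: P polyhedron_of_def row)
    show "a i \<in> Rn n" for i
      unfolding a_def by (intro subspace_sum subspace_Rn subspace_scale unit_vec_Rn) auto
  qed
  interpret random_orthonormal_pair n k M
    using M n \<open>0 < k\<close> by unfold_locales
  interpret M: prob_space M by (rule prob_M)
  define V where "V = vertices P"
  have V: "finite V" "P = convex hull V" using polytope_eq_convex_hull_vertices[OF \<open>polytope P\<close>] by (simp_all add: V_def)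
  have PR: "P \<subseteq> Rn n" by (auto simp: P_def)
  have VP: "V \<subseteq> P" by (auto simp: V_def vertices_def extreme_point_of_def)
  define N where "N w = normal_cone n P w" for w
  define G where "G w = ray_generators (N w)" for w
  have G: "finite (G w)" "card (G w) = n" "independent (G w)" "span (G w) = Rn n"
    "\<And>g. g \<in> G w \<Longrightarrow> norm g = 1" "N w = gen_cone (G w)" if w: "w \<in> V" for w
  proof -
    have "w extreme_point_of P" using w by (simp add: V_def vertices_def)
    from normal_cone_simplicial[OF dimP n \<open>is_simple P\<close> this]
    obtain H where "finite H" "card H = n" "independent H" "span H = Rn n" "\<And>g. g \<in> H \<Longrightarrow> norm g = 1"
      "N w = gen_cone H" "ray_generators (N w) = H"
      unfolding N_def by metis
    then show "finite (G w)" "card (G w) = n" "independent (G w)" "span (G w) = Rn n"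
      "\<And>g. g \<in> G w \<Longrightarrow> norm g = 1" "N w = gen_cone (G w)" unfolding G_def by simp_all
  qed
  define \<nu> where "\<nu> w g = (SOME \<nu>. \<nu> \<in> Rn n \<and> norm \<nu> = 1 \<and> g \<bullet> \<nu> > 0 \<and> (\<forall>h\<in>G w - {g}. h \<bullet> \<nu> = 0))" for w g
  have \<nu>: "\<nu> w g \<in> Rn n" "norm (\<nu> w g) = 1" "g \<bullet> \<nu> w g > 0" "\<And>h. h \<in> G w \<Longrightarrow> h \<noteq> g \<Longrightarrow> h \<bullet> \<nu> w g = 0"
    if "w \<in> V" "g \<in> G w" for w g
  proof -
    have "\<exists>\<nu>. \<nu> \<in> Rn n \<and> norm \<nu> = 1 \<and> g \<bullet> \<nu> > 0 \<and> (\<forall>h\<in>G w - {g}. h \<bullet> \<nu> = 0)"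
      using facet_normal_exists[OF G(1,3,4)[OF that(1)] that(2)] by blast
    from someI_ex[OF this] show "\<nu> w g \<in> Rn n" "norm (\<nu> w g) = 1" "g \<bullet> \<nu> w g > 0"
      "\<And>h. h \<in> G w \<Longrightarrow> h \<noteq> g \<Longrightarrow> h \<bullet> \<nu> w g = 0" unfolding \<nu>_def by blast+
  qed
  define \<delta> where "\<delta> = delta n P"
  \<comment> \<open>By \<open>infdist_facet_normal\<close> the infimum runs over finitely many
    positive numbers \<open>g \<bullet> \<nu> w g\<close>, and over at least one since
    \<open>P\<close> has a vertex.\<close>
  have \<delta>: "\<delta> > 0" "\<And>w g. w \<in> V \<Longrightarrow> g \<in> G w \<Longrightarrow> \<delta> \<le> g \<bullet> \<nu> w g"
  proof -
    define D where "D = (\<lambda>(w, g). g \<bullet> \<nu> w g) ` (SIGMA w:V. G w)"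
    have "infdist g (span (G w - {g})) = g \<bullet> \<nu> w g" if "w \<in> V" "g \<in> G w" for w g
      by (rule infdist_facet_normal[OF G(1,4)[OF that(1)] that(2)]) (use \<nu>[OF that] in auto)
    then have "{infdist g (span (G w - {g})) | w g. w \<in> V \<and> g \<in> G w} = D"
      unfolding D_def by force
    then have \<delta>D: "\<delta> = Inf D" by (simp add: \<delta>_def delta_def V_def G_def N_def)
    have "finite D" unfolding D_def using V(1) G(1) by auto
    have "P \<noteq> {}" using dimP by (auto simp: has_aff_dim_def)
    then obtain w where w: "w \<in> V" using V(2) by fastforce
    have "G w \<noteq> {}" using G(2)[OF w] n by auto
    then have "D \<noteq> {}" using w unfolding D_def by blast
    have Min: "Inf D = Min D" using \<open>finite D\<close> \<open>D \<noteq> {}\<close> by (rule cInf_eq_Min)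
    show "\<delta> > 0" unfolding \<delta>D Min using \<open>finite D\<close> \<open>D \<noteq> {}\<close> \<nu>(3) by (auto simp: D_def)
    show "\<delta> \<le> g \<bullet> \<nu> w g" if "w \<in> V" "g \<in> G w" for w g
      unfolding \<delta>D Min using \<open>finite D\<close> that by (intro Min_le) (auto simp: D_def)
  qed
  have N_halfspaces: "N w = {x \<in> Rn n. \<forall>g\<in>G w. 0 \<le> x \<bullet> \<nu> w g}" if w: "w \<in> V" for w
  proof -
    have "x \<in> N w \<longleftrightarrow> (\<forall>g\<in>G w. 0 \<le> x \<bullet> \<nu> w g)" if "x \<in> Rn n" for x
      unfolding G(6)[OF w] using G(1,4)[OF w] that \<nu>(3,4)[OF w] by (rule mem_gen_cone_iff_facet_normals)
    moreover have "N w \<subseteq> Rn n" by (auto simp: N_def normal_cone_def)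
    ultimately show ?thesis by blast
  qed
  have N_closed: "closed (N w)" if w: "w \<in> V" for w
  proof -
    have "N w = Rn n \<inter> (\<Inter>g\<in>G w. {x. 0 \<le> x \<bullet> \<nu> w g})" using N_halfspaces[OF w] by auto
    moreover have "closed {x. 0 \<le> x \<bullet> \<nu> w g}" for g by (intro closed_Collect_le continuous_intros)
    ultimately show ?thesis by (simp only:) (intro closed_Int closed_Rn closed_INT ballI)
  qed
  define F where "F w g = {x \<in> N w. x \<bullet> \<nu> w g = 0}" for w g
  have F_closed: "closed (F w g)" if "w \<in> V" for w g
  proof -
    have "F w g = N w \<inter> {x. x \<bullet> \<nu> w g = 0}" by (auto simp: F_def)
    moreover have "closed {x. x \<bullet> \<nu> w g = 0}" by (intro closed_Collect_eq continuous_intros)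
    ultimately show ?thesis using N_closed[OF that] by auto
  qed
  have N_cone: "t *\<^sub>R x \<in> N w" if "w \<in> V" "x \<in> N w" "0 \<le> t" for w t x
    using that unfolding G(6)[OF that(1)] by (auto intro: gen_cone_scale)
  have F_cone: "t *\<^sub>R x \<in> F w g" if "w \<in> V" "x \<in> F w g" "0 \<le> t" for w g t x
    using that by (auto simp: F_def N_cone)
  \<comment> \<open>The crossing vector is determined by the plane only up to sign, so a plane
    meeting \<open>F\<close> in a ray may have its crossing vector in the opposite facet
    \<open>- F\<close>.\<close>
  define F' where "F' w g = {x. - x \<in> F w g}" for w g
  have F'_closed: "closed (F' w g)" if "w \<in> V" for w g
    unfolding F'_def using continuous_closed_vimage[OF F_closed[OF that], of uminus] by (simp add: vimage_def)
  have F'_cone: "t *\<^sub>R x \<in> F' w g" if "w \<in> V" "x \<in> F' w g" "0 \<le> t" for w g t x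
    using F_cone[OF that(1), of "- x" g t] that by (simp add: F'_def)
  define q where "q w = cone_frac n unit_vec (N w)" for w
  define K where "K = 2 * exp 1 * real n / \<delta>"
  have frac: "cone_frac k (adapted_basis k (\<nu> w g)) (F w g) \<le> K * q w" if w: "w \<in> V" and g: "g \<in> G w" for w g
  proof -
    have \<nu>': "\<nu> w g \<in> Rn (Suc k)" "norm (\<nu> w g) = 1" using \<nu>[OF w g] n by auto
    let ?b = "adapted_basis k (\<nu> w g)"
    note orth = orthonormal_adapted_basis[OF \<nu>']
    have "cone_frac k ?b (F w g) \<le> 2 * exp 1 * real (Suc k) / \<delta> * cone_frac (Suc k) ?b (N w)"
    proof (rule cone_frac_facet_le[OF orth, where g = g])
      show "g \<in> span (?b ` {..<Suc k})"
        unfolding span_adapted_basis[OF \<nu>'] using span_base[OF g] G(4)[OF w] n by simp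
      show "g \<bullet> ?b k \<ge> \<delta>" using \<delta>(2)[OF w g] adapted_basis_last[OF \<nu>'] by simp
      show "x + t *\<^sub>R g \<in> N w" if "x \<in> F w g" "0 \<le> t" for x t
        using that gen_cone_base[OF G(1)[OF w] g] unfolding F_def G(6)[OF w]
        by (auto intro!: gen_cone_add gen_cone_scale)
    qed (use F_closed[OF w] N_closed[OF w] N_cone[OF w] G(5)[OF w g] \<delta>(1) in auto)
    \<comment> \<open>Each facet has its own adapted basis; returning to the standard one lets the
      fractions \<open>q w\<close> be summed over all facets and vertices.\<close>
    moreover have "subspace_leb (Suc k) ?b = subspace_leb (Suc k) unit_vec"
      using orth orthonormal_upto_unit_vec
      by (rule subspace_leb_eq) (simp only: span_unit_vec span_adapted_basis[OF \<nu>'])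
    ultimately show ?thesis by (simp add: K_def q_def cone_frac_def n)
  qed
  define X where "X w g = {p \<in> space M. crossing (\<nu> w g) p \<in> F w g}" for w g
  define Y where "Y w g = {p \<in> space M. crossing (\<nu> w g) p \<in> F' w g}" for w g
  have XY_sets: "X w g \<in> sets M" "Y w g \<in> sets M" if "w \<in> V" for w g
    using measurable_sets[OF measurable_M[OF crossing_measurable[of "\<nu> w g"]], of "F w g"]
      measurable_sets[OF measurable_M[OF crossing_measurable[of "\<nu> w g"]], of "F' w g"]
      F_closed[OF that] F'_closed[OF that]
    by (auto simp: X_def Y_def vimage_def Int_def conj_commute)
  have X: "measure M (X w g) \<le> K * q w" if w: "w \<in> V" and g: "g \<in> G w" for w g
  proof -
    have "measure M (X w g) = cone_frac k (adapted_basis k (\<nu> w g)) (F w g)"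
      unfolding X_def using \<nu>(1,2)[OF w g] F_closed[OF w] F_cone[OF w] by (rule prob_crossing)
    then show ?thesis using frac[OF w g] by simp
  qed
  have Y: "measure M (Y w g) \<le> K * q w" if w: "w \<in> V" and g: "g \<in> G w" for w g
  proof -
    have \<nu>': "\<nu> w g \<in> Rn (Suc k)" "norm (\<nu> w g) = 1" using \<nu>[OF w g] n by auto
    have "measure M (Y w g) = cone_frac k (adapted_basis k (\<nu> w g)) (F' w g)"
      unfolding Y_def using \<nu>(1,2)[OF w g] F'_closed[OF w] F'_cone[OF w] by (rule prob_crossing)
    also have "\<dots> = cone_frac k (adapted_basis k (\<nu> w g)) (F w g)"
      unfolding F'_def using F_closed[OF w] by (intro cone_frac_uminus orthonormal_adapted_basis[OF \<nu>']) auto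
    finally show ?thesis using frac[OF w g] by simp
  qed
  have meets: "\<exists>g\<in>G w. (u, v) \<in> X w g \<union> Y w g"
    if w: "w \<in> V" and uv: "(u, v) \<in> space M" and nz: "\<forall>g\<in>G w. crossing (\<nu> w g) (u, v) \<noteq> 0"
      and x: "\<alpha> *\<^sub>R u + \<beta> *\<^sub>R v \<noteq> 0" "\<alpha> *\<^sub>R u + \<beta> *\<^sub>R v \<in> N w" for w u v \<alpha> \<beta>
  proof -
    obtain d where d: "\<And>c. c \<in> N w \<Longrightarrow> c \<noteq> 0 \<Longrightarrow> c \<bullet> d < 0"
      using strictly_feasible_direction[OF dimP] w VP unfolding N_def by blast
    have "\<exists>g\<in>G w. \<exists>\<alpha> \<beta>. \<alpha> *\<^sub>R u + \<beta> *\<^sub>R v \<noteq> 0 \<and> \<alpha> *\<^sub>R u + \<beta> *\<^sub>R v \<in> gen_cone (G w)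
        \<and> (\<alpha> *\<^sub>R u + \<beta> *\<^sub>R v) \<bullet> \<nu> w g = 0"
      by (rule plane_meets_facet[OF G(1,4)[OF w] \<nu>(3,4)[OF w] d[unfolded G(6)[OF w]]
            uv[unfolded space_M] x(2)[unfolded G(6)[OF w]] x(1)])
    then obtain g s t where g: "g \<in> G w" and y: "s *\<^sub>R u + t *\<^sub>R v \<noteq> 0" "s *\<^sub>R u + t *\<^sub>R v \<in> N w"
      "(s *\<^sub>R u + t *\<^sub>R v) \<bullet> \<nu> w g = 0" unfolding G(6)[OF w] by blast
    define y where "y = s *\<^sub>R u + t *\<^sub>R v"
    define c where "c = crossing (\<nu> w g) (u, v)"
    obtain r where r: "y = r *\<^sub>R c"
      using plane_meets_hyperplane[OF nz[THEN bspec, OF g] y(3)] by (auto simp: y_def c_def)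
    have yF: "y \<in> F w g" using y by (simp add: F_def y_def)
    have "r \<noteq> 0" using r y(1) by (auto simp: y_def)
    then have "c \<in> F w g \<or> - c \<in> F w g"
    proof (cases "r > 0")
      case True
      then have "c = (1 / r) *\<^sub>R y" by (simp add: r)
      then show ?thesis using F_cone[OF w yF, of "1 / r"] True by simp
    next
      case False
      then have "- c = (- (1 / r)) *\<^sub>R y" using \<open>r \<noteq> 0\<close> by (simp add: r)
      then show ?thesis using F_cone[OF w yF, of "- (1 / r)"] False by simp
    qed
    then show ?thesis using g uv by (auto simp: X_def Y_def F'_def c_def)
  qed
  let ?f = "\<lambda>p. real (card (vertices (shadow (fst p) (snd p) P)))"
  let ?h = "\<lambda>p. \<Sum>w\<in>V. \<Sum>g\<in>G w. indicat_real (X w g) p + indicat_real (Y w g) p"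
  have card_le: "card (vertices (shadow u v P))
      \<le> card {w \<in> V. \<exists>\<alpha> \<beta>. \<alpha> *\<^sub>R u + \<beta> *\<^sub>R v \<noteq> 0 \<and> \<alpha> *\<^sub>R u + \<beta> *\<^sub>R v \<in> N w}"
    if "(u, v) \<in> space M" for u v
    unfolding N_def using V PR that[unfolded space_M] by (rule card_vertices_shadow_le)
  have f_meas: "?f \<in> borel_measurable M"
    using measurable_M[OF borel_measurable_card_vertices_shadow[OF V(1)]] V(2) by (simp add: case_prod_beta')
  have f_int: "integrable M ?f"
  proof (rule M.integrable_const_bound[OF _ f_meas])
    show "AE p in M. norm (?f p) \<le> real (card V)"
    proof (rule AE_I2)
      fix p assume "p \<in> space M"
      then have "card (vertices (shadow (fst p) (snd p) P)) \<le> card {w \<in> V. \<exists>\<alpha> \<beta>. \<alpha> *\<^sub>R fst p + \<beta> *\<^sub>R snd p \<noteq> 0 \<and> \<alpha> *\<^sub>R fst p + \<beta> *\<^sub>R snd p \<in> N w}"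
        by (intro card_le) simp
      also have "\<dots> \<le> card V" using V(1) by (intro card_mono) auto
      finally show "norm (?f p) \<le> real (card V)" by simp
    qed
  qed
  \<comment> \<open>Degenerate crossings are excluded for the finitely many facets
    simultaneously.\<close>
  have "AE p in M. \<forall>w\<in>V. \<forall>g\<in>G w. crossing (\<nu> w g) p \<noteq> 0"
    using V(1) G(1) \<nu>(1,2) by (intro AE_finite_allI AE_crossing_nonzero) auto
  then have f_le_h: "AE p in M. ?f p \<le> ?h p"
    using AE_space
  proof eventually_elim
    case (elim p)
    obtain u v where p: "p = (u, v)" by (cases p)
    let ?Z = "{w \<in> V. \<exists>\<alpha> \<beta>. \<alpha> *\<^sub>R u + \<beta> *\<^sub>R v \<noteq> 0 \<and> \<alpha> *\<^sub>R u + \<beta> *\<^sub>R v \<in> N w}"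
    have "?f p \<le> real (card ?Z)" using card_le[of u v] elim(2) by (simp add: p)
    also have "\<dots> = (\<Sum>w\<in>?Z. 1)" by simp
    also have "\<dots> \<le> (\<Sum>w\<in>?Z. \<Sum>g\<in>G w. indicat_real (X w g) p + indicat_real (Y w g) p)"
    proof (rule sum_mono)
      fix w assume "w \<in> ?Z"
      then have w: "w \<in> V" and "\<exists>g\<in>G w. (u, v) \<in> X w g \<union> Y w g"
        using meets[of w u v] elim p by blast+
      then obtain g where g: "g \<in> G w" "p \<in> X w g \<union> Y w g" using p by blast
      have "1 \<le> indicat_real (X w g) p + indicat_real (Y w g) p" using g(2) by (auto simp: indicator_def)
      also have "\<dots> \<le> (\<Sum>g\<in>G w. indicat_real (X w g) p + indicat_real (Y w g) p)"
        using G(1)[OF w] g(1) by (intro member_le_sum) auto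
      finally show "1 \<le> (\<Sum>g\<in>G w. indicat_real (X w g) p + indicat_real (Y w g) p)" .
    qed
    also have "\<dots> \<le> ?h p" using V(1) by (intro sum_mono2) (auto intro!: sum_nonneg)
    finally show ?case .
  qed
  have int_ind: "integrable M (indicat_real S)" if "S \<in> sets M" for S
    using that by (simp add: M.emeasure_eq_measure)
  have h_int: "integrable M ?h"
    using XY_sets by (intro Bochner_Integration.integrable_sum Bochner_Integration.integrable_add int_ind) auto
  have "(\<integral>p. ?f p \<partial>M) \<le> (\<integral>p. ?h p \<partial>M)"
    using f_int h_int f_le_h by (rule integral_mono_AE)
  also have "\<dots> = (\<Sum>w\<in>V. \<Sum>g\<in>G w. measure M (X w g) + measure M (Y w g))"
    using XY_sets int_ind by simp
  also have "\<dots> \<le> (\<Sum>w\<in>V. \<Sum>g\<in>G w. K * q w + K * q w)"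
    using X Y by (intro sum_mono add_mono) auto
  \<comment> \<open>Each cone has n generators, and each of them contributes two orientations
    bounded by \<open>K * q w\<close>.\<close>
  also have "\<dots> = 2 * real n * K * (\<Sum>w\<in>V. q w)"
    unfolding sum_distrib_left by (intro sum.cong) (simp_all add: G(2))
  also have "\<dots> \<le> 2 * real n * K * 1"
  proof (rule mult_left_mono)
    show "(\<Sum>w\<in>V. q w) \<le> 1"
      unfolding q_def N_def
      using n V(1) order_trans[OF VP PR] VP N_closed[unfolded N_def] by (rule sum_normal_cone_frac_le_1)
    show "0 \<le> 2 * real n * K" using \<delta>(1) by (simp add: K_def)
  qed
  also have "\<dots> = 4 * exp 1 * (real n)\<^sup>2 / \<delta>" by (simp add: K_def power2_eq_square)
  finally show "(\<integral>(u, v). real (card (vertices (shadow u v P))) \<partial>M) \<le> 4 * exp 1 * (real n)\<^sup>2 / delta n P"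
    by (simp add: \<delta>_def case_prod_beta')
  show "integrable M (\<lambda>(u, v). real (card (vertices (shadow u v P))))"
    using f_int by (simp add: case_prod_beta')
qed

theorem theorem1p5:
  shows "\<exists>c::real. \<forall>(n::nat) (m::nat) (A :: nat \<Rightarrow> nat \<Rightarrow> real) (b :: nat \<Rightarrow> real)
           (P :: rvec set) (M :: (rvec \<times> rvec) measure).
     2 \<le> n \<longrightarrow> P = polyhedron_of m n A b \<longrightarrow> polytope P \<longrightarrow> has_aff_dim P n \<longrightarrow>
     is_simple P \<longrightarrow> uniform_orthonormal_pair n M \<longrightarrow>
       integrable M (\<lambda>(u, v). real (card (vertices (shadow u v P)))) \<and>
       (\<integral>(u, v). real (card (vertices (shadow u v P))) \<partial>M) \<le> c * (real n)\<^sup>2 / delta n P"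
  using expected_shadow_vertices_le by (intro exI[of _ "4 * exp 1"]) blast

end
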